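(* Let $G=(V,E)$ be a directed or undirected unweighted graph with $n$ nodes and $m$ edges, let $f\geq 1$ be an integer and let $S\subseteq V$. Then one can construct in time $O(f\,n\,m)$ an $f$-FT $S$-sourcewise preserver $H$ of $G$ with $\widetilde{O}\left(f\cdot |S|^{1/2^f}\cdot n^{2-1/2^f}\right)$ edges.
   Context: For a graph $G=(V,E)$ and a set of pairs $P\subseteq V\times V$, a subgraph $H\subseteq G$ is an $f$-fault-tolerant ($f$-FT) $P$-pairwise preserver if $\mathrm{dist}_{H\setminus F}(s,t)=\mathrm{dist}_{G\setminus F}(s,t)$ for every $(s,t)\in P$ and every fault set $F\subseteq E$ with $|F|\leq f$ (distances are $\infty$ if no path exists). An $f$-FT $S$-sourcewise preserver is an $f$-FT $P$-pairwise preserver for $P=S\times V$. The size of $H$ is its number of edges; $\widetilde{O}$ hides polylogarithmic factors in $n$. *)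

theory Defs
  imports
    Complex_Main
    "Graph_Theory.Pair_Digraph"
    "Graph_Theory.Shortest_Path"
begin

section \<open>Graphs, distances and fault-tolerant preservers\<close>

datatype kind = Directed | Undirected

text \<open>
  An edge is represented by the set of arcs along which it can be traversed. Thus a directed and
  an undirected graph are both a vertex set together with a set of edges; an undirected edge
  counts once, and it is deleted in both directions when it fails.
\<close>

type_synonym 'a edge = "('a \<times> 'a) set"

fun edge_of :: "kind \<Rightarrow> 'a \<times> 'a \<Rightarrow> 'a edge" where
  "edge_of Directed (u, v) = {(u, v)}"
| "edge_of Undirected (u, v) = {(u, v), (v, u)}"

definition simple_graph :: "kind \<Rightarrow> 'a set \<Rightarrow> 'a edge set \<Rightarrow> bool" where
  "simple_graph k V E \<longleftrightarrow>
     finite V \<and> E \<subseteq> {edge_of k (u, v) | u v. u \<in> V \<and> v \<in> V \<and> u \<noteq> v}"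

text \<open>Unweighted distance; it is \<open>\<infinity>\<close> (an infimum over the empty set) if there is no walk.\<close>

definition graph_dist :: "'a set \<Rightarrow> 'a edge set \<Rightarrow> 'a \<Rightarrow> 'a \<Rightarrow> ereal" where
  "graph_dist V E s t =
     wf_digraph.\<mu> (with_proj \<lparr>pverts = V, parcs = \<Union>E\<rparr>) (\<lambda>_. 1) s t"

text \<open>A subgraph on the full vertex set \<open>V\<close> is given by its edge set \<open>H\<close>.\<close>

definition ft_pairwise_preserver ::
  "nat \<Rightarrow> 'a set \<Rightarrow> 'a edge set \<Rightarrow> ('a \<times> 'a) set \<Rightarrow> 'a edge set \<Rightarrow> bool" where
  "ft_pairwise_preserver f V E P H \<longleftrightarrow>
     H \<subseteq> E \<and>
     (\<forall>(s, t) \<in> P. \<forall>F \<subseteq> E. card F \<le> f \<longrightarrow>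
        graph_dist V (H - F) s t = graph_dist V (E - F) s t)"

definition ft_sourcewise_preserver ::
  "nat \<Rightarrow> 'a set \<Rightarrow> 'a edge set \<Rightarrow> 'a set \<Rightarrow> 'a edge set \<Rightarrow> bool" where
  "ft_sourcewise_preserver f V E S H \<longleftrightarrow> ft_pairwise_preserver f V E (S \<times> V) H"

section \<open>A word RAM\<close>

text \<open>
  Running time is the number of elementary steps of a program of the following deterministic
  imperative language over natural numbers. A program has finitely many named arrays, and a
  scalar variable \<open>x\<close> is the cell \<open>x[0]\<close>. Assignments and tests each cost one unit: the
  expressions occurring in a fixed program have bounded size, so this is the usual uniform cost
  up to a constant factor that depends on the program only.

  The parameter \<open>W\<close> is the largest value that a memory cell may receive and the largest address
  that may be written to. A program violating this bound is stuck, i.e. it has no execution.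
  Hence no more than a constant number of machine words of \<open>O(log W)\<close> bits is processed
  in one step.
\<close>

type_synonym state = "string \<Rightarrow> nat \<Rightarrow> nat"

datatype aexp =
    Const nat
  | Read string aexp
  | Plus aexp aexp
  | Minus aexp aexp
  | Times aexp aexp
  | Div aexp aexp

datatype bexp =
    Less aexp aexp
  | Neg bexp
  | Conj bexp bexp

datatype com =
    Skip
  | Write string aexp aexp
  | Seq com com
  | Cond bexp com com
  | While bexp com

fun aval :: "aexp \<Rightarrow> state \<Rightarrow> nat" where
  "aval (Const c) s = c"
| "aval (Read x a) s = s x (aval a s)"
| "aval (Plus a b) s = aval a s + aval b s"
| "aval (Minus a b) s = aval a s - aval b s"
| "aval (Times a b) s = aval a s * aval b s"
| "aval (Div a b) s = aval a s div aval b s"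

fun bval :: "bexp \<Rightarrow> state \<Rightarrow> bool" where
  "bval (Less a b) s \<longleftrightarrow> aval a s < aval b s"
| "bval (Neg b) s \<longleftrightarrow> \<not> bval b s"
| "bval (Conj b c) s \<longleftrightarrow> bval b s \<and> bval c s"

text \<open>\<open>exec W c s T s'\<close>: started in \<open>s\<close>, program \<open>c\<close> halts in \<open>s'\<close> after \<open>T\<close> steps.\<close>

inductive exec :: "nat \<Rightarrow> com \<Rightarrow> state \<Rightarrow> nat \<Rightarrow> state \<Rightarrow> bool" for W :: nat where
  Skip: "exec W Skip s 1 s"
| Write: "aval a s \<le> W \<Longrightarrow> aval e s \<le> W \<Longrightarrow>
    exec W (Write x a e) s 1 (s(x := (s x)(aval a s := aval e s)))"
| Seq: "exec W c1 s T1 s1 \<Longrightarrow> exec W c2 s1 T2 s2 \<Longrightarrow> exec W (Seq c1 c2) s (T1 + T2) s2"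
| CondTrue: "bval b s \<Longrightarrow> exec W c1 s T s' \<Longrightarrow> exec W (Cond b c1 c2) s (1 + T) s'"
| CondFalse: "\<not> bval b s \<Longrightarrow> exec W c2 s T s' \<Longrightarrow> exec W (Cond b c1 c2) s (1 + T) s'"
| WhileFalse: "\<not> bval b s \<Longrightarrow> exec W (While b c) s 1 s"
| WhileTrue: "bval b s \<Longrightarrow> exec W c s T1 s1 \<Longrightarrow> exec W (While b c) s1 T2 s2 \<Longrightarrow>
    exec W (While b c) s (1 + T1 + T2) s2"

inductive_cases SkipE: "exec W Skip s T s'"
inductive_cases WriteE: "exec W (Write x a e) s T s'"
inductive_cases SeqE: "exec W (Seq c1 c2) s T s'"
inductive_cases CondE: "exec W (Cond b c1 c2) s T s'"
inductive_cases WhileE: "exec W (While b c) s T s'"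

lemma exec_deterministic:
  "exec W c s T s' \<Longrightarrow> exec W c s T' s'' \<Longrightarrow> T' = T \<and> s'' = s'"
proof (induction arbitrary: T' s'' rule: exec.induct)
  case (Skip s)
  then show ?case by (rule SkipE) simp
next
  case (Write a s e x)
  from Write(3) show ?case by (rule WriteE) simp
next
  case (Seq c1 s T1 s1 c2 T2 s2)
  from Seq.prems show ?case by (rule SeqE) (auto dest!: Seq.IH)
next
  case (CondTrue b s c1 T s' c2)
  from CondTrue.prems show ?case by (rule CondE) (auto simp: CondTrue.hyps(1) dest: CondTrue.IH)
next
  case (CondFalse b s c2 T s' c1)
  from CondFalse.prems show ?case by (rule CondE) (auto simp: CondFalse.hyps(1) dest: CondFalse.IH)
next
  case (WhileFalse b s c)
  from WhileFalse.prems show ?case by (rule WhileE) (simp_all add: WhileFalse.hyps)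
next
  case (WhileTrue b s c T1 s1 T2 s2)
  from WhileTrue.prems show ?case
    by (rule WhileE) (auto simp: WhileTrue.hyps(1) dest!: WhileTrue.IH)
qed

section \<open>Input and output\<close>

text \<open>
  The nodes of an \<open>n\<close>-node graph are \<open>0, \<dots>, n - 1\<close>. The input consists of \<open>n\<close>, \<open>f\<close>, a list of
  the edges (each edge given once, by its two endpoints; in the undirected case in either order)
  and a list of the sources, both in arbitrary order. All other cells are initially zero.
\<close>

definition lists_edges :: "kind \<Rightarrow> (nat \<times> nat) list \<Rightarrow> nat edge set \<Rightarrow> bool" where
  "lists_edges k es E \<longleftrightarrow> distinct (map (edge_of k) es) \<and> set (map (edge_of k) es) = E"

definition array :: "nat list \<Rightarrow> nat \<Rightarrow> nat" where
  "array xs i = (if i < length xs then xs ! i else 0)"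

definition input :: "nat \<Rightarrow> (nat \<times> nat) list \<Rightarrow> nat list \<Rightarrow> nat \<Rightarrow> state" where
  "input n es ss f = (\<lambda>_ _. 0)
     (''n'' := array [n],
      ''m'' := array [length es],
      ''tail'' := array (map fst es),
      ''head'' := array (map snd es),
      ''k'' := array [length ss],
      ''source'' := array ss,
      ''f'' := array [f])"

text \<open>The program outputs a set of edges by marking their positions in the input list.\<close>

definition output_edges :: "kind \<Rightarrow> (nat \<times> nat) list \<Rightarrow> state \<Rightarrow> nat edge set" where
  "output_edges k es s = {edge_of k (es ! i) | i. i < length es \<and> s ''out'' i \<noteq> 0}"

end

theory Submission
  imports Defs
begin

text \<open>
  Every target \<open>t\<close> is treated separately, and only last edges of replacement paths to \<open>t\<close> are kept.
  For a set \<open>S\<close> of sources and \<open>g\<close> possible faults, take a breadth-first search tree towards \<open>t\<close> and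
  keep the last edges of the tree paths from \<open>S\<close>. If a fault hits the tree path from \<open>s\<close>, a
  replacement path leaves the tree, or passes the level \<open>j\<close>, for the last time at a node of \<open>S'\<close>:
  these are the nodes of level \<open>j\<close> and the tree nodes up to level \<open>j\<close>. The rest of the
  replacement path lies in a subgraph without the edges of the tree, which has one fault less, so
  we continue there with the sources \<open>S'\<close> and \<open>g - 1\<close> faults. For the least \<open>j\<close> such that level \<open>j\<close>
  has at most \<open>|S| * j\<close> nodes we get \<open>|S'| = O(sqrt (n * |S|))\<close>, and iterating this bound gives the
  exponents of the theorem. A cutting level replaces the usual random hitting set, so the algorithm
  is deterministic and no logarithmic factor is lost. Each of the \<open>f + 1\<close> stages for a target takes
  linear time.
\<close>

section \<open>Walks and distances\<close>

text \<open>Faults are counted inside the current subgraph only. If an edge on a tree path from some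
  source fails, it is absent from the next subgraph, so at most \<open>g - 1\<close> faults are left
  there, whichever tree edge it was. An undirected edge has to vanish in both directions, which
  shapes the next subgraph: it drops every arc whose head lies on these tree paths, apart from
  \<open>t\<close>, and the arcs into \<open>t\<close> whose tail lies on them. Each tree edge and
  its reverse are of this form.

  The cut level balances two costs. With \<open>a\<close> sources the tree paths have at most
  \<open>a\<close> nodes per level, hence at most \<open>a * j\<close> up to level \<open>j\<close>,
  and a level with at most \<open>a * j\<close> nodes adds no more than this. Earlier levels are
  larger, so \<open>a * j\<^sup>2 \<le> 6 * n\<close>, and the square of \<open>2 * a * j\<close> is
  at most \<open>24 * n * a\<close>.

  A stage may not touch \<open>n\<close> cells if there are fewer edges than nodes. Its loops
  therefore run over the arcs, the queue or the levels, and the last two are bounded by the number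
  of arcs plus one.\<close>

lemma graph_dist_eq_INF:
  assumes "\<Union>E \<subseteq> V \<times> V" "s \<in> V" "t \<in> V"
  shows "graph_dist V E s t = (INF l \<in> {l. (s, t) \<in> (\<Union>E) ^^ l}. ereal (real l))"
proof -
  let ?G = "with_proj \<lparr>pverts = V, parcs = \<Union>E\<rparr>"
  interpret wf_digraph ?G
    using assms(1) by unfold_locales auto
  have walks: "(\<exists>p. awalk u p t \<and> length p = l) \<longleftrightarrow> (u, t) \<in> (\<Union>E) ^^ l" if "u \<in> V" for u l
    using that
  proof (induction l arbitrary: u)
    case 0
    then show ?case using \<open>t \<in> V\<close> by (auto simp: awalk_Nil_iff)
  next
    case (Suc l)
    have "(\<exists>p. awalk u p t \<and> length p = Suc l) \<longleftrightarrow>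
        (\<exists>e p. awalk u (e # p) t \<and> length p = l)"
      by (metis length_Suc_conv)
    also have "\<dots> \<longleftrightarrow> (\<exists>w. (u, w) \<in> \<Union>E \<and> (\<exists>p. awalk w p t \<and> length p = l))"
      by (auto simp: awalk_Cons_iff split_paired_Ex)
    also have "\<dots> \<longleftrightarrow> (\<exists>w. (u, w) \<in> \<Union>E \<and> (w, t) \<in> (\<Union>E) ^^ l)"
      using Suc.IH assms(1) by (metis (no_types, lifting) mem_Sigma_iff subsetD)
    also have "\<dots> \<longleftrightarrow> (u, t) \<in> (\<Union>E) ^^ Suc l"
      by (metis relpow_Suc_D2 relpow_Suc_I2)
    finally show ?case .
  qed
  have cost: "awalk_cost (\<lambda>_. 1) p = real (length p)" for p :: "('a \<times> 'a) list"
    by (induction p) auto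
  have "(\<lambda>p. ereal (awalk_cost (\<lambda>_. 1) p)) ` {p. awalk s p t}
      = (\<lambda>l. ereal (real l)) ` {l. (s, t) \<in> (\<Union>E) ^^ l}"
    using walks[OF \<open>s \<in> V\<close>] by (auto simp: cost image_iff) metis+
  then show ?thesis
    unfolding graph_dist_def \<mu>_def by simp
qed

section \<open>Edge faults acting on arcs\<close>

definition avoiding :: "kind \<Rightarrow> 'a edge set \<Rightarrow> ('a \<times> 'a) set \<Rightarrow> ('a \<times> 'a) set" where
  "avoiding k F R = {p \<in> R. edge_of k p \<notin> F}"

lemma avoiding_mono: "R \<subseteq> R' \<Longrightarrow> avoiding k F R \<subseteq> avoiding k F R'"
  by (auto simp: avoiding_def)

lemma avoiding_subset: "avoiding k F R \<subseteq> R"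
  by (auto simp: avoiding_def)

lemma self_in_edge_of: "p \<in> edge_of k p"
  by (cases k; cases p) auto

lemma edge_of_eqI: "p \<in> edge_of k q \<Longrightarrow> edge_of k p = edge_of k q"
  by (cases k; cases p; cases q) auto

lemma edge_of_eqD: "edge_of k (u, v) = edge_of k (u', v') \<Longrightarrow>
    (u = u' \<and> v = v') \<or> (u = v' \<and> v = u')"
  by (cases k) (auto simp: doubleton_eq_iff set_eq_iff)

lemma simple_graph_edge_eq:
  assumes "simple_graph k V E" "e \<in> E" "p \<in> e"
  shows "edge_of k p = e"
proof -
  obtain u v where "e = edge_of k (u, v)"
    using assms(1,2) unfolding simple_graph_def by blast
  then show ?thesis using edge_of_eqI assms(3) by blast
qed

lemma Union_Diff_eq_avoiding:
  assumes "simple_graph k V E" "E' \<subseteq> E"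
  shows "\<Union>(E' - F) = avoiding k F (\<Union>E')"
  using simple_graph_edge_eq[OF assms(1)] assms(2) unfolding avoiding_def by blast

lemma simple_graph_arc:
  assumes "simple_graph k V E" "(u, v) \<in> \<Union>E"
  shows "u \<in> V" "v \<in> V" "u \<noteq> v"
  using assms unfolding simple_graph_def
  by (cases k; fastforce)+

lemma simple_graph_finite: "simple_graph k V E \<Longrightarrow> finite E"
  unfolding simple_graph_def
  by (auto intro!: finite_subset[of E "(\<lambda>(u, v). edge_of k (u, v)) ` (V \<times> V)"])

section \<open>One target and a bounded number of faults\<close>

text \<open>Only the last edge has to lie in \<open>X\<close>; the walk to \<open>u\<close> may use
  all of \<open>R\<close>, since it is treated when \<open>u\<close> is the target. Comparing with a
  walk of arbitrary length \<open>l\<close> by \<open>l' < l\<close> replaces shortest paths and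
  suits an induction on the length. Faults outside \<open>R\<close> are free.\<close>

definition covers ::
  "kind \<Rightarrow> 'a \<Rightarrow> nat \<Rightarrow> ('a \<times> 'a) set \<Rightarrow> 'a set \<Rightarrow> 'a edge set \<Rightarrow> bool" where
  "covers k t g R S X \<longleftrightarrow>
     (\<forall>F. card (F \<inter> edge_of k ` R) \<le> g \<longrightarrow>
       (\<forall>s \<in> S - {t}. \<forall>l. (s, t) \<in> avoiding k F R ^^ l \<longrightarrow>
          (\<exists>l' u. l' < l \<and> (s, u) \<in> avoiding k F R ^^ l' \<and> (u, t) \<in> avoiding k F R \<and>
             edge_of k (u, t) \<in> X)))"

lemma relpow_trans: "(x, y) \<in> R ^^ a \<Longrightarrow> (y, z) \<in> R ^^ b \<Longrightarrow> (x, z) \<in> R ^^ (a + b)"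
  by (auto simp: relpow_add)

lemma relpow_mono_set: "R \<subseteq> (R' :: 'a rel) \<Longrightarrow> (x, y) \<in> R ^^ l \<Longrightarrow> (x, y) \<in> R' ^^ l"
  by (induction l arbitrary: y) (auto intro: relcompI)

text \<open>
  It suffices to preserve the last edges of the replacement paths: the remaining part of a
  replacement path is a replacement path to the last but one node.
\<close>

lemma ft_sourcewise_preserver_if_covers:
  assumes G: "simple_graph k V E" and "S \<subseteq> V" and "H \<subseteq> E"
    and cov: "\<And>t. t \<in> V \<Longrightarrow> covers k t f (\<Union>E) S H"
  shows "ft_sourcewise_preserver f V E S H"
proof -
  have main: "\<exists>l' \<le> l. (s, t) \<in> (\<Union>(H - F)) ^^ l'"
    if "F \<subseteq> E" "card F \<le> f" "s \<in> S" "t \<in> V" "(s, t) \<in> (\<Union>(E - F)) ^^ l" for F s t l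
    using that(4,5)
  proof (induction l arbitrary: t rule: less_induct)
    case (less l)
    show ?case
    proof (cases "s = t")
      case True
      then show ?thesis by (intro exI[of _ 0]) auto
    next
      case False
      have E: "\<Union>(E - F) = avoiding k F (\<Union>E)"
        using Union_Diff_eq_avoiding[OF G] by simp
      have "finite F" using simple_graph_finite[OF G] that(1) finite_subset by blast
      then have "card (F \<inter> edge_of k ` \<Union>E) \<le> f"
        using card_mono[of F "F \<inter> edge_of k ` \<Union>E"] that(2) by auto
      then obtain l' u where l': "l' < l" "(s, u) \<in> (\<Union>(E - F)) ^^ l'"
        and u: "(u, t) \<in> avoiding k F (\<Union>E)" "edge_of k (u, t) \<in> H"
        using cov[OF less.prems(1)] less.prems(2) \<open>s \<in> S\<close> False
        unfolding covers_def E by blast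
      have "u \<in> V" using simple_graph_arc[OF G] u by (auto simp: avoiding_def)
      from less.IH[OF l'(1) this l'(2)] obtain l'' where "l'' \<le> l'" "(s, u) \<in> (\<Union>(H - F)) ^^ l''"
        by blast
      moreover have "(u, t) \<in> \<Union>(H - F)"
        using u self_in_edge_of[of "(u, t)" k] by (auto simp: avoiding_def)
      ultimately show ?thesis
        using l'(1) by (intro exI[of _ "Suc l''"]) auto
    qed
  qed
  have arcs: "\<Union>E \<subseteq> V \<times> V" using simple_graph_arc(1,2)[OF G] by (intro subrelI) blast
  have "graph_dist V (H - F) s t = graph_dist V (E - F) s t"
    if F: "F \<subseteq> E" "card F \<le> f" and st: "s \<in> S" "t \<in> V" for F s t
  proof -
    have "s \<in> V" using st \<open>S \<subseteq> V\<close> by auto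
    have "graph_dist V (H - F) s t = (INF l \<in> {l. (s, t) \<in> (\<Union>(H - F)) ^^ l}. ereal (real l))"
      using arcs \<open>H \<subseteq> E\<close> by (intro graph_dist_eq_INF \<open>s \<in> V\<close> st) blast
    moreover have "graph_dist V (E - F) s t = (INF l \<in> {l. (s, t) \<in> (\<Union>(E - F)) ^^ l}. ereal (real l))"
      using arcs by (intro graph_dist_eq_INF \<open>s \<in> V\<close> st) blast
    moreover have "(INF l \<in> {l. (s, t) \<in> (\<Union>(H - F)) ^^ l}. ereal (real l)) =
        (INF l \<in> {l. (s, t) \<in> (\<Union>(E - F)) ^^ l}. ereal (real l))"
    proof (rule antisym)
      show "(INF l \<in> {l. (s, t) \<in> (\<Union>(H - F)) ^^ l}. ereal (real l)) \<le>
        (INF l \<in> {l. (s, t) \<in> (\<Union>(E - F)) ^^ l}. ereal (real l))"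
        using main[OF F st] by (intro INF_mono) auto
      show "(INF l \<in> {l. (s, t) \<in> (\<Union>(E - F)) ^^ l}. ereal (real l)) \<le>
        (INF l \<in> {l. (s, t) \<in> (\<Union>(H - F)) ^^ l}. ereal (real l))"
        using relpow_mono_set[of "\<Union>(H - F)" "\<Union>(E - F)"] \<open>H \<subseteq> E\<close>
        by (intro INF_superset_mono) blast+
    qed
    ultimately show ?thesis by simp
  qed
  then show ?thesis
    using \<open>H \<subseteq> E\<close> unfolding ft_sourcewise_preserver_def ft_pairwise_preserver_def by auto
qed

text \<open>The recursion step in isolation from the program. \<open>Rc\<close> are the nodes that
  reach \<open>t\<close>, \<open>lev\<close> and \<open>par\<close> a breadth-first tree towards
  \<open>t\<close>, and \<open>Anc\<close> the nodes other than \<open>t\<close> on tree paths from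
  sources. \<open>Anc_origin\<close> lets no other node into \<open>Anc\<close>, which is what
  bounds its size.\<close>

locale stage =
  fixes k :: kind and t :: 'a and R :: "('a \<times> 'a) set" and S Rc Anc :: "'a set"
    and lev :: "'a \<Rightarrow> nat" and par :: "'a \<Rightarrow> 'a" and j :: nat
  assumes finite_R: "finite R" and finite_Rc: "finite Rc"
    and t_reached: "t \<in> Rc" and lev_t: "lev t = 0"
    and reached: "\<And>u v. (u, v) \<in> R \<Longrightarrow> v \<in> Rc \<Longrightarrow> u \<in> Rc"
    and lev_le: "\<And>u v. (u, v) \<in> R \<Longrightarrow> v \<in> Rc \<Longrightarrow> lev u \<le> Suc (lev v)"
    and par_arc: "\<And>v. v \<in> Rc \<Longrightarrow> v \<noteq> t \<Longrightarrow> (v, par v) \<in> R"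
    and par_reached: "\<And>v. v \<in> Rc \<Longrightarrow> v \<noteq> t \<Longrightarrow> par v \<in> Rc"
    and lev_par: "\<And>v. v \<in> Rc \<Longrightarrow> v \<noteq> t \<Longrightarrow> lev v = Suc (lev (par v))"
    and Anc_subset: "Anc \<subseteq> Rc - {t}"
    and sources_Anc: "S \<inter> Rc - {t} \<subseteq> Anc"
    and Anc_par: "\<And>v. v \<in> Anc \<Longrightarrow> par v \<noteq> t \<Longrightarrow> par v \<in> Anc"
    and Anc_origin: "\<And>v. v \<in> Anc \<Longrightarrow> v \<in> S \<or> (\<exists>u \<in> Anc. par u = v)"
    and j_pos: "1 \<le> j"
begin

text \<open>Except for arcs into \<open>t\<close>, only heads are restricted, as walks must be able
  to start at tree nodes and at level \<open>j\<close>. Arcs into \<open>t\<close> need their own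
  rule because all tree paths end there. For \<open>a\<close> in \<open>Anc\<close>, the arc
  \<open>(a, par a)\<close> is dropped, and so is its reverse, whose head is
  \<open>a\<close>.\<close>

definition R' where
  "R' = {(u, v) \<in> R. if v = t then u \<notin> Anc else v \<in> Rc \<and> lev v < j \<and> v \<notin> Anc}"

definition S' where
  "S' = {v \<in> Rc - {t}. lev v \<le> j \<and> (v \<in> Anc \<or> lev v = j)}"

definition X where
  "X = {edge_of k (u, t) | u. u \<in> Anc \<and> (u, t) \<in> R}"

definition level where "level i = {v \<in> Rc. lev v = i}"

definition num_sources where "num_sources = card (S \<inter> Rc - {t})"

lemma lev_eq_0: "v \<in> Rc \<Longrightarrow> lev v = 0 \<Longrightarrow> v = t"
  using lev_par by fastforce

lemma walk_reached: "(x, t) \<in> R ^^ l \<Longrightarrow> x \<in> Rc \<and> lev x \<le> l"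
proof (induction l arbitrary: x)
  case 0
  then show ?case using t_reached lev_t by auto
next
  case (Suc l)
  then obtain y where "(x, y) \<in> R" "(y, t) \<in> R ^^ l" by (meson relpow_Suc_D2)
  then show ?case using Suc.IH reached lev_le by fastforce
qed

lemma R'_subset: "R' \<subseteq> R" by (auto simp: R'_def)

text \<open>The alternative is a fault anywhere on the tree, not merely on the path from
  \<open>v\<close>, because any such fault lowers the budget of the next stage. The path is cut
  before its last arc, whose edge belongs to \<open>X\<close>.\<close>

lemma tree_path:
  assumes "v \<in> Anc"
  shows "(\<exists>a \<in> Anc. edge_of k (a, par a) \<in> F) \<or>
    (\<exists>u \<in> Anc. (v, u) \<in> avoiding k F R ^^ (lev v - 1) \<and> (u, t) \<in> avoiding k F R)"
  using assms
proof (induction "lev v" arbitrary: v)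
  case 0
  then show ?case using lev_eq_0 Anc_subset by auto
next
  case (Suc l)
  have v: "v \<in> Rc" "v \<noteq> t" using Suc.prems Anc_subset by auto
  show ?case
  proof (cases "edge_of k (v, par v) \<in> F")
    case True
    then show ?thesis using Suc.prems by blast
  next
    case False
    then have arc: "(v, par v) \<in> avoiding k F R"
      using par_arc v by (auto simp: avoiding_def)
    show ?thesis
    proof (cases "par v = t")
      case True
      then have "lev v = 1" using lev_par[OF v] lev_t by simp
      then show ?thesis using arc True Suc.prems by auto
    next
      case False
      then have p: "par v \<in> Anc" using Anc_par Suc.prems by auto
      have l: "l = lev (par v)" using lev_par[OF v] Suc.hyps(2) by simp
      have "lev (par v) \<noteq> 0" using lev_eq_0 par_reached v False by blast
      then have "lev v - 1 = Suc (lev (par v) - 1)" using lev_par[OF v] by simp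
      then show ?thesis
        using Suc.hyps(1)[OF l p] arc by (metis relpow_Suc_I2)
    qed
  qed
qed

text \<open>
  Follow a walk to \<open>t\<close> up to its last node in \<open>S'\<close>. Behind that node it stays below level \<open>j\<close>
  and outside the tree, as a walk cannot skip level \<open>j\<close> on its way towards \<open>t\<close>.
\<close>

lemma walk_split:
  assumes "(x, t) \<in> avoiding k F R ^^ l" "x \<noteq> t"
  shows "(\<exists>l' u. l' < l \<and> u \<in> Anc \<and> (x, u) \<in> avoiding k F R ^^ l' \<and> (u, t) \<in> avoiding k F R)
    \<or> (\<exists>z l1 l2. z \<in> S' \<and> l1 + l2 \<le> l \<and> (x, z) \<in> avoiding k F R ^^ l1
         \<and> (z, t) \<in> avoiding k F R' ^^ l2)
    \<or> (x \<in> Rc \<and> x \<notin> S' \<and> lev x < j \<and> (\<exists>l2 \<le> l. (x, t) \<in> avoiding k F R' ^^ l2))"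
    (is "?A x l \<or> ?B x l \<or> ?C x l")
  using assms
proof (induction l arbitrary: x)
  case 0
  then show ?case by simp
next
  case (Suc l)
  then obtain y where y: "(x, y) \<in> avoiding k F R" "(y, t) \<in> avoiding k F R ^^ l"
    by (meson relpow_Suc_D2)
  have xy: "(x, y) \<in> R" using y(1) by (simp add: avoiding_def)
  have "(y, t) \<in> R ^^ l" using relpow_mono_set[OF avoiding_subset y(2)] .
  then have yR: "y \<in> Rc" using walk_reached by blast
  then have xR: "x \<in> Rc" and lx: "lev x \<le> Suc (lev y)" using reached lev_le xy by auto
  \<comment> \<open>Prepending an arc of \<open>R'\<close> keeps the suffix inside
    \<open>R'\<close>. If \<open>x\<close> is in \<open>S'\<close>, the suffix starts at
    \<open>x\<close> after an empty prefix; otherwise the walk has not met \<open>S'\<close>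
    yet.\<close>
  have fin: "?B x (Suc l) \<or> ?C x (Suc l)"
    if "lev x \<le> j" "(x, y) \<in> R'" "l2 \<le> l" "(y, t) \<in> avoiding k F R' ^^ l2" for l2
  proof -
    have "(x, y) \<in> avoiding k F R'" using that(2) y(1) by (auto simp: avoiding_def)
    then have w: "(x, t) \<in> avoiding k F R' ^^ Suc l2" using that(4) by (meson relpow_Suc_I2)
    show ?thesis
    proof (cases "x \<in> S'")
      case True
      then have "?B x (Suc l)"
        using w that(3) by (intro exI[of _ x] exI[of _ 0] exI[of _ "Suc l2"]) auto
      then show ?thesis ..
    next
      case False
      then have "lev x < j" using that(1) xR Suc.prems(2) by (auto simp: S'_def)
      then show ?thesis using w that(3) False xR by (metis Suc_le_mono)
    qed
  qed
  show ?case
  proof (cases "y = t")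
    case True
    show ?thesis
    proof (cases "x \<in> Anc")
      case True
      then have "?A x (Suc l)"
        using y(1) \<open>y = t\<close> by (intro exI[of _ 0] exI[of _ x]) auto
      then show ?thesis ..
    next
      case False
      then have "(x, y) \<in> R'" using xy True by (auto simp: R'_def)
      moreover have "lev x \<le> j" using lx True lev_t j_pos by simp
      ultimately show ?thesis using fin[of 0] True by auto
    qed
  next
    case False
    from Suc.IH[OF y(2) False] consider (A) "?A y l" | (B) "?B y l" | (C) "?C y l" by blast
    then show ?thesis
    proof cases
      case A
      then have "?A x (Suc l)" using y(1) by (metis Suc_less_eq relpow_Suc_I2)
      then show ?thesis ..
    next
      case B
      then obtain z l1 l2 where "z \<in> S'" "l1 + l2 \<le> l" "(y, z) \<in> avoiding k F R ^^ l1"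
        "(z, t) \<in> avoiding k F R' ^^ l2" by blast
      then have "?B x (Suc l)"
        using relpow_Suc_I2[OF y(1)]
        by (intro exI[of _ z] exI[of _ "Suc l1"] exI[of _ l2]) auto
      then show ?thesis by blast
    next
      case C
      then have "y \<notin> Anc" using False yR by (auto simp: S'_def)
      then have "(x, y) \<in> R'" using xy C False by (auto simp: R'_def)
      moreover have "lev x \<le> j" using lx C by simp
      ultimately show ?thesis using fin C by blast
    qed
  qed
qed

text \<open>If no tree edge fails, the tree path is a shortest walk with last edge in
  \<open>X\<close>. Otherwise \<open>R'\<close> has a fault less, and a walk enters \<open>t\<close>
  from the tree or has a suffix in \<open>R'\<close> that starts in \<open>S'\<close>; rerouting
  this suffix through \<open>X'\<close> does not lengthen the walk. For \<open>g = 0\<close> a tree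
  edge cannot fail.\<close>

lemma covers_step:
  assumes next_cov: "g = 0 \<or> covers k t (g - 1) R' S' X'"
  shows "covers k t g R S (X \<union> X')"
  unfolding covers_def
proof (intro allI impI ballI)
  fix F s l
  assume F: "card (F \<inter> edge_of k ` R) \<le> g" and s: "s \<in> S - {t}"
    and w: "(s, t) \<in> avoiding k F R ^^ l"
  let ?goal = "\<exists>l' u. l' < l \<and> (s, u) \<in> avoiding k F R ^^ l' \<and> (u, t) \<in> avoiding k F R \<and>
             edge_of k (u, t) \<in> X \<union> X'"
  have "(s, t) \<in> R ^^ l" using relpow_mono_set[OF avoiding_subset w] .
  then have sR: "s \<in> Rc" "lev s \<le> l" using walk_reached by auto
  then have sA: "s \<in> Anc" using sources_Anc s by auto
  have last_in_X: "edge_of k (u, t) \<in> X" if "u \<in> Anc" "(u, t) \<in> avoiding k F R" for u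
    using that by (auto simp: X_def avoiding_def)
  show ?goal
  proof (cases "\<exists>a \<in> Anc. edge_of k (a, par a) \<in> F")
    case False
    then obtain u where "u \<in> Anc" "(s, u) \<in> avoiding k F R ^^ (lev s - 1)" "(u, t) \<in> avoiding k F R"
      using tree_path[OF sA] by blast
    moreover have "lev s \<noteq> 0" using lev_eq_0 sR s by blast
    ultimately show ?thesis using last_in_X sR(2)
      by (intro exI[of _ "lev s - 1"] exI[of _ u]) auto
  next
    case True
    then obtain a where a: "a \<in> Anc" "edge_of k (a, par a) \<in> F" by blast
    have aR: "a \<in> Rc" "a \<noteq> t" using a Anc_subset by auto
    \<comment> \<open>\<open>edge_of\<close> forgets the direction of an undirected edge, so neither
      direction of the tree edge may survive in \<open>R'\<close>.\<close>
    have gone: "edge_of k (a, par a) \<notin> edge_of k ` R'"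
    proof
      assume "edge_of k (a, par a) \<in> edge_of k ` R'"
      then obtain u v where "edge_of k (a, par a) = edge_of k (u, v)" "(u, v) \<in> R'"
        by auto
      then have "(a, par a) \<in> R' \<or> (par a, a) \<in> R'"
        using edge_of_eqD by metis
      then show False
        using a(1) aR(2) Anc_par by (auto simp: R'_def split: if_splits)
    qed
    have "F \<inter> edge_of k ` R' \<subset> F \<inter> edge_of k ` R"
      using gone a(2) par_arc[OF aR] R'_subset by blast
    then have "card (F \<inter> edge_of k ` R') < card (F \<inter> edge_of k ` R)"
      using finite_R by (intro psubset_card_mono) auto
    then have g: "card (F \<inter> edge_of k ` R') \<le> g - 1" "g \<noteq> 0" using F by auto
    from walk_split[OF w] s
    consider (A) l' u where "l' < l" "u \<in> Anc" "(s, u) \<in> avoiding k F R ^^ l'" "(u, t) \<in> avoiding k F R"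
      | (B) z l1 l2 where "z \<in> S'" "l1 + l2 \<le> l" "(s, z) \<in> avoiding k F R ^^ l1"
         "(z, t) \<in> avoiding k F R' ^^ l2"
      | (C) "s \<notin> S'" "lev s < j"
      by blast
    then show ?thesis
    proof cases
      case A
      then show ?thesis using last_in_X by blast
    next
      case B
      have "z \<in> S' - {t}" using B(1) by (auto simp: S'_def)
      then obtain l' u where l': "l' < l2" "(z, u) \<in> avoiding k F R' ^^ l'"
        "(u, t) \<in> avoiding k F R'" "edge_of k (u, t) \<in> X'"
        using next_cov g B(4) unfolding covers_def by blast
      have sub: "avoiding k F R' \<subseteq> avoiding k F R" using avoiding_mono R'_subset by metis
      have "(s, u) \<in> avoiding k F R ^^ (l1 + l')"
        using relpow_trans[OF B(3) relpow_mono_set[OF sub l'(2)]] .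
      then show ?thesis
        using l' B(2) sub by (intro exI[of _ "l1 + l'"] exI[of _ u]) auto
    next
      case C
      \<comment> \<open>A source below level \<open>j\<close> that reaches \<open>t\<close> is a
        tree node and hence in \<open>S'\<close>: the third case is impossible.\<close>
      then show ?thesis using sA sR s by (auto simp: S'_def)
    qed
  qed
qed

section \<open>Counting new sources and chosen edges\<close>

lemma finite_Anc: "finite Anc"
  using Anc_subset finite_Rc finite_subset by blast

text \<open>Downward induction from the deepest level: a tree node is a source or the parent of a
  tree node one level deeper, and distinct nodes have distinct children. So each level has no more
  tree nodes than there are sources on it or deeper.\<close>

lemma card_Anc_level: "card {v \<in> Anc. lev v = i} \<le> num_sources"
proof -
  obtain M where M: "\<And>v. v \<in> Rc \<Longrightarrow> lev v \<le> M"
    using finite_Rc by (metis finite_imageI finite_nat_set_iff_bounded_le imageI)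
  have "card {v \<in> Anc. lev v = i} \<le> card {v \<in> S \<inter> Rc - {t}. i \<le> lev v}"
  proof (cases "i \<le> M")
    case False
    then have "{v \<in> Anc. lev v = i} = {}" using M Anc_subset by fastforce
    then show ?thesis by (metis card.empty le0)
  next
    case True
    then show ?thesis
    proof (induction i rule: inc_induct)
      case base
      have "{v \<in> Anc. lev v = M} \<subseteq> {v \<in> S \<inter> Rc - {t}. M \<le> lev v}"
      proof
        fix v assume "v \<in> {v \<in> Anc. lev v = M}"
        then have v: "v \<in> Anc" "lev v = M" by auto
        have "par u \<noteq> v" if "u \<in> Anc" for u
          using M[of u] lev_par[of u] that Anc_subset v by fastforce
        then show "v \<in> {v \<in> S \<inter> Rc - {t}. M \<le> lev v}"
          using Anc_origin[OF v(1)] v Anc_subset by auto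
      qed
      then show ?case using finite_Rc by (intro card_mono) auto
    next
      case (step i)
      let ?src = "{v \<in> S \<inter> Rc - {t}. lev v = i}" and ?up = "{v \<in> S \<inter> Rc - {t}. Suc i \<le> lev v}"
      have "{v \<in> Anc. lev v = i} \<subseteq> ?src \<union> par ` {v \<in> Anc. lev v = Suc i}"
      proof
        fix v assume "v \<in> {v \<in> Anc. lev v = i}"
        then have v: "v \<in> Anc" "lev v = i" by auto
        consider "v \<in> S" | u where "u \<in> Anc" "par u = v" using Anc_origin[OF v(1)] by blast
        then show "v \<in> ?src \<union> par ` {v \<in> Anc. lev v = Suc i}"
        proof cases
          case 1
          then show ?thesis using v Anc_subset by auto
        next
          case 2
          then have "lev u = Suc i" using lev_par[of u] v Anc_subset by auto
          then show ?thesis using 2 by auto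
        qed
      qed
      then have "card {v \<in> Anc. lev v = i} \<le> card (?src \<union> par ` {v \<in> Anc. lev v = Suc i})"
        using finite_Rc finite_Anc by (intro card_mono) auto
      also have "\<dots> \<le> card ?src + card (par ` {v \<in> Anc. lev v = Suc i})"
        by (rule card_Un_le)
      also have "\<dots> \<le> card ?src + card ?up"
        using card_image_le[of "{v \<in> Anc. lev v = Suc i}" par] finite_Anc step.IH by simp
      also have "\<dots> = card (?src \<union> ?up)"
        using finite_Rc by (intro card_Un_disjoint[symmetric]) auto
      also have "?src \<union> ?up = {v \<in> S \<inter> Rc - {t}. i \<le> lev v}" by auto
      finally show ?case .
    qed
  qed
  also have "\<dots> \<le> num_sources"
    unfolding num_sources_def using finite_Rc by (intro card_mono) auto
  finally show ?thesis .
qed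

lemma card_X: "card X \<le> num_sources"
proof -
  have sub: "X \<subseteq> (\<lambda>u. edge_of k (u, t)) ` {v \<in> Anc. lev v = 1}"
  proof
    fix e assume "e \<in> X"
    then obtain u where u: "e = edge_of k (u, t)" "u \<in> Anc" "(u, t) \<in> R" by (auto simp: X_def)
    have "lev u \<le> 1" using lev_le[OF u(3) t_reached] lev_t by simp
    moreover have "lev u \<noteq> 0" using lev_eq_0 u(2) Anc_subset by blast
    ultimately show "e \<in> (\<lambda>u. edge_of k (u, t)) ` {v \<in> Anc. lev v = 1}" using u by auto
  qed
  have "card X \<le> card {v \<in> Anc. lev v = 1}"
    using surj_card_le[OF _ sub] finite_Anc by simp
  then show ?thesis using card_Anc_level le_trans by blast
qed

lemma card_S':
  assumes "card (level j) \<le> num_sources * j"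
  shows "card S' \<le> 2 * num_sources * j"
proof -
  have "S' \<subseteq> (\<Union>i \<in> {1..j}. {v \<in> Anc. lev v = i}) \<union> level j"
  proof
    fix v assume v: "v \<in> S'"
    then have "lev v \<noteq> 0" using lev_eq_0 by (auto simp: S'_def)
    then show "v \<in> (\<Union>i \<in> {1..j}. {v \<in> Anc. lev v = i}) \<union> level j"
      using v by (auto simp: S'_def level_def)
  qed
  then have "card S' \<le> card ((\<Union>i \<in> {1..j}. {v \<in> Anc. lev v = i}) \<union> level j)"
    using finite_Anc finite_Rc by (intro card_mono) (auto simp: level_def)
  also have "\<dots> \<le> card (\<Union>i \<in> {1..j}. {v \<in> Anc. lev v = i}) + card (level j)"
    by (rule card_Un_le)
  also have "card (\<Union>i \<in> {1..j}. {v \<in> Anc. lev v = i}) \<le> (\<Sum>i \<in> {1..j}. card {v \<in> Anc. lev v = i})"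
    by (rule card_UN_le) simp
  also have "\<dots> \<le> (\<Sum>i \<in> {1..j}. num_sources)"
    by (intro sum_mono card_Anc_level)
  finally show ?thesis using assms by (simp add: mult.commute)
qed

text \<open>All levels before the chosen one are large, so there are few of them.\<close>

lemma card_S'_squared:
  assumes "card (level j) \<le> num_sources * j"
    and large: "\<And>i. 1 \<le> i \<Longrightarrow> i < j \<Longrightarrow> num_sources * i < card (level i)"
    and n: "card Rc \<le> n"
  shows "(card S')\<^sup>2 \<le> 24 * n * num_sources"
proof -
  let ?a = num_sources
  have "(\<Sum>i \<in> {1..<j}. ?a * i) \<le> (\<Sum>i \<in> {1..<j}. card (level i))"
    using large by (intro sum_mono less_imp_le) auto
  also have "\<dots> = card (\<Union>i \<in> {1..<j}. level i)"
    using finite_Rc by (intro card_UN_disjoint[symmetric]) (auto simp: level_def)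
  also have "\<dots> \<le> n"
    using finite_Rc by (intro order_trans[OF card_mono n]) (auto simp: level_def)
  finally have "?a * (\<Sum>i \<in> {1..<j}. i) \<le> n" by (simp add: sum_distrib_left)
  moreover have "2 * (\<Sum>i \<in> {1..<j}. i) = j * (j - 1)"
    using j_pos by (induction j rule: nat_induct_at_least) (auto simp: algebra_simps)
  ultimately have 1: "?a * (j * (j - 1)) \<le> 2 * n"
    using mult_le_mono2[of "?a * (\<Sum>i \<in> {1..<j}. i)" n 2]
    by (simp only: mult.left_commute[of 2])
  have a_le: "?a \<le> n"
    using finite_Rc unfolding num_sources_def by (intro order_trans[OF card_mono n]) auto
  obtain d where d: "j = Suc d" using j_pos by (metis Suc_le_D One_nat_def)
  \<comment> \<open>The summand 2 is for \<open>j = 1\<close>, where there is no earlier level; it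
    costs at most \<open>2 * n\<close>, as there are at most \<open>n\<close> sources.\<close>
  have "j\<^sup>2 \<le> 2 * (j * (j - 1)) + 2"
    by (cases d) (auto simp: d power2_eq_square algebra_simps)
  then have "?a * j\<^sup>2 \<le> 2 * (?a * (j * (j - 1))) + 2 * ?a"
    using mult_le_mono2[of "j\<^sup>2" "2 * (j * (j - 1)) + 2" ?a]
    by (simp only: add_mult_distrib2 mult.left_commute[of _ 2] mult.commute[of _ 2])
  also have "\<dots> \<le> 6 * n" using 1 a_le by simp
  finally have 2: "?a * j\<^sup>2 \<le> 6 * n" .
  have "(card S')\<^sup>2 \<le> (2 * ?a * j)\<^sup>2"
    using card_S'[OF assms(1)] by (simp add: power_mono)
  also have "\<dots> = 4 * ?a * (?a * j\<^sup>2)" by (simp add: power2_eq_square)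
  also have "\<dots> \<le> 4 * ?a * (6 * n)" using 2 by (rule mult_le_mono2)
  finally show ?thesis by (simp add: ac_simps)
qed

end

section \<open>The size recurrence\<close>

text \<open>
  A bound for the edges added at one target with \<open>a\<close> sources and \<open>g\<close> possible faults. The
  exponent of 24 is the sum \<open>1/2 + 1/4 + \<dots> + 1/2^g\<close>, as each stage takes a square root.
\<close>

definition size_bound :: "nat \<Rightarrow> nat \<Rightarrow> nat \<Rightarrow> real" where
  "size_bound n g a = (real g + 1) * (24 powr (1 - 1 / 2 ^ g) * (real n * (real a / real n) powr (1 / 2 ^ g)))"

lemma size_bound_0: "n > 0 \<Longrightarrow> size_bound n 0 a = a"
  by (simp add: size_bound_def)

text \<open>Scaled by \<open>n\<close>, the hypothesis on \<open>a'\<close> reads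
  \<open>(a' / n)\<^sup>2 \<le> 24 * (a / n)\<close>. Raising it to the power
  \<open>1 / 2 ^ Suc g\<close> halves the exponent and brings in one more power of 24. As
  \<open>a / n\<close> is at most 1, \<open>a\<close> itself is below the same term and fills the
  additional unit of the factor \<open>g + 1\<close>.\<close>

lemma size_bound_Suc:
  assumes "a \<le> n" "a'\<^sup>2 \<le> 24 * n * a" "n > 0"
  shows "real a + size_bound n g a' \<le> size_bound n (Suc g) a"
proof -
  define x :: real where "x = 1 / 2 ^ Suc g"
  have x: "0 < x" "x \<le> 1" "1 / 2 ^ g = 2 * x"
    using one_le_power[of "2 :: real" "Suc g"] by (auto simp: x_def divide_le_eq_1 simp del: one_le_power)
  have x1: "x \<le> 1" by fact
  define b where "b = real n * (real a / real n) powr x"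
  have "(real a' / real n)\<^sup>2 \<le> 24 * (real a / real n)"
  proof -
    have "(real a')\<^sup>2 \<le> 24 * real n * real a"
      using assms(2) by (metis of_nat_le_iff of_nat_mult of_nat_numeral of_nat_power)
    then show ?thesis using assms(3) by (simp add: power_divide field_simps power2_eq_square)
  qed
  then have "((real a' / real n)\<^sup>2) powr x \<le> (24 * (real a / real n)) powr x"
    using x by (intro powr_mono2) auto
  moreover have "((real a' / real n)\<^sup>2) powr x = (real a' / real n) powr (2 * x)"
    by (cases "a' = 0") (auto simp: powr_powr[symmetric] powr_numeral[symmetric] simp del: powr_numeral)
  ultimately have 1: "(real a' / real n) powr (2 * x) \<le> 24 powr x * (real a / real n) powr x"
    by (metis powr_mult times_divide_eq_right)
  have "24 powr (1 - 2 * x) * (real n * (real a' / real n) powr (2 * x))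
      \<le> 24 powr (1 - 2 * x) * (real n * (24 powr x * (real a / real n) powr x))"
    by (intro mult_left_mono 1) auto
  also have "\<dots> = (24 powr (1 - 2 * x) * 24 powr x) * b" by (simp add: b_def)
  also have "24 powr (1 - 2 * x) * 24 powr x = (24 :: real) powr (1 - x)"
    by (simp add: powr_add[symmetric])
  finally have 2: "24 powr (1 - 2 * x) * (real n * (real a' / real n) powr (2 * x)) \<le> 24 powr (1 - x) * b" .
  have q: "0 \<le> real a / real n" "real a / real n \<le> 1" using assms by auto
  have "real a / real n \<le> (real a / real n) powr x"
    using powr_mono'[OF x1 q] q by simp
  then have "real a \<le> b" using assms(3) by (simp add: b_def field_simps)
  also have "\<dots> \<le> 24 powr (1 - x) * b"
  proof -
    have "(1::real) \<le> 24 powr (1 - x)" using x by (intro ge_one_powr_ge_zero) auto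
    then show ?thesis using mult_right_mono[of 1 "24 powr (1 - x)" b] by (simp add: b_def)
  qed
  finally have 3: "real a \<le> 24 powr (1 - x) * b" .
  have "real a + size_bound n g a' \<le> 24 powr (1 - x) * b + (real g + 1) * (24 powr (1 - x) * b)"
    unfolding size_bound_def x(3) by (intro add_mono 3 mult_left_mono 2) auto
  also have "\<dots> = size_bound n (Suc g) a"
    unfolding size_bound_def b_def x_def by (simp add: algebra_simps)
  finally show ?thesis .
qed

lemma size_bound_mono: "a \<le> b \<Longrightarrow> size_bound n g a \<le> size_bound n g b"
  unfolding size_bound_def by (intro mult_left_mono powr_mono2 divide_right_mono) auto

text \<open>The factor \<open>n\<close> stands for the sum over the targets. The constant is
  \<open>2 * 24\<close>: \<open>f + 1\<close> is at most \<open>2 * f\<close>, and the power of 24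
  is at most 24.\<close>

lemma size_bound_le:
  assumes "f \<ge> 1"
  shows "real n * size_bound n f a
    \<le> 48 * (real f * real a powr (1 / 2 ^ f) * real n powr (2 - 1 / 2 ^ f))"
proof (cases "n = 0")
  case True
  then show ?thesis by simp
next
  case False
  define x :: real where "x = 1 / 2 ^ f"
  have "0 < x" by (simp add: x_def)
  have "(24 :: real) powr (1 - x) \<le> 24 powr 1" using \<open>0 < x\<close> by (intro powr_mono) auto
  then have "(24 :: real) powr (1 - x) \<le> 24" by simp
  moreover have "real f + 1 \<le> 2 * real f" using assms by simp
  ultimately have "(real f + 1) * (24 powr (1 - x)) \<le> (2 * real f) * 24"
    by (intro mult_mono) auto
  then have 1: "(real f + 1) * (24 powr (1 - x)) \<le> 48 * real f" by simp
  have 2: "real n * (real n * (real a / real n) powr x) = real a powr x * real n powr (2 - x)"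
    using False by (simp add: powr_divide powr_diff power2_eq_square)
  have "real n * size_bound n f a
      = ((real f + 1) * (24 powr (1 - x))) * (real n * (real n * (real a / real n) powr x))"
    unfolding size_bound_def x_def[symmetric] by simp
  also have "\<dots> \<le> (48 * real f) * (real n * (real n * (real a / real n) powr x))"
    by (intro mult_right_mono 1) auto
  finally show ?thesis unfolding 2 x_def[symmetric] by (simp add: mult.assoc)
qed

section \<open>Total correctness with time bounds\<close>

definition halts :: "nat \<Rightarrow> com \<Rightarrow> state \<Rightarrow> nat \<Rightarrow> (state \<Rightarrow> bool) \<Rightarrow> bool" where
  "halts W c s T Q \<longleftrightarrow> (\<exists>T' s'. exec W c s T' s' \<and> T' \<le> T \<and> Q s')"

lemma halts_mono:
  "halts W c s T Q \<Longrightarrow> T \<le> T' \<Longrightarrow> (\<And>s'. Q s' \<Longrightarrow> Q' s') \<Longrightarrow> halts W c s T' Q'"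
  unfolding halts_def by (meson le_trans)

lemma halts_Seq:
  assumes "halts W c1 s T1 Q1" "\<And>s1. Q1 s1 \<Longrightarrow> halts W c2 s1 T2 Q"
  shows "halts W (Seq c1 c2) s (T1 + T2) Q"
  using assms unfolding halts_def by (meson add_mono exec.Seq)

lemma halts_WhileTrue:
  assumes "bval b s" "halts W c s T1 Q1" "\<And>s1. Q1 s1 \<Longrightarrow> halts W (While b c) s1 T2 Q"
  shows "halts W (While b c) s (1 + T1 + T2) Q"
  using assms unfolding halts_def by (meson add_mono exec.WhileTrue order_refl)

lemma halts_WhileFalse: "\<not> bval b s \<Longrightarrow> Q s \<Longrightarrow> 1 \<le> T \<Longrightarrow> halts W (While b c) s T Q"
  unfolding halts_def by (meson exec.WhileFalse)

text \<open>Each unit of the measure pays for one round of at most \<open>K\<close> steps and its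
  test; the final 1 is the failing test.\<close>

lemma halts_While:
  assumes step: "\<And>s. I s \<Longrightarrow> bval b s \<Longrightarrow> halts W c s K (\<lambda>s'. I s' \<and> \<mu> s' < \<mu> s)"
  shows "I s \<Longrightarrow> halts W (While b c) s (Suc K * \<mu> s + 1) (\<lambda>s'. I s' \<and> \<not> bval b s')"
proof (induction "\<mu> s" arbitrary: s rule: less_induct)
  case less
  show ?case
  proof (cases "bval b s")
    case False
    then show ?thesis using less.prems by (intro halts_WhileFalse) auto
  next
    case True
    have "halts W (While b c) s (1 + K + (Suc K * (\<mu> s - 1) + 1)) (\<lambda>s'. I s' \<and> \<not> bval b s')"
    proof (rule halts_WhileTrue[OF True step[OF less.prems True]])
      fix s1 assume s1: "I s1 \<and> \<mu> s1 < \<mu> s"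
      then have "Suc K * \<mu> s1 + 1 \<le> Suc K * (\<mu> s - 1) + 1"
        by (intro add_right_mono mult_le_mono2) auto
      then show "halts W (While b c) s1 (Suc K * (\<mu> s - 1) + 1) (\<lambda>s'. I s' \<and> \<not> bval b s')"
        using s1 by (intro halts_mono[OF less.hyps[of s1]]) auto
    qed
    \<comment> \<open>The measure of \<open>s\<close> is positive, because a round from
      \<open>s\<close> halts in a state of smaller measure.\<close>
    moreover have "1 + K + (Suc K * (\<mu> s - 1) + 1) \<le> Suc K * \<mu> s + 1"
      using step[OF less.prems True] by (cases "\<mu> s") (auto simp: halts_def)
    ultimately show ?thesis by (rule halts_mono) auto
  qed
qed

fun writes :: "com \<Rightarrow> string set" where
  "writes Skip = {}"
| "writes (Write x a e) = {x}"
| "writes (Seq c1 c2) = writes c1 \<union> writes c2"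
| "writes (Cond b c1 c2) = writes c1 \<union> writes c2"
| "writes (While b c) = writes c"

definition unchanged :: "com \<Rightarrow> state \<Rightarrow> state \<Rightarrow> bool" where
  "unchanged c s s' \<longleftrightarrow> (\<forall>x. x \<notin> writes c \<longrightarrow> s' x = s x)"

lemma exec_unchanged: "exec W c s T s' \<Longrightarrow> unchanged c s s'"
  by (induction rule: exec.induct) (auto simp: unchanged_def)

lemma halts_unchanged: "halts W c s T Q \<Longrightarrow> halts W c s T (\<lambda>s'. Q s' \<and> unchanged c s s')"
  unfolding halts_def by (meson exec_unchanged)

text \<open>Invariants need not mention cells that the body never writes: the syntactic frame
  condition is carried along from the start of the loop.\<close>

lemma halts_While_unchanged:
  assumes step: "\<And>s'. I s' \<Longrightarrow> unchanged c s s' \<Longrightarrow> bval b s' \<Longrightarrow>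
      halts W c s' K (\<lambda>s''. I s'' \<and> \<mu> s'' < \<mu> s')"
    and "I s" "\<mu> s \<le> M"
  shows "halts W (While b c) s (Suc K * M + 1) (\<lambda>s'. I s' \<and> unchanged c s s' \<and> \<not> bval b s')"
proof -
  let ?J = "\<lambda>s'. I s' \<and> unchanged c s s'"
  have "halts W c s' K (\<lambda>s''. ?J s'' \<and> \<mu> s'' < \<mu> s')" if "?J s'" "bval b s'" for s'
    using that by (intro halts_mono[OF halts_unchanged[OF step]]) (auto simp: unchanged_def)
  then have "halts W (While b c) s (Suc K * \<mu> s + 1) (\<lambda>s'. ?J s' \<and> \<not> bval b s')"
    by (rule halts_While) (auto simp: unchanged_def \<open>I s\<close>)
  moreover have "Suc K * \<mu> s + 1 \<le> Suc K * M + 1"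
    using \<open>\<mu> s \<le> M\<close> by (intro add_right_mono mult_le_mono2)
  ultimately show ?thesis by (rule halts_mono) auto
qed

text \<open>Symbolic execution of loop-free code by the simplifier, with the word bound checked at
  each write. Loops are left to the measure rule, hence \<open>False\<close>, which also makes the
  dummy \<open>cost\<close> of a loop harmless.\<close>

fun wp :: "nat \<Rightarrow> com \<Rightarrow> (state \<Rightarrow> bool) \<Rightarrow> state \<Rightarrow> bool" where
  "wp W Skip Q s \<longleftrightarrow> Q s"
| "wp W (Write x a e) Q s \<longleftrightarrow>
     aval a s \<le> W \<and> aval e s \<le> W \<and> Q (s(x := (s x)(aval a s := aval e s)))"
| "wp W (Seq c1 c2) Q s \<longleftrightarrow> wp W c1 (wp W c2 Q) s"
| "wp W (Cond b c1 c2) Q s \<longleftrightarrow> (if bval b s then wp W c1 Q s else wp W c2 Q s)"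
| "wp W (While b c) Q s \<longleftrightarrow> False"

fun cost :: "com \<Rightarrow> nat" where
  "cost Skip = 1"
| "cost (Write x a e) = 1"
| "cost (Seq c1 c2) = cost c1 + cost c2"
| "cost (Cond b c1 c2) = 1 + max (cost c1) (cost c2)"
| "cost (While b c) = 0"

lemma wp_halts: "wp W c Q s \<Longrightarrow> halts W c s (cost c) Q"
proof (induction c arbitrary: s Q)
  case Skip
  then show ?case unfolding halts_def by (metis cost.simps(1) exec.Skip order_refl wp.simps(1))
next
  case (Write x a e)
  then show ?case
    unfolding halts_def by (metis cost.simps(2) exec.Write order_refl wp.simps(2))
next
  case (Seq c1 c2)
  have "halts W c1 s (cost c1) (wp W c2 Q)" using Seq by simp
  then show ?case using Seq.IH(2) by (simp add: halts_Seq)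
next
  case (Cond b c1 c2)
  show ?case
  proof (cases "bval b s")
    case True
    then have "halts W c1 s (cost c1) Q" using Cond by simp
    then obtain T s' where "exec W c1 s T s'" "T \<le> cost c1" "Q s'" unfolding halts_def by blast
    then show ?thesis
      using exec.CondTrue[OF True, of W c1 T s' c2] unfolding halts_def
      by (intro exI[of _ "1 + T"] exI[of _ s']) auto
  next
    case False
    then have "halts W c2 s (cost c2) Q" using Cond by simp
    then obtain T s' where "exec W c2 s T s'" "T \<le> cost c2" "Q s'" unfolding halts_def by blast
    then show ?thesis
      using exec.CondFalse[OF False, of W c2 T s' c1] unfolding halts_def
      by (intro exI[of _ "1 + T"] exI[of _ s']) auto
  qed
next
  case (While b c)
  then show ?case by simp
qed

section \<open>The program\<close>

abbreviation var :: "string \<Rightarrow> aexp" where "var x \<equiv> Read x (Const 0)"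

abbreviation assign :: "string \<Rightarrow> aexp \<Rightarrow> com" where "assign x e \<equiv> Write x (Const 0) e"

abbreviation incr :: "string \<Rightarrow> com" where "incr x \<equiv> assign x (Plus (var x) (Const 1))"

abbreviation positive :: "aexp \<Rightarrow> bexp" where "positive e \<equiv> Less (Const 0) e"

fun block :: "com list \<Rightarrow> com" where
  "block [] = Skip"
| "block (c # cs) = Seq c (block cs)"

text \<open>
  An undirected edge gives two arcs. The static data are: the number \<open>N\<close> of arcs; tail \<open>U\<close>, head
  \<open>V\<close> and edge index \<open>I\<close> of an arc; linked lists of the arcs into a node with first element \<open>Z\<close> and
  successor \<open>X\<close>; the marks \<open>B\<close> of the sources. In stage \<open>g\<close> for target \<open>t\<close>, \<open>L\<close> marks the remaining
  arcs and \<open>C\<close> the current sources. The search uses the queue \<open>Q\<close> (from \<open>h\<close> to \<open>e\<close>), the pointer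
  \<open>a\<close> into the list of arcs into \<open>v\<close>, the parents \<open>P\<close>, and in \<open>D\<close> the levels plus \<open>d + 1\<close>, where
  \<open>D x \<le> d\<close> says that \<open>x\<close> is not reached. It counts the reached sources in \<open>c\<close> and the nodes of
  each level in \<open>K\<close>; \<open>A\<close> marks the ancestors of the sources and \<open>j\<close> is the level where the search
  tree is cut. The last stage restores \<open>L\<close> and \<open>C\<close> for the next target.
\<close>

definition bfs_step :: com where
  "bfs_step =
    Cond (positive (var ''a''))
      (block [
        assign ''b'' (Minus (var ''a'') (Const 1)),
        assign ''u'' (Read ''U'' (var ''b'')),
        Cond (Conj (positive (Read ''L'' (var ''b'')))
                   (Less (Read ''D'' (var ''u'')) (Plus (var ''d'') (Const 1))))
          (block [
            Write ''D'' (var ''u'') (Plus (Read ''D'' (var ''v'')) (Const 1)),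
            Write ''P'' (var ''u'') (var ''v''),
            Write ''Q'' (var ''e'') (var ''u''),
            incr ''e'',
            Write ''A'' (var ''u'') (Read ''C'' (var ''u'')),
            assign ''c'' (Plus (var ''c'') (Read ''C'' (var ''u''))),
            Write ''K'' (Read ''D'' (var ''u'')) (Plus (Read ''K'' (Read ''D'' (var ''u''))) (Const 1))])
          Skip,
        assign ''a'' (Read ''X'' (var ''b''))])
      (block [
        assign ''v'' (Read ''Q'' (var ''h'')),
        incr ''h'',
        assign ''a'' (Read ''Z'' (var ''v''))])"

definition bfs_init :: com where
  "bfs_init = block [
     Write ''D'' (var ''t'') (Plus (var ''d'') (Const 1)),
     Write ''Q'' (Const 0) (var ''t''),
     assign ''h'' (Const 0),
     assign ''e'' (Const 1),
     assign ''a'' (Const 0),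
     assign ''c'' (Const 0)]"

definition bfs :: com where
  "bfs = Seq bfs_init
     (While (positive (Plus (var ''a'') (Minus (var ''e'') (var ''h'')))) bfs_step)"

definition mark_step :: com where
  "mark_step = block [
     assign ''e'' (Minus (var ''e'') (Const 1)),
     assign ''u'' (Read ''Q'' (var ''e'')),
     Cond (positive (Read ''A'' (var ''u''))) (Write ''A'' (Read ''P'' (var ''u'')) (Const 1)) Skip]"

definition mark :: com where
  "mark = While (Less (Const 1) (var ''e'')) mark_step"

definition choose_level :: com where
  "choose_level = Seq (assign ''j'' (Const 1))
     (While (Less (Times (var ''c'') (var ''j''))
                  (Read ''K'' (Plus (Plus (var ''d'') (Const 1)) (var ''j''))))
        (incr ''j''))"

definition update_step :: com where
  "update_step = block [
     assign ''u'' (Read ''U'' (var ''i'')),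
     assign ''v'' (Read ''V'' (var ''i'')),
     Cond (positive (Read ''L'' (var ''i'')))
       (Cond (Conj (Neg (Less (var ''v'') (var ''t''))) (Neg (Less (var ''t'') (var ''v''))))
         (Cond (positive (Read ''A'' (var ''u'')))
            (Seq (Write ''out'' (Read ''I'' (var ''i'')) (Const 1)) (Write ''L'' (var ''i'') (Const 0)))
            Skip)
         (Cond (Conj (Less (var ''d'') (Read ''D'' (var ''v'')))
                 (Conj (Less (Read ''D'' (var ''v'')) (Plus (Plus (var ''d'') (Const 1)) (var ''j'')))
                       (Less (Read ''A'' (var ''v'')) (Const 1))))
            Skip
            (Write ''L'' (var ''i'') (Const 0))))
       Skip,
     Cond (Conj (Less (Plus (var ''d'') (Const 1)) (Read ''D'' (var ''u'')))
            (Conj (Less (Read ''D'' (var ''u'')) (Plus (Plus (var ''d'') (Const 2)) (var ''j'')))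
                  (Neg (Conj (Less (Read ''A'' (var ''u'')) (Const 1))
                             (Less (Read ''D'' (var ''u'')) (Plus (Plus (var ''d'') (Const 1)) (var ''j'')))))))
       (Write ''C'' (var ''u'') (Const 1))
       (Write ''C'' (var ''u'') (Const 0)),
     Cond (Less (var ''g'') (var ''f''))
       Skip
       (Seq (Write ''L'' (var ''i'') (Const 1)) (Write ''C'' (var ''u'') (Read ''B'' (var ''u'')))),
     incr ''i'']"

definition update :: com where
  "update = Seq (assign ''i'' (Const 0)) (While (Less (var ''i'') (var ''N'')) update_step)"

definition stage_prog :: com where
  "stage_prog = Seq bfs (Seq mark (Seq choose_level (Seq update
     (Seq (assign ''d'' (Plus (var ''d'') (Plus (var ''n'') (Const 2)))) (incr ''g'')))))"

definition target_prog :: com where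
  "target_prog = Seq (assign ''g'' (Const 0))
     (Seq (While (Less (var ''g'') (Plus (var ''f'') (Const 1))) stage_prog) (incr ''t''))"

definition main_loop :: com where
  "main_loop = While (Less (var ''t'') (var ''n'')) target_prog"

definition arcs_step :: com where
  "arcs_step = block [
     Write ''U'' (var ''i'') (Read ''tail'' (var ''i'')),
     Write ''V'' (var ''i'') (Read ''head'' (var ''i'')),
     Write ''I'' (var ''i'') (var ''i''),
     Write ''U'' (Plus (var ''m'') (var ''i'')) (Read ''head'' (var ''i'')),
     Write ''V'' (Plus (var ''m'') (var ''i'')) (Read ''tail'' (var ''i'')),
     Write ''I'' (Plus (var ''m'') (var ''i'')) (var ''i''),
     incr ''i'']"

definition sources_step :: com where
  "sources_step = Seq (Write ''B'' (Read ''source'' (var ''i'')) (Const 1)) (incr ''i'')"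

definition links_step :: com where
  "links_step = block [
     assign ''v'' (Read ''V'' (var ''i'')),
     assign ''u'' (Read ''U'' (var ''i'')),
     Write ''X'' (var ''i'') (Read ''Z'' (var ''v'')),
     Write ''Z'' (var ''v'') (Plus (var ''i'') (Const 1)),
     Write ''L'' (var ''i'') (Const 1),
     Write ''C'' (var ''u'') (Read ''B'' (var ''u'')),
     incr ''i'']"

definition preparation :: "kind \<Rightarrow> com" where
  "preparation k =
    Seq (assign ''N'' (case k of Directed \<Rightarrow> var ''m'' | Undirected \<Rightarrow> Plus (var ''m'') (var ''m'')))
    (Seq (While (Less (var ''i'') (var ''m'')) arcs_step)
    (Seq (assign ''i'' (Const 0))
    (Seq (While (Less (var ''i'') (var ''k'')) sources_step)
    (Seq (assign ''i'' (Const 0))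
         (While (Less (var ''i'') (var ''N'')) links_step)))))"

text \<open>Without edges there is no time for the loop over the \<open>n\<close> targets.\<close>

definition preserver_prog :: "kind \<Rightarrow> com" where
  "preserver_prog k = Cond (positive (var ''m'')) (Seq (preparation k) main_loop) Skip"

section \<open>Breadth-first search\<close>

text \<open>
  \<open>fr v\<close> and \<open>nx b\<close> are the heads of linked lists: an arc \<open>b\<close> is pointed to by \<open>Suc b\<close>, and the
  arcs into \<open>v\<close> are listed by decreasing index. Hence the rest of the list from pointer \<open>a\<close> on
  consists of the arcs \<open>b < a\<close> with head \<open>v\<close>.
\<close>

locale arcs =
  fixes n N :: nat and U V nx fr :: "nat \<Rightarrow> nat"
  assumes tail_less: "b < N \<Longrightarrow> U b < n" and head_less: "b < N \<Longrightarrow> V b < n"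
    and no_loop: "b < N \<Longrightarrow> U b \<noteq> V b"
    and fr_le: "fr v \<le> N" and fr_head: "0 < fr v \<Longrightarrow> V (fr v - 1) = v"
    and fr_all: "b < N \<Longrightarrow> b < fr (V b)"
    and nx_le: "b < N \<Longrightarrow> nx b \<le> b" and nx_head: "b < N \<Longrightarrow> 0 < nx b \<Longrightarrow> V (nx b - 1) = V b"
    and nx_all: "b < N \<Longrightarrow> b' < b \<Longrightarrow> V b' = V b \<Longrightarrow> b' < nx b"
begin

definition scanned :: "(nat \<Rightarrow> nat) \<Rightarrow> nat \<Rightarrow> nat \<Rightarrow> nat \<Rightarrow> nat set" where
  "scanned Q h v a = {b. b < N \<and> V b \<in> Q ` {..<h} \<and> \<not> (b < a \<and> V b = v)}"

lemma finite_scanned: "finite (scanned Q h v a)"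
  by (rule finite_subset[of _ "{..<N}"]) (auto simp: scanned_def)

lemma card_scanned_le: "card (scanned Q h v a) \<le> N"
  using card_mono[of "{..<N}" "scanned Q h v a"] by (auto simp: scanned_def)

lemma scanned_next:
  assumes "0 < a" "a \<le> N" "V (a - 1) = v" "v \<in> Q ` {..<h}"
  shows "scanned Q h v (nx (a - 1)) = insert (a - 1) (scanned Q h v a)"
    and "a - 1 \<notin> scanned Q h v a"
proof -
  have "b < nx (a - 1) \<longleftrightarrow> b < a \<and> b \<noteq> a - 1" if "V b = v" for b
  proof -
    have "a - 1 < N" using assms by simp
    then have "nx (a - 1) \<le> a - 1" "b < a - 1 \<Longrightarrow> b < nx (a - 1)"
      using nx_all[of "a - 1" b] nx_le[of "a - 1"] assms(3) that by auto
    then show ?thesis by auto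
  qed
  then show "scanned Q h v (nx (a - 1)) = insert (a - 1) (scanned Q h v a)"
    using assms unfolding scanned_def by auto
  show "a - 1 \<notin> scanned Q h v a"
    using assms unfolding scanned_def by auto
qed

text \<open>Taking a node from the queue adds it to the processed nodes and its entire list to the
  exception, which cancels out; with pointer 0 the old exception is empty.\<close>

lemma scanned_dequeue:
  assumes "inj_on Q {..<e}" "h < e"
  shows "scanned Q (Suc h) (Q h) (fr (Q h)) = scanned Q h v 0"
proof -
  have "Q h \<noteq> Q i" if "i < h" for i
    using inj_onD[OF assms(1), of h i] assms(2) that by auto
  then have "Q h \<notin> Q ` {..<h}" by auto
  moreover have "b < fr (Q h)" if "b < N" "V b = Q h" for b
    using fr_all[of b] that by simp
  ultimately show ?thesis
    unfolding scanned_def by (auto simp: lessThan_Suc)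
qed

end

text \<open>Cells of \<open>D\<close> with value at most \<open>base\<close> are leftovers. Levels
  increase along the queue and exceed that of \<open>v\<close> by at most one, which is why the
  search finds distances. \<open>tree\<close> puts parents earlier on the queue, as the marking pass
  requires, and \<open>e_le_scanned\<close> charges each queued node other than \<open>t\<close> to
  a scanned arc.\<close>

locale bfs_state = arcs n N U V nx fr
  for n N :: nat and U V nx fr :: "nat \<Rightarrow> nat" +
  fixes t base :: nat and al src :: "nat \<Rightarrow> nat"
    and a v h e c :: nat and D P Q A K :: "nat \<Rightarrow> nat"
  assumes e_pos: "1 \<le> e" and h_le: "h \<le> e" and Q_0: "Q 0 = t" and Q_inj: "inj_on Q {..<e}"
    and Q_less: "i < e \<Longrightarrow> Q i < n"
    and reached_iff: "base < D x \<longleftrightarrow> x \<in> Q ` {..<e}"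
    and D_t: "D t = Suc base"
    and D_mono: "i \<le> i' \<Longrightarrow> i' < e \<Longrightarrow> D (Q i) \<le> D (Q i')"
    and D_le: "i < e \<Longrightarrow> D (Q i) \<le> Suc base + i"
    and front: "0 < h \<Longrightarrow> v = Q (h - 1)"
    and D_front: "0 < h \<Longrightarrow> i < e \<Longrightarrow> D (Q i) \<le> Suc (D v)"
    and start: "h = 0 \<Longrightarrow> e = 1 \<and> a = 0"
    and a_le: "a \<le> N" and a_head: "0 < a \<Longrightarrow> V (a - 1) = v"
    and e_le_scanned: "e \<le> Suc (card (scanned Q h v a))"
    and scanned_D: "b \<in> scanned Q h v a \<Longrightarrow> al b \<noteq> 0 \<Longrightarrow> base < D (U b) \<and> D (U b) \<le> Suc (D (V b))"
    and tree: "0 < i \<Longrightarrow> i < e \<Longrightarrow> \<exists>b < N. al b \<noteq> 0 \<and> U b = Q i \<and> V b = P (Q i) \<and>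
        D (Q i) = Suc (D (P (Q i))) \<and> P (Q i) \<in> Q ` {..<i}"
    and A_eq: "0 < i \<Longrightarrow> i < e \<Longrightarrow> A (Q i) = src (Q i)"
    and c_eq: "c = (\<Sum>i \<in> {1..<e}. src (Q i))"
    and K_eq: "base < x \<Longrightarrow> K x = card {i \<in> {1..<e}. D (Q i) = x}"
begin

text \<open>This bounds the passes over the queue and over the levels by the number of arcs, even if
  \<open>n\<close> is much larger.\<close>

lemma e_le: "e \<le> Suc N"
  using e_le_scanned card_scanned_le le_trans by (meson Suc_le_mono)

lemma e_le_n: "e \<le> n"
proof -
  have "card (Q ` {..<e}) \<le> card {..<n}" using Q_less by (intro card_mono) auto
  then show ?thesis using card_image[OF Q_inj] by simp
qed

lemma front_reached: "0 < h \<Longrightarrow> v \<in> Q ` {..<h}" "0 < h \<Longrightarrow> base < D v"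
proof -
  assume "0 < h"
  then show "v \<in> Q ` {..<h}" using front by auto
  then have "v \<in> Q ` {..<e}" using h_le by auto
  then show "base < D v" using reached_iff by auto
qed

lemma D_v_le: "0 < h \<Longrightarrow> D v \<le> base + e"
  using D_le[of "h - 1"] front h_le by fastforce

lemma c_le:
  assumes "\<And>x. src x \<le> 1"
  shows "c \<le> e - 1"
  using sum_bounded_above[of "{1..<e}" "\<lambda>i. src (Q i)" 1] assms unfolding c_eq by simp

lemma K_le: "base < x \<Longrightarrow> K x \<le> e - 1"
  using K_eq[of x] card_mono[of "{1..<e}" "{i \<in> {1..<e}. D (Q i) = x}"] by fastforce

lemma skip_arc:
  assumes "0 < a" "al (a - 1) = 0 \<or> base < D (U (a - 1))"
  shows "bfs_state n N U V nx fr t base al src (nx (a - 1)) v h e c D P Q A K"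
    "card (scanned Q h v (nx (a - 1))) = Suc (card (scanned Q h v a))"
proof -
  have h: "0 < h" using start assms(1) by auto
  note sc = scanned_next[OF assms(1) a_le a_head[OF assms(1)] front_reached(1)[OF h]]
  show card: "card (scanned Q h v (nx (a - 1))) = Suc (card (scanned Q h v a))"
    using sc finite_scanned by simp
  have aN: "a - 1 < N" using assms(1) a_le by simp
  show "bfs_state n N U V nx fr t base al src (nx (a - 1)) v h e c D P Q A K"
  proof (unfold_locales; (fact e_pos h_le Q_0 Q_inj Q_less reached_iff D_t D_mono D_le front D_front tree A_eq c_eq K_eq)?)
    show "h = 0 \<Longrightarrow> e = 1 \<and> nx (a - 1) = 0" using h by simp
    show "nx (a - 1) \<le> N" using nx_le[OF aN] aN by simp
    show "0 < nx (a - 1) \<Longrightarrow> V (nx (a - 1) - 1) = v"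
      using nx_head[OF aN] a_head assms(1) by simp
    show "e \<le> Suc (card (scanned Q h v (nx (a - 1))))" using card e_le_scanned by simp
    fix b assume b: "b \<in> scanned Q h v (nx (a - 1))" "al b \<noteq> 0"
    show "base < D (U b) \<and> D (U b) \<le> Suc (D (V b))"
    proof (cases "b = a - 1")
      case True
      then have "base < D (U b)" using assms b by auto
      \<comment> \<open>The tail is queued already, so it is at most one level deeper than
        \<open>v\<close>, the head of this arc.\<close>
      moreover from this obtain i where "i < e" "U b = Q i" using reached_iff by auto
      ultimately show ?thesis using D_front[OF h] True a_head assms(1) by auto
    next
      case False
      then show ?thesis using scanned_D b sc(1) by blast
    qed
  qed
qed

text \<open>The new node goes to the end of the queue with the largest level possible there, so
  levels stay ordered. It was not queued before, so overwriting its cells leaves all facts about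
  older nodes intact.\<close>

lemma new_arc:
  assumes "0 < a" "al (a - 1) \<noteq> 0" "D (U (a - 1)) \<le> base" "u = U (a - 1)"
  shows "bfs_state n N U V nx fr t base al src (nx (a - 1)) v h (Suc e) (c + src u)
      (D(u := Suc (D v))) (P(u := v)) (Q(e := u)) (A(u := src u))
      (K(Suc (D v) := Suc (K (Suc (D v)))))"
    (is "bfs_state _ _ _ _ _ _ _ _ _ _ _ _ _ _ _ ?D ?P ?Q ?A ?K")
    "card (scanned (Q(e := u)) h v (nx (a - 1))) = Suc (card (scanned Q h v a))"
proof -
  have h: "0 < h" using start assms(1) by auto
  have aN: "a - 1 < N" using assms(1) a_le by simp
  have uQ: "u \<notin> Q ` {..<e}" using assms(3,4) reached_iff by (metis leD)
  have [simp]: "Q i \<noteq> u" "u \<noteq> Q i" if "i < e" for i using uQ that by auto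
  have Qh: "?Q ` {..<h} = Q ` {..<h}" using h_le by auto
  have scQ: "scanned ?Q h x y = scanned Q h x y" for x y unfolding scanned_def Qh ..
  note sc = scanned_next[OF assms(1) a_le a_head[OF assms(1)] front_reached(1)[OF h]]
  show card: "card (scanned ?Q h v (nx (a - 1))) = Suc (card (scanned Q h v a))"
    using sc finite_scanned unfolding scQ by simp
  have vu: "v \<noteq> u" using front_reached(1)[OF h] uQ h_le by auto
  have Qe: "?Q ` {..<Suc e} = insert u (Q ` {..<e})"
    by (auto simp: lessThan_Suc)
  show "bfs_state n N U V nx fr t base al src (nx (a - 1)) v h (Suc e) (c + src u) ?D ?P ?Q ?A ?K"
  proof unfold_locales
    show "1 \<le> Suc e" "h \<le> Suc e" "h = 0 \<Longrightarrow> Suc e = 1 \<and> nx (a - 1) = 0" using h h_le by auto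
    show "?Q 0 = t" using e_pos Q_0 by simp
    show "inj_on ?Q {..<Suc e}"
      using Q_inj uQ by (auto simp: lessThan_Suc inj_on_def)
    show "?Q i < n" if "i < Suc e" for i
      using that Q_less tail_less[OF aN] assms(4) by (auto simp: less_Suc_eq)
    show "base < ?D x \<longleftrightarrow> x \<in> ?Q ` {..<Suc e}" for x
      using reached_iff[of x] front_reached(2)[OF h] by (auto simp: Qe)
    have "t \<noteq> u" using Q_0 e_pos uQ by force
    then show "?D t = Suc base" using D_t by simp
    show "?D (?Q i) \<le> ?D (?Q i')" if "i \<le> i'" "i' < Suc e" for i i'
    proof (cases "i' = e")
      case True
      then show ?thesis using that D_front[OF h, of i] by (cases "i = e") auto
    next
      case False
      then show ?thesis using that D_mono[of i i'] by auto
    qed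
    show "?D (?Q i) \<le> Suc base + i" if "i < Suc e" for i
      using that D_le[of i] D_v_le[OF h] by (auto simp: less_Suc_eq)
    show "v = ?Q (h - 1)" using front[OF h] h h_le by auto
    show "?D (?Q i) \<le> Suc (?D v)" if "i < Suc e" for i
      using that D_front[OF h, of i] vu by (auto simp: less_Suc_eq)
    show "nx (a - 1) \<le> N" using nx_le[OF aN] aN by simp
    show "0 < nx (a - 1) \<Longrightarrow> V (nx (a - 1) - 1) = v"
      using nx_head[OF aN] a_head assms(1) by simp
    show "Suc e \<le> Suc (card (scanned ?Q h v (nx (a - 1))))" using card e_le_scanned by simp
    show "base < ?D (U b) \<and> ?D (U b) \<le> Suc (?D (V b))"
      if "b \<in> scanned ?Q h v (nx (a - 1))" "al b \<noteq> 0" for b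
    proof (cases "b = a - 1")
      case True
      then show ?thesis
        using front_reached(2)[OF h] vu a_head assms by auto
    next
      case False
      then have b: "b \<in> scanned Q h v a" using that(1) sc(1) unfolding scQ by blast
      then have "base < D (U b)" "V b \<in> Q ` {..<h}"
        using scanned_D that(2) by (auto simp: scanned_def)
      then have "U b \<noteq> u" "V b \<noteq> u" using reached_iff uQ h_le by auto
      then show ?thesis using scanned_D[OF b that(2)] by simp
    qed
    show "\<exists>b < N. al b \<noteq> 0 \<and> U b = ?Q i \<and> V b = ?P (?Q i) \<and>
        ?D (?Q i) = Suc (?D (?P (?Q i))) \<and> ?P (?Q i) \<in> ?Q ` {..<i}" if "0 < i" "i < Suc e" for i
    proof (cases "i = e")
      case True
      have "v \<in> ?Q ` {..<i}" using front_reached(1)[OF h] h_le True by auto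
      then show ?thesis
        using True aN assms a_head vu by (intro exI[of _ "a - 1"]) auto
    next
      case False
      then have i: "i < e" "0 < i" using that by auto
      then have im: "?Q ` {..<i} = Q ` {..<i}" by auto
      obtain b where b: "b < N" "al b \<noteq> 0" "U b = Q i" "V b = P (Q i)"
        "D (Q i) = Suc (D (P (Q i)))" "P (Q i) \<in> Q ` {..<i}"
        using tree[OF i(2,1)] by blast
      then have "P (Q i) \<noteq> u" using i uQ by auto
      then show ?thesis
        using b i unfolding im by (intro exI[of _ b]) auto
    qed
    show "?A (?Q i) = src (?Q i)" if "0 < i" "i < Suc e" for i
      using that A_eq[of i] by (auto simp: less_Suc_eq)
    show "c + src u = (\<Sum>i \<in> {1..<Suc e}. src (?Q i))"
      using e_pos unfolding c_eq by simp
    fix x assume x: "base < x"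
    have "{i \<in> {1..<Suc e}. ?D (?Q i) = x} =
        (if x = Suc (D v) then insert e else id) {i \<in> {1..<e}. D (Q i) = x}"
      using e_pos by (auto simp: less_Suc_eq)
    then show "?K x = card {i \<in> {1..<Suc e}. ?D (?Q i) = x}"
      using K_eq[OF x] by auto
  qed
qed

lemma dequeue:
  assumes "a = 0" "h < e"
  shows "bfs_state n N U V nx fr t base al src (fr (Q h)) (Q h) (Suc h) e c D P Q A K"
    "card (scanned Q (Suc h) (Q h) (fr (Q h))) = card (scanned Q h v a)"
proof -
  have sc: "scanned Q (Suc h) (Q h) (fr (Q h)) = scanned Q h v a"
    using scanned_dequeue[OF Q_inj assms(2)] assms(1) by simp
  then show "card (scanned Q (Suc h) (Q h) (fr (Q h))) = card (scanned Q h v a)" by simp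
  show "bfs_state n N U V nx fr t base al src (fr (Q h)) (Q h) (Suc h) e c D P Q A K"
  proof (unfold_locales; (fact e_pos Q_0 Q_inj Q_less reached_iff D_t D_mono D_le tree A_eq c_eq K_eq)?)
    show "Suc h \<le> e" "Q h = Q (Suc h - 1)" "Suc h = 0 \<Longrightarrow> e = 1 \<and> fr (Q h) = 0" using assms by auto
    show "D (Q i) \<le> Suc (D (Q h))" if "i < e" for i
    proof (cases "h = 0")
      case True
      then show ?thesis using start that by simp
    next
      case False
      then have "D (Q i) \<le> Suc (D v)" "D v \<le> D (Q h)"
        using D_front that front D_mono[of "h - 1" h] assms(2) by auto
      then show ?thesis by simp
    qed
    show "fr (Q h) \<le> N" "0 < fr (Q h) \<Longrightarrow> V (fr (Q h) - 1) = Q h" using fr_le fr_head by auto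
    show "e \<le> Suc (card (scanned Q (Suc h) (Q h) (fr (Q h))))" using e_le_scanned sc by simp
    show "base < D (U b) \<and> D (U b) \<le> Suc (D (V b))"
      if "b \<in> scanned Q (Suc h) (Q h) (fr (Q h))" "al b \<noteq> 0" for b
      using scanned_D that sc by blast
  qed
qed

end

text \<open>\<open>P\<close>, \<open>Q\<close> and \<open>A\<close> may hold anything, as their
  relevant cells are written when a node is queued. \<open>D\<close> and \<open>K\<close> are read
  without that guard, and the offset makes their old contents harmless.\<close>

lemma (in arcs) bfs_start:
  assumes "t < n" "\<And>x. D x \<le> base" "\<And>x. base < x \<Longrightarrow> K x = 0"
  shows "bfs_state n N U V nx fr t base al src 0 v 0 1 0 (D(t := Suc base)) P (Q(0 := t)) A K"
proof unfold_locales
  show "base < (D(t := Suc base)) x \<longleftrightarrow> x \<in> (Q(0 := t)) ` {..<1}" for x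
    using assms(2)[of x] by (auto simp: not_less)
qed (use assms in \<open>auto simp: scanned_def lessThan_Suc\<close>)

section \<open>Marking the search tree\<close>

locale search = bfs_state n N U V nx fr t base al src 0 v e e c D P Q A0 K
  for n N :: nat and U V nx fr :: "nat \<Rightarrow> nat" and t base :: nat and al src :: "nat \<Rightarrow> nat"
    and v e c :: nat and D P Q A0 K :: "nat \<Rightarrow> nat" +
  assumes src_le: "src x \<le> 1"
begin

definition marked_from :: "nat \<Rightarrow> (nat \<Rightarrow> nat) \<Rightarrow> bool" where
  "marked_from q A \<longleftrightarrow>
     (\<forall>i \<in> {1..<e}. src (Q i) \<noteq> 0 \<longrightarrow> A (Q i) \<noteq> 0) \<and>
     (\<forall>i \<in> {q..<e}. A (Q i) \<noteq> 0 \<longrightarrow> A (P (Q i)) \<noteq> 0) \<and>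
     (\<forall>i \<in> {1..<e}. A (Q i) \<noteq> 0 \<longrightarrow> src (Q i) \<noteq> 0 \<or>
        (\<exists>i' \<in> {1..<e}. A (Q i') \<noteq> 0 \<and> P (Q i') = Q i))"

lemma marked_start: "marked_from e A0"
  using A_eq unfolding marked_from_def by auto

text \<open>Parents precede children on the queue, so going backwards each node has its final mark
  when it is processed. A new mark goes to an earlier position and is justified by the
  child.\<close>

lemma marked_step:
  assumes "marked_from q A" "1 < q" "q \<le> e"
  shows "marked_from (q - 1) (if A (Q (q - 1)) \<noteq> 0 then A(P (Q (q - 1)) := 1) else A)"
    (is "marked_from _ ?A")
proof -
  define x where "x = Q (q - 1)"
  have x: "P x \<in> Q ` {..<q - 1}" using tree[of "q - 1"] assms unfolding x_def by fastforce
  have mono: "A y \<noteq> 0 \<Longrightarrow> ?A y \<noteq> 0" for y by auto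
  have same: "?A (Q i) = A (Q i)" if "i \<in> {q - 1..<e}" for i
  proof -
    obtain i' where "i' < q - 1" "P x = Q i'" using x by auto
    then have "Q i \<noteq> P x" using that inj_onD[OF Q_inj, of i i'] by auto
    then show ?thesis by (simp add: x_def)
  qed
  have "?A (P (Q i)) \<noteq> 0" if "i \<in> {q - 1..<e}" "?A (Q i) \<noteq> 0" for i
  proof (cases "i = q - 1")
    case True
    then show ?thesis using that same[OF that(1)] by auto
  next
    case False
    then have "i \<in> {q..<e}" using that by auto
    then show ?thesis using assms(1) that same[OF that(1)] mono unfolding marked_from_def by auto
  qed
  moreover have "src (Q i) \<noteq> 0 \<or> (\<exists>i' \<in> {1..<e}. ?A (Q i') \<noteq> 0 \<and> P (Q i') = Q i)"
    if "i \<in> {1..<e}" "?A (Q i) \<noteq> 0" for i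
  proof (cases "A (Q i) = 0")
    case True
    then have "A x \<noteq> 0" "Q i = P x" using that by (auto simp: x_def split: if_splits)
    moreover have "?A x \<noteq> 0" using calculation mono by blast
    ultimately show ?thesis using assms by (intro disjI2 bexI[of _ "q - 1"]) (auto simp: x_def)
  next
    case False
    then show ?thesis using assms(1) that mono unfolding marked_from_def by meson
  qed
  ultimately show ?thesis
    using assms(1) mono unfolding marked_from_def by meson
qed

section \<open>The finished search as a recursion step\<close>

definition Rc where "Rc = Q ` {..<e}"
definition lev where "lev x = D x - Suc base"
definition alive where "alive = {(U b, V b) | b. b < N \<and> al b \<noteq> 0}"
definition sources where "sources = {x. src x \<noteq> 0}"
text \<open>Cells of \<open>A\<close> outside \<open>Rc\<close> may be stale, and that of
  \<open>t\<close> may be marked as a parent or may still be stale.\<close>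

definition tree_of where "tree_of A = {x \<in> Rc - {t}. A x \<noteq> 0}"

lemma Rc_iff: "x \<in> Rc \<longleftrightarrow> base < D x"
  using reached_iff by (simp add: Rc_def)

lemma scanned_all: "scanned Q e v 0 = {b. b < N \<and> V b \<in> Rc}"
  by (auto simp: scanned_def Rc_def)

lemma Rc_minus_t: "Rc - {t} = Q ` {1..<e}"
proof -
  have "{..<e} = insert 0 {1..<e}" using e_pos by auto
  then show ?thesis using Q_inj Q_0 e_pos unfolding Rc_def by (auto simp: inj_on_def)
qed

lemma stage_axioms:
  assumes A: "marked_from 1 A" and "1 \<le> j"
  shows "stage t alive sources Rc (tree_of A) lev P j"
proof
  have alive_sub: "alive \<subseteq> (\<lambda>b. (U b, V b)) ` {..<N}" by (auto simp: alive_def)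
  then show "finite alive" using finite_surj by blast
  show "finite Rc" by (simp add: Rc_def)
  show "t \<in> Rc" "lev t = 0" using D_t Rc_iff by (auto simp: lev_def)
  \<comment> \<open>The queue is exhausted, so all arcs into reached nodes have been scanned and
    obey the level condition.\<close>
  have arc: "base < D u \<and> D u \<le> Suc (D v)" if "(u, v) \<in> alive" "v \<in> Rc" for u v
    using that scanned_D unfolding scanned_all alive_def by auto
  then show "u \<in> Rc" "lev u \<le> Suc (lev v)" if "(u, v) \<in> alive" "v \<in> Rc" for u v
    using that Rc_iff[of v] unfolding Rc_iff lev_def by fastforce+
  show "(x, P x) \<in> alive" "P x \<in> Rc" "lev x = Suc (lev (P x))" if x: "x \<in> Rc" "x \<noteq> t" for x
  proof -
    obtain i where i: "i \<in> {1..<e}" "x = Q i" using x Rc_minus_t by blast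
    then obtain b where b: "b < N" "al b \<noteq> 0" "U b = x" "V b = P x" "D x = Suc (D (P x))"
      "P x \<in> Q ` {..<i}" using tree[of i] by auto
    from b(1,2) have "(U b, V b) \<in> alive" unfolding alive_def by blast
    then show "(x, P x) \<in> alive" using b(3,4) by simp
    show "P x \<in> Rc" using b(6) i by (auto simp: Rc_def)
    then show "lev x = Suc (lev (P x))" using b(5) unfolding Rc_iff lev_def by simp
  qed
  show "tree_of A \<subseteq> Rc - {t}" by (auto simp: tree_of_def)
  have eq: "tree_of A = {Q i | i. i \<in> {1..<e} \<and> A (Q i) \<noteq> 0}"
    unfolding tree_of_def Rc_minus_t by auto
  show "sources \<inter> Rc - {t} \<subseteq> tree_of A"
  proof
    fix x assume "x \<in> sources \<inter> Rc - {t}"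
    then have "x \<in> Q ` {1..<e}" "src x \<noteq> 0" using Rc_minus_t by (auto simp: sources_def)
    then show "x \<in> tree_of A" using A unfolding eq marked_from_def by auto
  qed
  show "P x \<in> tree_of A" if "x \<in> tree_of A" "P x \<noteq> t" for x
  proof -
    have "x \<in> Rc" "x \<noteq> t" using that by (auto simp: tree_of_def)
    then obtain i where "i \<in> {1..<e}" "x = Q i" using Rc_minus_t by blast
    moreover from this have "P x \<in> Rc" using tree[of i] by (auto simp: Rc_def)
    moreover have "A x \<noteq> 0" using that by (auto simp: tree_of_def)
    ultimately show ?thesis using that(2) A unfolding marked_from_def tree_of_def by auto
  qed
  show "x \<in> sources \<or> (\<exists>u \<in> tree_of A. P u = x)" if "x \<in> tree_of A" for x
    using that A unfolding eq marked_from_def sources_def by fastforce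
qed fact

lemma c_eq_card: "c = card (sources \<inter> Rc - {t})"
proof -
  have "c = (\<Sum>i \<in> {1..<e}. if src (Q i) \<noteq> 0 then 1 else 0)"
    unfolding c_eq
  proof (intro sum.cong refl)
    show "src (Q i) = (if src (Q i) \<noteq> 0 then 1 else 0)" for i using src_le[of "Q i"] by auto
  qed
  also have "\<dots> = card {i \<in> {1..<e}. src (Q i) \<noteq> 0}"
    by (simp add: sum.If_cases Int_def)
  also have "\<dots> = card (Q ` {i \<in> {1..<e}. src (Q i) \<noteq> 0})"
    using Q_inj by (intro card_image[symmetric]) (auto intro: inj_on_subset)
  also have "Q ` {i \<in> {1..<e}. src (Q i) \<noteq> 0} = {x \<in> Q ` {1..<e}. src x \<noteq> 0}"
    by auto
  also have "\<dots> = sources \<inter> Rc - {t}"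
    unfolding Rc_minus_t[symmetric] by (auto simp: sources_def)
  finally show ?thesis .
qed

lemma K_eq_card: "1 \<le> i \<Longrightarrow> K (Suc base + i) = card {x \<in> Rc. lev x = i}"
proof -
  assume i: "1 \<le> i"
  have "K (Suc base + i) = card {q \<in> {1..<e}. D (Q q) = Suc base + i}"
    using K_eq[of "Suc base + i"] by simp
  also have "\<dots> = card (Q ` {q \<in> {1..<e}. D (Q q) = Suc base + i})"
    using Q_inj by (intro card_image[symmetric]) (auto intro: inj_on_subset)
  also have "Q ` {q \<in> {1..<e}. D (Q q) = Suc base + i} = {x \<in> Q ` {1..<e}. D x = Suc base + i}"
    by auto
  also have "\<dots> = {x \<in> Rc. lev x = i}"
    unfolding Rc_minus_t[symmetric] using i D_t Rc_iff by (auto simp: lev_def)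
  finally show ?thesis .
qed

text \<open>The node at queue position \<open>q\<close> has level at most \<open>q\<close>, so
  levels from \<open>e\<close> on are empty. A level that is too large for the cut is nonempty,
  hence the search for \<open>j\<close> stops by \<open>e\<close>.\<close>

lemma level_nonempty_less:
  assumes "1 \<le> i" "0 < K (Suc base + i)"
  shows "i < e"
proof -
  have "{q \<in> {1..<e}. D (Q q) = Suc base + i} \<noteq> {}"
    using assms K_eq[of "Suc base + i"] by (metis (no_types, lifting) card.empty less_add_Suc1 less_irrefl add_Suc)
  then obtain q where "q < e" "D (Q q) = Suc base + i" by auto
  then show ?thesis using D_le[of q] by simp
qed

lemma card_Rc: "card Rc \<le> n"
  using e_le_n card_image_le[of "{..<e}" Q] unfolding Rc_def by simp

end

section \<open>One stage of the program\<close>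

text \<open>\<open>W_ge\<close> is dictated by the offset \<open>d\<close>, which grows by
  \<open>n + 2\<close> in each of the \<open>n * (f + 1)\<close> stages; the other terms are for
  counters and array positions.\<close>

locale run = arcs n N U V nx fr
  for n N :: nat and U V nx fr :: "nat \<Rightarrow> nat" +
  fixes k :: kind and es :: "(nat \<times> nat) list" and Ix Bs :: "nat \<Rightarrow> nat" and f W :: nat
  assumes Ix_less: "b < N \<Longrightarrow> Ix b < length es"
    and edge_Ix: "b < N \<Longrightarrow> edge_of k (es ! Ix b) = edge_of k (U b, V b)"
    and Bs_le: "Bs x \<le> 1"
    and W_ge: "n * (f + 1) * (n + 2) + n + f + N + length es + 3 \<le> W"
begin

definition static :: "state \<Rightarrow> bool" where
  "static s \<longleftrightarrow> s ''n'' 0 = n \<and> s ''f'' 0 = f \<and> s ''N'' 0 = N \<and> s ''U'' = U \<and> s ''V'' = V \<and>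
     s ''X'' = nx \<and> s ''Z'' = fr \<and> s ''I'' = Ix \<and> s ''B'' = Bs"

definition bfs_of :: "state \<Rightarrow> nat \<Rightarrow> nat \<Rightarrow> state \<Rightarrow> bool" where
  "bfs_of s0 t base s \<longleftrightarrow> bfs_state n N U V nx fr t base (s0 ''L'') (s0 ''C'') (s ''a'' 0) (s ''v'' 0)
     (s ''h'' 0) (s ''e'' 0) (s ''c'' 0) (s ''D'') (s ''P'') (s ''Q'') (s ''A'') (s ''K'')"

definition search_of :: "state \<Rightarrow> nat \<Rightarrow> nat \<Rightarrow> state \<Rightarrow> bool" where
  "search_of s0 t base s \<longleftrightarrow> search n N U V nx fr t base (s0 ''L'') (s0 ''C'') (s ''v'' 0)
     (s ''e'' 0) (s ''c'' 0) (s ''D'') (s ''P'') (s ''Q'') (s ''A'') (s ''K'')"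

text \<open>One loop interleaves scanning and dequeuing, so its body is loop-free and the total is
  linear. Scanning an arc may queue a node, which the weight 2 outweighs; dequeuing lowers the
  second summand.\<close>

definition bfs_measure :: "state \<Rightarrow> nat" where
  "bfs_measure s = 2 * (N - card (scanned (s ''Q'') (s ''h'' 0) (s ''v'' 0) (s ''a'' 0))) +
     (s ''e'' 0 - s ''h'' 0)"

lemma bfs_step_correct:
  assumes inv: "bfs_of s0 t base s" and st: "static s"
    and same: "s ''L'' = s0 ''L''" "s ''C'' = s0 ''C''" "s ''d'' 0 = base"
    and C: "\<And>x. s0 ''C'' x \<le> 1" and base: "base + n + 2 \<le> W"
    and b: "0 < s ''a'' 0 + (s ''e'' 0 - s ''h'' 0)"
  shows "wp W bfs_step (\<lambda>s'. bfs_of s0 t base s' \<and> bfs_measure s' < bfs_measure s) s"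
proof -
  interpret bfs_state n N U V nx fr t base "s0 ''L''" "s0 ''C''" "s ''a'' 0" "s ''v'' 0"
     "s ''h'' 0" "s ''e'' 0" "s ''c'' 0" "s ''D''" "s ''P''" "s ''Q''" "s ''A''" "s ''K''"
    using inv unfolding bfs_of_def .
  have regs: "s ''U'' = U" "s ''X'' = nx" "s ''Z'' = fr" using st by (auto simp: static_def)
  have W: "n \<le> W" "N + 1 \<le> W" using W_ge by auto
  show ?thesis
  proof (cases "s ''a'' 0 = 0")
    case True
    then have h: "s ''h'' 0 < s ''e'' 0" using b by simp
    have "s ''Q'' (s ''h'' 0) < n" using Q_less[OF h] .
    then have bounds: "s ''Q'' (s ''h'' 0) \<le> W" "Suc (s ''h'' 0) \<le> W"
      "fr (s ''Q'' (s ''h'' 0)) \<le> W"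
      using W h e_le_n fr_le[of "s ''Q'' (s ''h'' 0)"] by auto
    show ?thesis
      using dequeue[OF True h] True h bounds
      by (simp add: bfs_step_def regs bfs_of_def bfs_measure_def)
  next
    case False
    define b where "b = s ''a'' 0 - Suc 0"
    have h: "0 < s ''h'' 0" using start False by auto
    have bN: "b < N" using a_le False by (auto simp: b_def)
    have bounds: "b \<le> W" "U b \<le> W" "nx b \<le> W"
      using bN W tail_less[OF bN] nx_le[OF bN] by auto
    show ?thesis
    proof (cases "s0 ''L'' b \<noteq> 0 \<and> s ''D'' (U b) \<le> base")
      case True
      have "s ''C'' (U b) \<le> 1" using C same by simp
      moreover have "s ''c'' 0 \<le> s ''e'' 0 - 1" using c_le C by simp
      moreover have "s ''K'' (Suc (s ''D'' (s ''v'' 0))) \<le> s ''e'' 0 - 1"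
        using K_le front_reached(2)[OF h] by simp
      moreover have "U b \<notin> s ''Q'' ` {..<s ''e'' 0}"
        using True reached_iff[of "U b"] by auto
      moreover have "s ''v'' 0 < n" using front[OF h] Q_less[of "s ''h'' 0 - 1"] h h_le by auto
      ultimately have bounds': "s ''C'' (U b) \<le> W" "s ''c'' 0 + s ''C'' (U b) \<le> W"
        "Suc (s ''K'' (Suc (s ''D'' (s ''v'' 0)))) \<le> W" "s ''v'' 0 \<le> W"
        "Suc (s ''e'' 0) \<le> W" "s ''e'' 0 \<le> W" "Suc (s ''D'' (s ''v'' 0)) \<le> W"
        using W e_le_n e_pos base D_v_le[OF h] by auto
      have b': "s ''a'' 0 - 1 = b" by (simp add: b_def)
      have pre: "0 < s ''a'' 0" "s0 ''L'' (s ''a'' 0 - 1) \<noteq> 0" "s ''D'' (U (s ''a'' 0 - 1)) \<le> base"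
        using True False by (auto simp: b_def)
      note new = new_arc[OF pre refl, unfolded b']
      have "card (scanned (s ''Q'') (s ''h'' 0) (s ''v'' 0) (s ''a'' 0)) < N"
        using new(2) card_scanned_le[of "(s ''Q'')(s ''e'' 0 := U b)" "s ''h'' 0" "s ''v'' 0" "nx b"]
        by simp
      then have less: "2 * (N - card (scanned ((s ''Q'')(s ''e'' 0 := U b)) (s ''h'' 0) (s ''v'' 0) (nx b)))
          + (Suc (s ''e'' 0) - s ''h'' 0) < bfs_measure s"
        unfolding bfs_measure_def new(2) using h_le by linarith
      show ?thesis
        using new(1) less pre(1) True bounds bounds'
        by (simp add: bfs_step_def regs bfs_of_def bfs_measure_def[of "_(_ := _)"] same b_def[symmetric]
            less_Suc_eq_le)
    next
      case skip: False
      have b': "s ''a'' 0 - 1 = b" by (simp add: b_def)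
      have pre: "0 < s ''a'' 0" "s0 ''L'' (s ''a'' 0 - 1) = 0 \<or> base < s ''D'' (U (s ''a'' 0 - 1))"
        using skip False by (auto simp: b_def)
      note old = skip_arc[OF pre, unfolded b']
      have "card (scanned (s ''Q'') (s ''h'' 0) (s ''v'' 0) (s ''a'' 0)) < N"
        using old(2) card_scanned_le[of "s ''Q''" "s ''h'' 0" "s ''v'' 0" "nx b"] by simp
      then have less: "2 * (N - card (scanned (s ''Q'') (s ''h'' 0) (s ''v'' 0) (nx b)))
          + (s ''e'' 0 - s ''h'' 0) < bfs_measure s"
        unfolding bfs_measure_def old(2) by linarith
      have "\<not> (0 < s0 ''L'' b \<and> s ''D'' (U b) \<le> base)" using skip by simp
      then show ?thesis
        using old(1) less pre(1) bounds
        by (simp add: bfs_step_def regs bfs_of_def bfs_measure_def[of "_(_ := _)"] same b_def[symmetric]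
            less_Suc_eq_le del: de_Morgan_conj)
    qed
  qed
qed

lemma bfs_correct:
  assumes st: "static s" and "s ''t'' 0 = t" "t < n" "s ''d'' 0 = base" "base + n + 2 \<le> W"
    and D: "\<And>x. s ''D'' x \<le> base" and K: "\<And>x. base < x \<Longrightarrow> s ''K'' x = 0"
    and C: "\<And>x. s ''C'' x \<le> 1"
  shows "halts W bfs s (cost bfs_init + (Suc (cost bfs_step) * (2 * N + 1) + 1)) (search_of s t base)"
  unfolding bfs_def
proof (rule halts_Seq[OF halts_unchanged[OF wp_halts]])
  show "wp W bfs_init (\<lambda>s1. bfs_of s t base s1 \<and> bfs_measure s1 \<le> 2 * N + 1) s"
    using assms bfs_start[OF \<open>t < n\<close> D K, where v = "s ''v'' 0" and P = "s ''P''" and Q = "s ''Q''"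
      and A = "s ''A''" and src = "s ''C''" and al = "s ''L''"]
    by (simp add: bfs_init_def bfs_of_def bfs_measure_def)
next
  fix s1 assume s1: "(bfs_of s t base s1 \<and> bfs_measure s1 \<le> 2 * N + 1) \<and> unchanged bfs_init s s1"
  let ?w = "While (positive (Plus (var ''a'') (Minus (var ''e'') (var ''h'')))) bfs_step"
  have regs: "static s1" "s1 ''L'' = s ''L''" "s1 ''C'' = s ''C''" "s1 ''d'' 0 = base"
    using s1 st \<open>s ''d'' 0 = base\<close>
    by (auto simp: unchanged_def bfs_init_def static_def)
  have "halts W ?w s1 (Suc (cost bfs_step) * (2 * N + 1) + 1)
     (\<lambda>s'. bfs_of s t base s' \<and> unchanged bfs_step s1 s' \<and>
        \<not> bval (positive (Plus (var ''a'') (Minus (var ''e'') (var ''h'')))) s')"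
  proof (rule halts_While_unchanged[where \<mu> = bfs_measure])
    fix s2 assume s2: "bfs_of s t base s2" "unchanged bfs_step s1 s2"
      "bval (positive (Plus (var ''a'') (Minus (var ''e'') (var ''h'')))) s2"
    have regs2: "static s2" "s2 ''L'' = s ''L''" "s2 ''C'' = s ''C''" "s2 ''d'' 0 = base"
      using s2(2) regs by (auto simp: unchanged_def bfs_step_def static_def)
    show "halts W bfs_step s2 (cost bfs_step)
        (\<lambda>s''. bfs_of s t base s'' \<and> bfs_measure s'' < bfs_measure s2)"
      using s2(3) by (intro wp_halts bfs_step_correct[OF s2(1) regs2 C \<open>base + n + 2 \<le> W\<close>]) auto
  qed (use s1 in auto)
  then show "halts W ?w s1 (Suc (cost bfs_step) * (2 * N + 1) + 1) (search_of s t base)"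
  proof (rule halts_mono[OF _ order_refl])
    fix s' assume "bfs_of s t base s' \<and> unchanged bfs_step s1 s' \<and>
        \<not> bval (positive (Plus (var ''a'') (Minus (var ''e'') (var ''h'')))) s'"
    then have s': "bfs_of s t base s'" and z: "s' ''a'' 0 = 0" "s' ''e'' 0 \<le> s' ''h'' 0" by auto
    have "s' ''h'' 0 \<le> s' ''e'' 0" using s' bfs_state.h_le unfolding bfs_of_def by blast
    then have "s' ''h'' 0 = s' ''e'' 0" using z by simp
    then show "search_of s t base s'"
      using s' z C unfolding bfs_of_def search_of_def search_def search_axioms_def by simp
  qed
qed

lemma mark_correct:
  assumes st: "search_of s0 t base s"
  shows "halts W mark s (Suc (cost mark_step) * N + 1)
     (\<lambda>s'. search.marked_from (s0 ''C'') (s ''e'' 0) (s ''P'') (s ''Q'') 1 (s' ''A''))"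
proof -
  interpret search n N U V nx fr t base "s0 ''L''" "s0 ''C''" "s ''v'' 0"
     "s ''e'' 0" "s ''c'' 0" "s ''D''" "s ''P''" "s ''Q''" "s ''A''" "s ''K''"
    using st unfolding search_of_def .
  let ?I = "\<lambda>s'. 1 \<le> s' ''e'' 0 \<and> s' ''e'' 0 \<le> s ''e'' 0 \<and> marked_from (s' ''e'' 0) (s' ''A'')"
  have W: "n \<le> W" "1 \<le> W" using W_ge by auto
  have "halts W mark s (Suc (cost mark_step) * N + 1)
     (\<lambda>s'. ?I s' \<and> unchanged mark_step s s' \<and> \<not> bval (Less (Const 1) (var ''e'')) s')"
    unfolding mark_def
  proof (rule halts_While_unchanged[where \<mu> = "\<lambda>s'. s' ''e'' 0 - 1"])
    fix s' assume s': "?I s'" "unchanged mark_step s s'" "bval (Less (Const 1) (var ''e'')) s'"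
    define q where "q = s' ''e'' 0"
    have q: "1 < q" "q \<le> s ''e'' 0" using s' by (auto simp: q_def)
    have regs: "s' ''Q'' = s ''Q''" "s' ''P'' = s ''P''"
      using s'(2) by (auto simp: unchanged_def mark_step_def)
    define x where "x = s ''Q'' (q - Suc 0)"
    have "s ''P'' x \<in> s ''Q'' ` {..<q - 1}" using tree[of "q - 1"] q unfolding x_def by fastforce
    then have "s ''P'' x < n" using Q_less q by auto
    moreover have "x < n" using Q_less q by (auto simp: x_def)
    ultimately have bounds: "s ''P'' x \<le> W" "x \<le> W" "q - Suc 0 \<le> W" "Suc 0 \<le> W"
      using W e_le_n q by auto
    have "marked_from (q - 1) (if s' ''A'' x \<noteq> 0 then (s' ''A'')(s ''P'' x := 1) else s' ''A'')"
      using marked_step[of q "s' ''A''"] s'(1) q by (auto simp: x_def q_def)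
    then have "wp W mark_step (\<lambda>s''. ?I s'' \<and> s'' ''e'' 0 - 1 < s' ''e'' 0 - 1) s'"
      using bounds q
      by (simp add: mark_step_def q_def[symmetric] x_def[symmetric] regs split: if_splits) linarith+
    then show "halts W mark_step s' (cost mark_step) (\<lambda>s''. ?I s'' \<and> s'' ''e'' 0 - 1 < s' ''e'' 0 - 1)"
      by (rule wp_halts)
  qed (use marked_start e_pos e_le in auto)
  then show ?thesis by (rule halts_mono) (auto simp: le_Suc_eq dest: le_antisym)
qed

section \<open>The cut level\<close>

definition level_choice :: "nat \<Rightarrow> nat \<Rightarrow> nat \<Rightarrow> (nat \<Rightarrow> nat) \<Rightarrow> bool" where
  "level_choice base j c K \<longleftrightarrow> 1 \<le> j \<and> j \<le> n + 1 \<and> K (Suc base + j) \<le> c * j \<and>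
     (\<forall>i. 1 \<le> i \<longrightarrow> i < j \<longrightarrow> c * i < K (Suc base + i))"

lemma choose_level_correct:
  assumes st: "search_of s0 t base s1"
    and same: "s ''c'' = s1 ''c''" "s ''K'' = s1 ''K''" "s ''d'' 0 = base"
  shows "halts W choose_level s (1 + (Suc 1 * N + 1))
     (\<lambda>s'. level_choice base (s' ''j'' 0) (s1 ''c'' 0) (s1 ''K''))"
proof -
  interpret search n N U V nx fr t base "s0 ''L''" "s0 ''C''" "s1 ''v'' 0"
     "s1 ''e'' 0" "s1 ''c'' 0" "s1 ''D''" "s1 ''P''" "s1 ''Q''" "s1 ''A''" "s1 ''K''"
    using st unfolding search_of_def .
  have W: "n + 1 \<le> W" "1 \<le> W" using W_ge by auto
  let ?I = "\<lambda>s'. 1 \<le> s' ''j'' 0 \<and> s' ''j'' 0 \<le> s1 ''e'' 0 \<and>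
     (\<forall>i. 1 \<le> i \<longrightarrow> i < s' ''j'' 0 \<longrightarrow> s1 ''c'' 0 * i < s1 ''K'' (Suc base + i))"
  let ?b = "Less (Times (var ''c'') (var ''j'')) (Read ''K'' (Plus (Plus (var ''d'') (Const 1)) (var ''j'')))"
  show ?thesis
    unfolding choose_level_def
  proof (rule halts_Seq)
    show "halts W (assign ''j'' (Const 1)) s 1 (\<lambda>s'. ?I s' \<and> unchanged (assign ''j'' (Const 1)) s s' \<and> s' ''j'' 0 = 1)"
      using e_pos W wp_halts[of W "assign ''j'' (Const 1)"
        "\<lambda>s'. ?I s' \<and> unchanged (assign ''j'' (Const 1)) s s' \<and> s' ''j'' 0 = 1" s]
      by (simp add: unchanged_def)
    fix s2 assume s2: "?I s2 \<and> unchanged (assign ''j'' (Const 1)) s s2 \<and> s2 ''j'' 0 = 1"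
    have "halts W (While ?b (incr ''j'')) s2 (Suc 1 * N + 1)
       (\<lambda>s'. ?I s' \<and> unchanged (incr ''j'') s2 s' \<and> \<not> bval ?b s')"
    proof (rule halts_While_unchanged[where \<mu> = "\<lambda>s'. s1 ''e'' 0 - s' ''j'' 0"])
      fix s' assume s': "?I s'" "unchanged (incr ''j'') s2 s'" "bval ?b s'"
      have regs: "s' ''c'' = s1 ''c''" "s' ''K'' = s1 ''K''" "s' ''d'' 0 = base"
        using s'(2) s2 same by (auto simp: unchanged_def)
      define j where "j = s' ''j'' 0"
      have large: "s1 ''c'' 0 * j < s1 ''K'' (Suc base + j)"
        using s'(3) regs by (simp add: j_def)
      then have j: "j < s1 ''e'' 0" using level_nonempty_less[of j] s'(1) by (simp add: j_def)
      have "wp W (incr ''j'') (\<lambda>s''. ?I s'' \<and> s1 ''e'' 0 - s'' ''j'' 0 < s1 ''e'' 0 - s' ''j'' 0) s'"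
        using s'(1) j large W e_le_n by (auto simp: j_def less_Suc_eq)
      then show "halts W (incr ''j'') s' 1 (\<lambda>s''. ?I s'' \<and> s1 ''e'' 0 - s'' ''j'' 0 < s1 ''e'' 0 - s' ''j'' 0)"
        using wp_halts by fastforce
    qed (use s2 e_le in auto)
    then show "halts W (While ?b (incr ''j'')) s2 (Suc 1 * N + 1)
       (\<lambda>s'. level_choice base (s' ''j'' 0) (s1 ''c'' 0) (s1 ''K''))"
    proof (rule halts_mono[OF _ order_refl])
      fix s' assume s': "?I s' \<and> unchanged (incr ''j'') s2 s' \<and> \<not> bval ?b s'"
      then have "s' ''c'' = s1 ''c''" "s' ''K'' = s1 ''K''" "s' ''d'' 0 = base"
        using s2 same by (auto simp: unchanged_def)
      then show "level_choice base (s' ''j'' 0) (s1 ''c'' 0) (s1 ''K'')"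
        using s' e_le_n unfolding level_choice_def by (auto simp: not_less)
    qed
  qed
qed

definition keep :: "nat \<Rightarrow> nat \<Rightarrow> nat \<Rightarrow> (nat \<Rightarrow> nat) \<Rightarrow> (nat \<Rightarrow> nat) \<Rightarrow> nat \<Rightarrow> bool" where
  "keep t base j D A b \<longleftrightarrow> (if V b = t then A (U b) = 0
     else base < D (V b) \<and> D (V b) < Suc base + j \<and> A (V b) = 0)"

definition new_L :: "nat \<Rightarrow> state \<Rightarrow> nat \<Rightarrow> nat" where
  "new_L base s b = (if s ''g'' 0 < f
     then if keep (s ''t'' 0) base (s ''j'' 0) (s ''D'') (s ''A'') b then s ''L'' b else 0
     else 1)"

definition new_C :: "nat \<Rightarrow> state \<Rightarrow> nat \<Rightarrow> nat" where
  "new_C base s x = (if s ''g'' 0 < f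
     then if Suc base < s ''D'' x \<and> s ''D'' x < Suc (Suc base) + s ''j'' 0 \<and>
       \<not> (s ''A'' x = 0 \<and> s ''D'' x < Suc base + s ''j'' 0) then 1 else 0
     else Bs x)"

definition marks :: "state \<Rightarrow> nat \<Rightarrow> bool" where
  "marks s b \<longleftrightarrow> s ''L'' b \<noteq> 0 \<and> V b = s ''t'' 0 \<and> s ''A'' (U b) \<noteq> 0"

text \<open>A closed form in the state before the pass is possible because only round
  \<open>b\<close> reads or writes entry \<open>b\<close> of \<open>L\<close>, and
  \<open>new_C\<close> does not refer to \<open>C\<close>: arcs with a common tail write the same
  value.\<close>

definition updated :: "nat \<Rightarrow> state \<Rightarrow> nat \<Rightarrow> state \<Rightarrow> bool" where
  "updated base s i s' \<longleftrightarrow>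
     s' ''L'' = (\<lambda>b. if b < i then new_L base s b else s ''L'' b) \<and>
     s' ''C'' = (\<lambda>x. if x \<in> U ` {..<i} then new_C base s x else s ''C'' x) \<and>
     s' ''out'' = (\<lambda>y. if \<exists>b < i. marks s b \<and> Ix b = y then 1 else s ''out'' y)"

lemma update_step_correct:
  assumes st: "static s" and "s ''d'' 0 = base" and i: "s ''i'' 0 < N"
  shows "wp W update_step (\<lambda>s'. s' ''i'' 0 = Suc (s ''i'' 0) \<and>
      s' ''L'' = (s ''L'')(s ''i'' 0 := new_L base s (s ''i'' 0)) \<and>
      s' ''C'' = (s ''C'')(U (s ''i'' 0) := new_C base s (U (s ''i'' 0))) \<and>
      s' ''out'' = (if marks s (s ''i'' 0) then (s ''out'')(Ix (s ''i'' 0) := 1) else s ''out'')) s"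
proof -
  define b where "b = s ''i'' 0"
  have b: "b < N" using i by (simp add: b_def)
  have regs: "s ''U'' = U" "s ''V'' = V" "s ''I'' = Ix" "s ''B'' = Bs" "s ''f'' 0 = f"
    using st by (auto simp: static_def)
  have bounds: "U b \<le> W" "V b \<le> W" "Ix b \<le> W" "b \<le> W" "Suc b \<le> W" "Suc 0 \<le> W" "Bs (U b) \<le> W"
    using tail_less[OF b] head_less[OF b] Ix_less[OF b] W_ge b Bs_le[of "U b"] by auto
  have idem: "(s ''L'')(b := 0) = s ''L''" if "s ''L'' b = 0"
    using that by (metis fun_upd_triv)
  have eq: "\<not> V b < s ''t'' 0 \<and> \<not> s ''t'' 0 < V b \<longleftrightarrow> V b = s ''t'' 0" by auto
  show ?thesis
    unfolding b_def[symmetric]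
    using bounds assms(2)
    by (cases "s ''L'' b = 0"; cases "V b = s ''t'' 0"; cases "s ''g'' 0 < f"; cases "s ''A'' (U b) = 0")
      (simp_all add: update_step_def regs b_def[symmetric] new_L_def new_C_def keep_def marks_def eq idem)
qed

lemma updated_Suc:
  assumes "updated base s i s'" and "s'' ''L'' = (s' ''L'')(i := new_L base s i)"
    and "s'' ''C'' = (s' ''C'')(U i := new_C base s (U i))"
    and "s'' ''out'' = (if marks s i then (s' ''out'')(Ix i := 1) else s' ''out'')"
  shows "updated base s (Suc i) s''"
  using assms unfolding updated_def
  by (auto simp: fun_eq_iff less_Suc_eq lessThan_Suc)

lemma update_correct:
  assumes st: "static s" and d: "s ''d'' 0 = base"
  shows "halts W update s (1 + (Suc (cost update_step) * N + 1)) (updated base s N)"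
  unfolding update_def
proof (rule halts_Seq)
  let ?I = "\<lambda>s'. s' ''i'' 0 \<le> N \<and> updated base s (s' ''i'' 0) s'"
  show "halts W (assign ''i'' (Const 0)) s 1 (\<lambda>s'. ?I s' \<and> unchanged (assign ''i'' (Const 0)) s s')"
    using wp_halts[of W "assign ''i'' (Const 0)" "\<lambda>s'. ?I s' \<and> unchanged (assign ''i'' (Const 0)) s s'" s]
    by (simp add: unchanged_def updated_def)
  fix s1 assume s1: "?I s1 \<and> unchanged (assign ''i'' (Const 0)) s s1"
  have "halts W (While (Less (var ''i'') (var ''N'')) update_step) s1 (Suc (cost update_step) * N + 1)
     (\<lambda>s'. ?I s' \<and> unchanged update_step s1 s' \<and> \<not> bval (Less (var ''i'') (var ''N'')) s')"
  proof (rule halts_While_unchanged[where \<mu> = "\<lambda>s'. N - s' ''i'' 0"])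
    fix s2 assume s2: "?I s2" "unchanged update_step s1 s2" "bval (Less (var ''i'') (var ''N'')) s2"
    have same: "s2 x = s x" if "x \<notin> {''i'', ''u'', ''v'', ''L'', ''C'', ''out''}" for x
      using s2(2) s1 that by (auto simp: unchanged_def update_step_def)
    have st2: "static s2" "s2 ''d'' 0 = base" using st d unfolding static_def by (simp_all add: same)
    define i where "i = s2 ''i'' 0"
    have i: "i < N" using s2(3) st2 by (simp add: i_def static_def)
    have L: "s2 ''L'' i = s ''L'' i" using s2(1) by (simp add: updated_def i_def)
    have eqs: "new_L base s2 i = new_L base s i" "new_C base s2 = new_C base s" "marks s2 i = marks s i"
      by (auto simp: new_L_def new_C_def marks_def same L fun_eq_iff)
    show "halts W update_step s2 (cost update_step) (\<lambda>s''. ?I s'' \<and> N - s'' ''i'' 0 < N - s2 ''i'' 0)"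
    proof (rule halts_mono[OF wp_halts[OF update_step_correct[OF st2]] order_refl])
      show "s2 ''i'' 0 < N" using i by (simp add: i_def)
    next
      fix s3 assume s3: "s3 ''i'' 0 = Suc (s2 ''i'' 0) \<and>
        s3 ''L'' = (s2 ''L'')(s2 ''i'' 0 := new_L base s2 (s2 ''i'' 0)) \<and>
        s3 ''C'' = (s2 ''C'')(U (s2 ''i'' 0) := new_C base s2 (U (s2 ''i'' 0))) \<and>
        s3 ''out'' = (if marks s2 (s2 ''i'' 0) then (s2 ''out'')(Ix (s2 ''i'' 0) := 1) else s2 ''out'')"
      have "updated base s (Suc i) s3"
        using s3 s2(1) by (intro updated_Suc[of base s i s2]) (simp_all add: i_def[symmetric] eqs)
      then show "?I s3 \<and> N - s3 ''i'' 0 < N - s2 ''i'' 0"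
        using s3 i by (simp add: i_def)
    qed
  qed (use s1 in auto)
  then show "halts W (While (Less (var ''i'') (var ''N'')) update_step) s1 (Suc (cost update_step) * N + 1)
     (updated base s N)"
  proof (rule halts_mono[OF _ order_refl])
    fix s2 assume s2: "?I s2 \<and> unchanged update_step s1 s2 \<and> \<not> bval (Less (var ''i'') (var ''N'')) s2"
    then have "s2 ''N'' 0 = N"
      using s1 st by (auto simp: unchanged_def update_step_def static_def)
    then have "s2 ''i'' 0 = N" using s2 by auto
    then show "updated base s N s2" using s2 by auto
  qed
qed

section \<open>Memory contents as subgraph, sources and chosen edges\<close>

definition alive_arcs :: "state \<Rightarrow> (nat \<times> nat) set" where
  "alive_arcs s = {(U b, V b) | b. b < N \<and> s ''L'' b \<noteq> 0}"

definition cur_sources :: "state \<Rightarrow> nat set" where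
  "cur_sources s = {x. s ''C'' x \<noteq> 0}"

definition chosen_edges :: "state \<Rightarrow> nat edge set" where
  "chosen_edges s = {edge_of k (es ! i) | i. i < length es \<and> s ''out'' i \<noteq> 0}"

definition fresh :: "state \<Rightarrow> bool" where
  "fresh s \<longleftrightarrow> (\<forall>b < N. s ''L'' b = 1) \<and> (\<forall>x. s ''C'' x = (if x \<in> U ` {..<N} then Bs x else 0))"

text \<open>
  The values of \<open>D\<close> and the addresses used in \<open>K\<close> grow from stage to stage, so these arrays need
  not be cleared, which would cost \<open>O(n)\<close> instead of \<open>O(m)\<close> steps.
\<close>

definition stage_inv :: "nat \<Rightarrow> nat \<Rightarrow> state \<Rightarrow> bool" where
  "stage_inv t g s \<longleftrightarrow> static s \<and> s ''t'' 0 = t \<and> s ''g'' 0 = g \<and>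
     s ''d'' 0 = (t * (f + 1) + g) * (n + 2) \<and>
     (\<forall>x. s ''D'' x \<le> s ''d'' 0) \<and> (\<forall>x. s ''d'' 0 < x \<longrightarrow> s ''K'' x = 0) \<and>
     (\<forall>x. s ''C'' x \<le> 1) \<and> (\<forall>x. x \<notin> U ` {..<N} \<longrightarrow> s ''C'' x = 0)"

text \<open>What the induction over stages uses, freed from the search data. Before the last stage,
  \<open>s'\<close> describes the next subgraph and sources. The last stage restores the arrays for
  the next target, so only \<open>g' = 0\<close> is available there, and \<open>X\<close> covers on
  its own.\<close>

definition stage_result :: "nat \<Rightarrow> nat \<Rightarrow> state \<Rightarrow> state \<Rightarrow> bool" where
  "stage_result t g s s' \<longleftrightarrow> (\<exists>X. chosen_edges s' = chosen_edges s \<union> X \<and>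
     card X \<le> card (cur_sources s) \<and>
     (\<forall>g' X'. g' = 0 \<or> g < f \<and> covers k t (g' - 1) (alive_arcs s') (cur_sources s') X' \<longrightarrow>
        covers k t g' (alive_arcs s) (cur_sources s) (X \<union> X')) \<and>
     (g < f \<longrightarrow> (card (cur_sources s'))\<^sup>2 \<le> 24 * n * card (cur_sources s)) \<and>
     (g = f \<longrightarrow> fresh s'))"

lemma finite_sources: "\<forall>x. x \<notin> U ` {..<N} \<longrightarrow> s ''C'' x = 0 \<Longrightarrow> finite (cur_sources s)"
  by (rule finite_subset[of _ "U ` {..<N}"]) (auto simp: cur_sources_def)

lemma card_sources_le: "\<forall>x. x \<notin> U ` {..<N} \<longrightarrow> s ''C'' x = 0 \<Longrightarrow> card (cur_sources s) \<le> n"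
proof -
  assume "\<forall>x. x \<notin> U ` {..<N} \<longrightarrow> s ''C'' x = 0"
  then have "cur_sources s \<subseteq> U ` {..<N}" by (auto simp: cur_sources_def)
  then have "cur_sources s \<subseteq> {..<n}" using tail_less by auto
  then show ?thesis using card_mono[of "{..<n}" "cur_sources s"] by simp
qed

lemma stage_result_if_updated:
  assumes inv: "stage_inv t g s" and "t < n" "g \<le> f" and base: "s ''d'' 0 = base"
    and search: "search n N U V nx fr t base (s ''L'') (s ''C'') v e c D P Q A0 K"
    and marked: "search.marked_from (s ''C'') e P Q 1 A"
    and level: "level_choice base j c K"
    and s1: "static s1" "s1 ''t'' 0 = t" "s1 ''g'' 0 = g" "s1 ''j'' 0 = j" "s1 ''D'' = D" "s1 ''A'' = A"
      "s1 ''L'' = s ''L''" "s1 ''C'' = s ''C''" "s1 ''out'' = s ''out''"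
    and upd: "updated base s1 N s'"
  shows "stage_result t g s s'"
    and "\<And>x. s' ''C'' x \<le> 1" and "\<And>x. x \<notin> U ` {..<N} \<Longrightarrow> s' ''C'' x = 0"
    and "\<And>x. D x \<le> base + n + 2" and "\<And>x. base + n + 2 < x \<Longrightarrow> K x = 0"
proof -
  interpret sr: search n N U V nx fr t base "s ''L''" "s ''C''" v e c D P Q A0 K by (rule search)
  have j: "1 \<le> j" using level by (simp add: level_choice_def)
  let ?S = "cur_sources s" and ?tree = "sr.tree_of A"
  have S: "sr.sources = ?S" by (simp add: sr.sources_def cur_sources_def)
  have R: "sr.alive = alive_arcs s" by (simp add: sr.alive_def alive_arcs_def)
  interpret st: stage k t "alive_arcs s" ?S sr.Rc ?tree sr.lev P j
    using sr.stage_axioms[OF marked j] unfolding S R .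
  have C0: "\<forall>x. x \<notin> U ` {..<N} \<longrightarrow> s ''C'' x = 0" using inv by (simp add: stage_inv_def)
  have L': "s' ''L'' b = new_L base s1 b" if "b < N" for b
    using upd that by (simp add: updated_def)
  have C': "s' ''C'' x = (if x \<in> U ` {..<N} then new_C base s1 x else 0)" for x
    using upd C0 s1(8) by (simp add: updated_def)
  have tree_iff: "x \<in> ?tree \<longleftrightarrow> base < D x \<and> x \<noteq> t \<and> A x \<noteq> 0" for x
    by (auto simp: sr.tree_of_def sr.Rc_iff)
  show "s' ''C'' x \<le> 1" for x using Bs_le by (simp add: C' new_C_def)
  show "x \<notin> U ` {..<N} \<Longrightarrow> s' ''C'' x = 0" for x by (simp add: C')
  show "D x \<le> base + n + 2" for x
  proof (cases "base < D x")
    case True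
    then obtain i where "i < e" "x = Q i" using sr.reached_iff by auto
    then show ?thesis using sr.D_le[of i] sr.e_le_n by simp
  qed simp
  show "K x = 0" if "base + n + 2 < x" for x
    using sr.level_nonempty_less[of "x - Suc base"] sr.e_le_n that by fastforce
  have marks_iff: "marks s1 b \<longleftrightarrow> s ''L'' b \<noteq> 0 \<and> V b = t \<and> U b \<in> ?tree" if "b < N" for b
  proof -
    \<comment> \<open>For arcs into \<open>t\<close> the program tests the mark of the tail alone.
      This is sound: a remaining arc into \<open>t\<close> makes its tail reached, and without loops
      the tail is not \<open>t\<close>.\<close>
    have "U b \<noteq> t" if "V b = t" using no_loop[OF \<open>b < N\<close>] that by auto
    moreover have "base < D (U b)" if "V b = t" "s ''L'' b \<noteq> 0"
    proof -
      have "(U b, t) \<in> alive_arcs s" using that \<open>b < N\<close> by (auto simp: alive_arcs_def)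
      then show ?thesis using st.reached st.t_reached sr.Rc_iff by blast
    qed
    ultimately show ?thesis
      using s1 unfolding marks_def tree_iff by auto
  qed
  have out': "s' ''out'' y \<noteq> 0 \<longleftrightarrow> s ''out'' y \<noteq> 0 \<or> (\<exists>b < N. marks s1 b \<and> Ix b = y)" for y
    using upd s1(9) by (auto simp: updated_def)
  have "st.X = {edge_of k (U b, V b) | b. b < N \<and> marks s1 b}"
  proof (intro set_eqI iffI)
    fix y assume "y \<in> st.X"
    then obtain u where u: "y = edge_of k (u, t)" "u \<in> ?tree" "(u, t) \<in> alive_arcs s"
      by (auto simp: st.X_def)
    then obtain b where "b < N" "U b = u" "V b = t" "s ''L'' b \<noteq> 0" by (auto simp: alive_arcs_def)
    then show "y \<in> {edge_of k (U b, V b) | b. b < N \<and> marks s1 b}"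
      using u marks_iff[of b] by auto
  next
    fix y assume "y \<in> {edge_of k (U b, V b) | b. b < N \<and> marks s1 b}"
    then obtain b where "y = edge_of k (U b, V b)" "b < N" "marks s1 b" by blast
    moreover from this have "(U b, t) \<in> alive_arcs s"
      using marks_iff[of b] by (auto simp: alive_arcs_def)
    ultimately show "y \<in> st.X" using marks_iff[of b] by (auto simp: st.X_def)
  qed
  also have "\<dots> = {edge_of k (es ! Ix b) | b. b < N \<and> marks s1 b}"
    using edge_Ix by force
  finally have X: "st.X = {edge_of k (es ! Ix b) | b. b < N \<and> marks s1 b}" .
  have chosen: "chosen_edges s' = chosen_edges s \<union> st.X"
  proof (intro set_eqI iffI)
    fix y assume "y \<in> chosen_edges s'"
    then obtain i where i: "y = edge_of k (es ! i)" "i < length es" "s' ''out'' i \<noteq> 0"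
      unfolding chosen_edges_def by blast
    from i(3) consider "s ''out'' i \<noteq> 0" | b where "b < N" "marks s1 b" "Ix b = i"
      unfolding out' by blast
    then show "y \<in> chosen_edges s \<union> st.X"
    proof cases
      case 1
      then show ?thesis using i unfolding chosen_edges_def by blast
    next
      case 2
      then show ?thesis using i unfolding X by blast
    qed
  next
    fix y assume "y \<in> chosen_edges s \<union> st.X"
    then show "y \<in> chosen_edges s'"
    proof
      assume "y \<in> chosen_edges s"
      then show ?thesis unfolding chosen_edges_def out' by blast
    next
      assume "y \<in> st.X"
      then obtain b where b: "b < N" "marks s1 b" "y = edge_of k (es ! Ix b)" unfolding X by blast
      then have "s' ''out'' (Ix b) \<noteq> 0" unfolding out' by blast
      then show ?thesis using b Ix_less[OF b(1)] unfolding chosen_edges_def by blast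
    qed
  qed
  have rest: "alive_arcs s' = st.R'" "cur_sources s' = st.S'" if "g < f"
  proof -
    have keep_iff: "keep t base j D A b \<longleftrightarrow> (U b, V b) \<in> st.R'" if b: "b < N" "s ''L'' b \<noteq> 0" for b
    proof (cases "V b = t")
      case True
      have al: "(U b, t) \<in> alive_arcs s" using b True by (auto simp: alive_arcs_def)
      then have "base < D (U b)" using st.reached st.t_reached sr.Rc_iff by blast
      moreover have "U b \<noteq> t" using no_loop[OF b(1)] True by simp
      ultimately have "U b \<in> ?tree \<longleftrightarrow> A (U b) \<noteq> 0" by (simp add: tree_iff)
      then show ?thesis using True al by (simp add: keep_def st.R'_def)
    next
      case False
      have "(U b, V b) \<in> alive_arcs s" using b by (auto simp: alive_arcs_def)
      moreover have "D (V b) < Suc base + j \<longleftrightarrow> sr.lev (V b) < j"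
        using j by (auto simp: sr.lev_def)
      ultimately show ?thesis
        using False by (auto simp: keep_def st.R'_def tree_iff sr.Rc_iff)
    qed
    have L'': "s' ''L'' b \<noteq> 0 \<longleftrightarrow> s ''L'' b \<noteq> 0 \<and> (U b, V b) \<in> st.R'" if "b < N" for b
      using L'[OF that] keep_iff[OF that] \<open>g < f\<close> s1 by (auto simp: new_L_def)
    show "alive_arcs s' = st.R'"
    proof (intro set_eqI iffI)
      fix p assume "p \<in> alive_arcs s'"
      then show "p \<in> st.R'" using L'' by (auto simp: alive_arcs_def)
    next
      fix p assume p: "p \<in> st.R'"
      then have "p \<in> alive_arcs s" using st.R'_subset by blast
      then obtain b where b: "b < N" "s ''L'' b \<noteq> 0" "p = (U b, V b)"
        unfolding alive_arcs_def by blast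
      then have "s' ''L'' b \<noteq> 0" using p L'' by simp
      then show "p \<in> alive_arcs s'" using b unfolding alive_arcs_def by blast
    qed
    \<comment> \<open>The pass rewrites \<open>C\<close> at tails only. This includes all of
      \<open>S'\<close>, as a reached node other than \<open>t\<close> is the tail of its tree
      arc.\<close>
    have tails: "x \<in> U ` {..<N}" if "x \<in> sr.Rc" "x \<noteq> t" for x
      using st.par_arc[OF that] unfolding alive_arcs_def by blast
    have newC_iff: "new_C base s1 x \<noteq> 0 \<longleftrightarrow> x \<in> st.S'" for x
    proof -
      \<comment> \<open>Level 0 is \<open>t\<close> alone, so the strict test against
        \<open>Suc base\<close> excludes exactly the root among the reached nodes.\<close>
      have "base < D x \<and> x \<noteq> t \<longleftrightarrow> Suc base < D x"
      proof
        assume x: "base < D x \<and> x \<noteq> t"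
        then have "sr.lev x \<noteq> 0" using st.lev_eq_0 sr.Rc_iff by blast
        then show "Suc base < D x" by (simp add: sr.lev_def)
      qed (use sr.D_t in auto)
      moreover have "sr.lev x \<le> j \<longleftrightarrow> D x < Suc (Suc base) + j"
        "sr.lev x = j \<longleftrightarrow> D x = Suc base + j" using j by (auto simp: sr.lev_def)
      ultimately show ?thesis
        using \<open>g < f\<close> s1 unfolding st.S'_def new_C_def tree_iff mem_Collect_eq Diff_iff sr.Rc_iff
        by auto
    qed
    show "cur_sources s' = st.S'"
      using newC_iff tails unfolding cur_sources_def C' by (auto simp: st.S'_def)
  qed
  have ns: "st.num_sources = c" using sr.c_eq_card by (simp add: st.num_sources_def S)
  have ns_le: "st.num_sources \<le> card ?S"
  proof -
    have "finite ?S" using C0 by (rule finite_sources)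
    then show ?thesis unfolding st.num_sources_def by (intro card_mono) auto
  qed
  have "covers k t g' (alive_arcs s) ?S (st.X \<union> X')"
    if "g' = 0 \<or> g < f \<and> covers k t (g' - 1) (alive_arcs s') (cur_sources s') X'" for g' X'
    using that rest by (intro st.covers_step) auto
  moreover have "(card (cur_sources s'))\<^sup>2 \<le> 24 * n * card ?S" if "g < f"
  proof -
    have "(card st.S')\<^sup>2 \<le> 24 * n * st.num_sources"
      using level sr.K_eq_card sr.card_Rc unfolding level_choice_def ns[symmetric]
      by (intro st.card_S'_squared) (auto simp: st.level_def)
    also have "\<dots> \<le> 24 * n * card ?S" using ns_le by (intro mult_le_mono2)
    finally show ?thesis using rest[OF that] by simp
  qed
  moreover have "fresh s'" if "g = f"
    using that s1 L' C' by (simp add: fresh_def new_L_def new_C_def)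
  moreover have "card st.X \<le> card ?S" using st.card_X ns_le by simp
  ultimately show "stage_result t g s s'"
    using chosen unfolding stage_result_def by (intro exI[of _ st.X]) blast
qed

definition stage_time :: nat where
  "stage_time = cost bfs_init + (Suc (cost bfs_step) * (2 * N + 1) + 1) +
     ((Suc (cost mark_step) * N + 1) + ((1 + (Suc 1 * N + 1)) +
     ((1 + (Suc (cost update_step) * N + 1)) + 2)))"

lemma stage_correct:
  assumes inv: "stage_inv t g s" and "t < n" "g \<le> f"
  shows "halts W stage_prog s stage_time (\<lambda>s'. stage_inv t (Suc g) s' \<and> stage_result t g s s')"
proof -
  define base where "base = (t * (f + 1) + g) * (n + 2)"
  have st: "static s" "s ''t'' 0 = t" "s ''g'' 0 = g" "s ''d'' 0 = base"
    and D: "\<And>x. s ''D'' x \<le> base" and K: "\<And>x. base < x \<Longrightarrow> s ''K'' x = 0"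
    and C: "\<And>x. s ''C'' x \<le> 1"
    using inv by (auto simp: stage_inv_def base_def)
  \<comment> \<open>The current stage has number \<open>t * (f + 1) + g\<close> among all
    \<open>n * (f + 1)\<close> stages, so even the next offset fits into a word.\<close>
  have "Suc t * (f + 1) \<le> n * (f + 1)" using \<open>t < n\<close> by (intro mult_le_mono1) auto
  then have "t * (f + 1) + g + 1 \<le> n * (f + 1)" using \<open>g \<le> f\<close> by simp
  then have "(t * (f + 1) + g + 1) * (n + 2) \<le> n * (f + 1) * (n + 2)" by (rule mult_le_mono1)
  moreover have "base + n + 2 = (t * (f + 1) + g + 1) * (n + 2)" by (simp add: base_def)
  ultimately have base: "base + n + 2 \<le> W" "f + 1 \<le> W" using W_ge by linarith+
  have next_base: "(t * (f + 1) + Suc g) * (n + 2) = base + n + 2" by (simp add: base_def)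
  show ?thesis
    unfolding stage_prog_def stage_time_def
  proof (rule halts_Seq[OF halts_unchanged[OF bfs_correct[OF st(1,2) \<open>t < n\<close> st(4) base(1) D K C]]])
    fix s1 assume s1: "search_of s t base s1 \<and> unchanged bfs s s1"
    then have search: "search_of s t base s1" by simp
    have same1: "s1 x = s x" if "x \<notin> {''D'', ''Q'', ''h'', ''e'', ''a'', ''c'', ''b'', ''u'', ''v'', ''P'', ''A'', ''K''}" for x
      using s1 that by (auto simp: unchanged_def bfs_def bfs_init_def bfs_step_def)
    show "halts W (Seq mark (Seq choose_level (Seq update
        (Seq (assign ''d'' (Plus (var ''d'') (Plus (var ''n'') (Const 2)))) (incr ''g''))))) s1
        ((Suc (cost mark_step) * N + 1) + ((1 + (Suc 1 * N + 1)) +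
          ((1 + (Suc (cost update_step) * N + 1)) + 2)))
        (\<lambda>s'. stage_inv t (Suc g) s' \<and> stage_result t g s s')"
    proof (rule halts_Seq[OF halts_unchanged[OF mark_correct[OF search]]])
      fix s2 assume s2: "search.marked_from (s ''C'') (s1 ''e'' 0) (s1 ''P'') (s1 ''Q'') 1 (s2 ''A'') \<and>
        unchanged mark s1 s2"
      have same2: "s2 x = s1 x" if "x \<notin> {''e'', ''u'', ''A''}" for x
        using s2 that by (auto simp: unchanged_def mark_def mark_step_def)
      have pre: "s2 ''c'' = s1 ''c''" "s2 ''K'' = s1 ''K''" "s2 ''d'' 0 = base"
        using same2 same1 st by auto
      show "halts W (Seq choose_level (Seq update
        (Seq (assign ''d'' (Plus (var ''d'') (Plus (var ''n'') (Const 2)))) (incr ''g'')))) s2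
        ((1 + (Suc 1 * N + 1)) + ((1 + (Suc (cost update_step) * N + 1)) + 2))
        (\<lambda>s'. stage_inv t (Suc g) s' \<and> stage_result t g s s')"
      proof (rule halts_Seq[OF halts_unchanged[OF choose_level_correct[OF search pre]]])
        fix s3 assume s3: "level_choice base (s3 ''j'' 0) (s1 ''c'' 0) (s1 ''K'') \<and> unchanged choose_level s2 s3"
        have same3: "s3 x = s2 x" if "x \<noteq> ''j''" for x
          using s3 that by (auto simp: unchanged_def choose_level_def)
        have st3: "static s3" "s3 ''d'' 0 = base"
          using st(1,4) by (simp_all add: static_def same1 same2 same3)
        show "halts W (Seq update
          (Seq (assign ''d'' (Plus (var ''d'') (Plus (var ''n'') (Const 2)))) (incr ''g''))) s3
          ((1 + (Suc (cost update_step) * N + 1)) + 2)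
          (\<lambda>s'. stage_inv t (Suc g) s' \<and> stage_result t g s s')"
        proof (rule halts_Seq[OF halts_unchanged[OF update_correct[OF st3]]])
          fix s4 assume s4: "updated base s3 N s4 \<and> unchanged update s3 s4"
          have same4: "s4 x = s3 x" if "x \<notin> {''i'', ''u'', ''v'', ''L'', ''C'', ''out''}" for x
            using s4 that by (auto simp: unchanged_def update_def update_step_def)
          have eqs: "s3 ''t'' 0 = t" "s3 ''g'' 0 = g" "s3 ''D'' = s1 ''D''" "s3 ''A'' = s2 ''A''"
            "s3 ''L'' = s ''L''" "s3 ''C'' = s ''C''" "s3 ''out'' = s ''out''"
            using st by (simp_all add: same1 same2 same3)
          have res: "stage_result t g s s4" "\<And>x. s4 ''C'' x \<le> 1"
            "\<And>x. x \<notin> U ` {..<N} \<Longrightarrow> s4 ''C'' x = 0"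
            "\<And>x. s1 ''D'' x \<le> base + n + 2" "\<And>x. base + n + 2 < x \<Longrightarrow> s1 ''K'' x = 0"
            using stage_result_if_updated[OF inv \<open>t < n\<close> \<open>g \<le> f\<close> st(4)
              search[unfolded search_of_def] conjunct1[OF s2] conjunct1[OF s3] st3(1) eqs(1,2) refl
              eqs(3,4,5,6,7) conjunct1[OF s4]] by blast+
          have st4: "static s4" "s4 ''t'' 0 = t" "s4 ''g'' 0 = g" "s4 ''d'' 0 = base"
            "s4 ''D'' = s1 ''D''" "s4 ''K'' = s1 ''K''" "s4 ''n'' 0 = n"
            using st by (simp_all add: static_def same1 same2 same3 same4)
          have result: "stage_result t g s s'" if "s' ''out'' = s4 ''out''" "s' ''L'' = s4 ''L''" "s' ''C'' = s4 ''C''" for s'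
            using res(1) that unfolding stage_result_def chosen_edges_def alive_arcs_def
              cur_sources_def fresh_def by simp
          let ?end = "Seq (assign ''d'' (Plus (var ''d'') (Plus (var ''n'') (Const 2)))) (incr ''g'')"
          have "wp W ?end (\<lambda>s'. stage_inv t (Suc g) s' \<and> stage_result t g s s') s4"
            using base st4 res(2-5) \<open>g \<le> f\<close> unfolding stage_inv_def next_base static_def
            by (simp add: result)
          from wp_halts[OF this]
          show "halts W ?end s4 2 (\<lambda>s'. stage_inv t (Suc g) s' \<and> stage_result t g s s')"
            by (simp add: numeral_2_eq_2)
        qed
      qed
    qed
  qed
qed

end

section \<open>All targets\<close>

context run
begin

text \<open>Induction on the budget \<open>f - g\<close>. The later stages cover the subgraph left
  by stage \<open>g\<close> with one fault less, and the sizes add up by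
  \<open>size_bound_Suc\<close>.\<close>

lemma stages_correct:
  assumes "stage_inv t g s" "t < n" "g \<le> f"
  shows "halts W (While (Less (var ''g'') (Plus (var ''f'') (Const 1))) stage_prog) s
     ((f - g + 1) * (1 + stage_time) + 1)
     (\<lambda>s'. stage_inv t (f + 1) s' \<and> fresh s' \<and>
        (\<exists>X. chosen_edges s' = chosen_edges s \<union> X \<and>
           covers k t (f - g) (alive_arcs s) (cur_sources s) X \<and>
           real (card X) \<le> size_bound n (f - g) (card (cur_sources s))))"
  using assms
proof (induction "f - g" arbitrary: g s)
  case 0
  then have g: "g = f" by simp
  have n: "n > 0" using \<open>t < n\<close> by simp
  have "halts W (While (Less (var ''g'') (Plus (var ''f'') (Const 1))) stage_prog) s
     (1 + stage_time + 1)
     (\<lambda>s'. stage_inv t (Suc g) s' \<and> stage_result t g s s')"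
  proof (rule halts_WhileTrue[OF _ stage_correct[OF 0(2-4)]])
    show "bval (Less (var ''g'') (Plus (var ''f'') (Const 1))) s"
      using 0(2) g by (simp add: stage_inv_def static_def)
    fix s1 assume s1: "stage_inv t (Suc g) s1 \<and> stage_result t g s s1"
    then have "\<not> bval (Less (var ''g'') (Plus (var ''f'') (Const 1))) s1"
      using g by (simp add: stage_inv_def static_def)
    then show "halts W (While (Less (var ''g'') (Plus (var ''f'') (Const 1))) stage_prog) s1 1
       (\<lambda>s'. stage_inv t (Suc g) s' \<and> stage_result t g s s')"
      using s1 by (intro halts_WhileFalse) auto
  qed
  then show ?case
  proof (rule halts_mono)
    fix s' assume s': "stage_inv t (Suc g) s' \<and> stage_result t g s s'"
    then obtain X where X: "chosen_edges s' = chosen_edges s \<union> X" "card X \<le> card (cur_sources s)"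
      "covers k t 0 (alive_arcs s) (cur_sources s) (X \<union> {})" "fresh s'"
      using g unfolding stage_result_def by blast
    then show "stage_inv t (f + 1) s' \<and> fresh s' \<and>
        (\<exists>X. chosen_edges s' = chosen_edges s \<union> X \<and>
           covers k t (f - g) (alive_arcs s) (cur_sources s) X \<and>
           real (card X) \<le> size_bound n (f - g) (card (cur_sources s)))"
      using s' g n by (intro conjI exI[of _ X]) (auto simp: size_bound_0)
  qed (simp add: g)
next
  case (Suc r)
  then have g: "g < f" "r = f - Suc g" "f - g = Suc (f - Suc g)" by auto
  have n: "n > 0" using \<open>t < n\<close> by simp
  let ?w = "While (Less (var ''g'') (Plus (var ''f'') (Const 1))) stage_prog"
  let ?Q = "\<lambda>s'. stage_inv t (f + 1) s' \<and> fresh s' \<and>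
        (\<exists>X. chosen_edges s' = chosen_edges s \<union> X \<and>
           covers k t (f - g) (alive_arcs s) (cur_sources s) X \<and>
           real (card X) \<le> size_bound n (f - g) (card (cur_sources s)))"
  have "halts W ?w s (1 + stage_time + ((f - Suc g + 1) * (1 + stage_time) + 1)) ?Q"
  proof (rule halts_WhileTrue[OF _ stage_correct[OF Suc.prems]])
    show "bval (Less (var ''g'') (Plus (var ''f'') (Const 1))) s"
      using Suc.prems(1) g by (simp add: stage_inv_def static_def)
    fix s1 assume s1: "stage_inv t (Suc g) s1 \<and> stage_result t g s s1"
    then obtain X where X: "chosen_edges s1 = chosen_edges s \<union> X" "card X \<le> card (cur_sources s)"
      "\<And>g' X'. covers k t (g' - 1) (alive_arcs s1) (cur_sources s1) X' \<Longrightarrow>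
        covers k t g' (alive_arcs s) (cur_sources s) (X \<union> X')"
      "(card (cur_sources s1))\<^sup>2 \<le> 24 * n * card (cur_sources s)"
      using g(1) unfolding stage_result_def by blast
    have "card (cur_sources s) \<le> n"
      using Suc.prems(1) by (intro card_sources_le) (simp add: stage_inv_def)
    note size = size_bound_Suc[OF this X(4) n, of "f - Suc g"]
    show "halts W ?w s1 ((f - Suc g + 1) * (1 + stage_time) + 1) ?Q"
    proof (rule halts_mono[OF Suc.hyps(1)[OF g(2) conjunct1[OF s1] \<open>t < n\<close>] order_refl])
      show "Suc g \<le> f" using g by simp
      fix s' assume s': "stage_inv t (f + 1) s' \<and> fresh s' \<and>
        (\<exists>X. chosen_edges s' = chosen_edges s1 \<union> X \<and>
           covers k t (f - Suc g) (alive_arcs s1) (cur_sources s1) X \<and>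
           real (card X) \<le> size_bound n (f - Suc g) (card (cur_sources s1)))"
      then obtain X' where X': "chosen_edges s' = chosen_edges s1 \<union> X'"
        "covers k t (f - Suc g) (alive_arcs s1) (cur_sources s1) X'"
        "real (card X') \<le> size_bound n (f - Suc g) (card (cur_sources s1))" by blast
      have "real (card (X \<union> X')) \<le> real (card X) + real (card X')"
        using card_Un_le[of X X'] by (simp flip: of_nat_add)
      also have "\<dots> \<le> real (card (cur_sources s)) + size_bound n (f - Suc g) (card (cur_sources s1))"
        using X(2) X'(3) by (intro add_mono) auto
      also have "\<dots> \<le> size_bound n (f - g) (card (cur_sources s))" using size g(3) by simp
      finally have "real (card (X \<union> X')) \<le> size_bound n (f - g) (card (cur_sources s))" .
      moreover have "covers k t (f - g) (alive_arcs s) (cur_sources s) (X \<union> X')"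
        using X'(2) by (intro X(3)) simp
      moreover have "chosen_edges s' = chosen_edges s \<union> (X \<union> X')"
        using X(1) X'(1) by blast
      ultimately show "?Q s'" using s' by blast
    qed
  qed
  moreover have time: "1 + stage_time + ((f - Suc g + 1) * (1 + stage_time) + 1) = (f - g + 1) * (1 + stage_time) + 1"
    using g(3) by simp
  ultimately show ?case unfolding time by blast
qed

section \<open>Iteration over the targets\<close>

definition all_arcs :: "(nat \<times> nat) set" where
  "all_arcs = {(U b, V b) | b. b < N}"

definition tail_sources :: "nat set" where
  "tail_sources = {x \<in> U ` {..<N}. Bs x \<noteq> 0}"

definition target_inv :: "nat \<Rightarrow> state \<Rightarrow> bool" where
  "target_inv t s \<longleftrightarrow> static s \<and> s ''t'' 0 = t \<and> s ''d'' 0 = t * (f + 1) * (n + 2) \<and>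
     (\<forall>x. s ''D'' x \<le> s ''d'' 0) \<and> (\<forall>x. s ''d'' 0 < x \<longrightarrow> s ''K'' x = 0) \<and> fresh s \<and>
     (\<exists>X. chosen_edges s = (\<Union>t' < t. X t') \<and>
        (\<forall>t' < t. covers k t' f all_arcs tail_sources (X t') \<and>
           real (card (X t')) \<le> size_bound n f (card tail_sources)))"

lemma fresh_arcs: "fresh s \<Longrightarrow> alive_arcs s = all_arcs"
  and fresh_sources: "fresh s \<Longrightarrow> cur_sources s = tail_sources"
  by (auto simp: fresh_def alive_arcs_def all_arcs_def cur_sources_def tail_sources_def)

definition target_time :: nat where
  "target_time = 1 + (((f + 1) * (1 + stage_time) + 1) + 1)"

lemma target_correct:
  assumes inv: "target_inv t s" and "t < n"
  shows "halts W target_prog s target_time (target_inv (Suc t))"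
  unfolding target_prog_def target_time_def
proof (rule halts_Seq)
  show "halts W (assign ''g'' (Const 0)) s 1
     (\<lambda>s1. stage_inv t 0 s1 \<and> unchanged (assign ''g'' (Const 0)) s s1)"
  proof -
    have "static s" "s ''t'' 0 = t" "s ''d'' 0 = t * (f + 1) * (n + 2)"
      "\<And>x. s ''D'' x \<le> s ''d'' 0" "\<And>x. s ''d'' 0 < x \<Longrightarrow> s ''K'' x = 0" "fresh s"
      using inv unfolding target_inv_def by blast+
    moreover from this have "\<And>x. s ''C'' x \<le> 1" "\<And>x. x \<notin> U ` {..<N} \<Longrightarrow> s ''C'' x = 0"
      using Bs_le by (simp_all add: fresh_def)
    ultimately have "wp W (assign ''g'' (Const 0))
        (\<lambda>s1. stage_inv t 0 s1 \<and> unchanged (assign ''g'' (Const 0)) s s1) s"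
      by (simp add: unchanged_def stage_inv_def static_def)
    from wp_halts[OF this] show ?thesis by simp
  qed
  fix s1 assume s1: "stage_inv t 0 s1 \<and> unchanged (assign ''g'' (Const 0)) s s1"
  have same1: "s1 x = s x" if "x \<noteq> ''g''" for x using s1 that by (auto simp: unchanged_def)
  let ?w = "While (Less (var ''g'') (Plus (var ''f'') (Const 1))) stage_prog"
  have "fresh s1" using inv by (simp add: target_inv_def fresh_def same1)
  note eqs = fresh_arcs[OF this] fresh_sources[OF this]
  have chosen1: "chosen_edges s1 = chosen_edges s" by (simp add: chosen_edges_def same1)
  have "halts W ?w s1 ((f + 1) * (1 + stage_time) + 1)
     (\<lambda>s'. stage_inv t (f + 1) s' \<and> fresh s' \<and> (\<exists>X. chosen_edges s' = chosen_edges s \<union> X \<and>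
         covers k t f all_arcs tail_sources X \<and>
           real (card X) \<le> size_bound n f (card tail_sources)))"
    using stages_correct[OF conjunct1[OF s1] \<open>t < n\<close>] by (simp add: eqs chosen1)
  then show "halts W (Seq ?w (incr ''t'')) s1 ((f + 1) * (1 + stage_time) + 1 + 1) (target_inv (Suc t))"
  proof (rule halts_Seq)
    fix s2 assume s2: "stage_inv t (f + 1) s2 \<and> fresh s2 \<and> (\<exists>X. chosen_edges s2 = chosen_edges s \<union> X \<and>
         covers k t f all_arcs tail_sources X \<and>
           real (card X) \<le> size_bound n f (card tail_sources))"
    then obtain Xt where Xt: "chosen_edges s2 = chosen_edges s \<union> Xt"
      "covers k t f all_arcs tail_sources Xt" "real (card Xt) \<le> size_bound n f (card tail_sources)"
      by blast
    obtain X where X: "chosen_edges s = (\<Union>t' < t. X t')"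
      "\<forall>t' < t. covers k t' f all_arcs tail_sources (X t') \<and>
           real (card (X t')) \<le> size_bound n f (card tail_sources)"
      using inv unfolding target_inv_def by blast
    have ex: "\<exists>X. chosen_edges s2 = (\<Union>t' < Suc t. X t') \<and>
        (\<forall>t' < Suc t. covers k t' f all_arcs tail_sources (X t') \<and>
           real (card (X t')) \<le> size_bound n f (card tail_sources))"
      using X Xt by (intro exI[of _ "X(t := Xt)"]) (auto simp: lessThan_Suc less_Suc_eq)
    have eq: "(t * (f + 1) + (f + 1)) * (n + 2) = Suc t * (f + 1) * (n + 2)" by simp
    have "Suc t \<le> W" using \<open>t < n\<close> W_ge by simp
    moreover have "static s2" "s2 ''t'' 0 = t" "s2 ''d'' 0 = Suc t * (f + 1) * (n + 2)"
      "\<And>x. s2 ''D'' x \<le> s2 ''d'' 0" "\<And>x. s2 ''d'' 0 < x \<Longrightarrow> s2 ''K'' x = 0" "fresh s2"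
      using s2 unfolding stage_inv_def eq by blast+
    ultimately have "wp W (incr ''t'') (target_inv (Suc t)) s2"
      using ex unfolding target_inv_def static_def fresh_def chosen_edges_def
      by simp
    from wp_halts[OF this] show "halts W (incr ''t'') s2 1 (target_inv (Suc t))" by simp
  qed
qed

lemma main_loop_correct:
  assumes "target_inv 0 s"
  shows "halts W main_loop s (Suc target_time * n + 1) (target_inv n)"
proof -
  let ?I = "\<lambda>s. s ''t'' 0 \<le> n \<and> target_inv (s ''t'' 0) s"
  have step: "halts W target_prog s target_time (\<lambda>s'. ?I s' \<and> n - s' ''t'' 0 < n - s ''t'' 0)"
    if "?I s" "bval (Less (var ''t'') (var ''n'')) s" for s
  proof -
    have "s ''t'' 0 < n" using that by (simp add: target_inv_def static_def)
    with that(1) show ?thesis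
    proof (intro halts_mono[OF target_correct order_refl])
      fix s' assume "target_inv (Suc (s ''t'' 0)) s'"
      moreover from this have "s' ''t'' 0 = Suc (s ''t'' 0)" by (simp add: target_inv_def)
      ultimately show "?I s' \<and> n - s' ''t'' 0 < n - s ''t'' 0"
        using \<open>s ''t'' 0 < n\<close> by simp
    qed auto
  qed
  have "halts W main_loop s (Suc target_time * n + 1)
     (\<lambda>s'. ?I s' \<and> unchanged target_prog s s' \<and> \<not> bval (Less (var ''t'') (var ''n'')) s')"
    unfolding main_loop_def
    using assms by (intro halts_While_unchanged[where \<mu> = "\<lambda>s. n - s ''t'' 0"] step)
      (auto simp: target_inv_def)
  then show ?thesis
  proof (rule halts_mono[OF _ order_refl])
    fix s' assume s': "?I s' \<and> unchanged target_prog s s' \<and> \<not> bval (Less (var ''t'') (var ''n'')) s'"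
    then have "static s'" by (simp add: target_inv_def)
    then have "s' ''t'' 0 = n" using s' by (simp add: static_def)
    then show "target_inv n s'" using s' by simp
  qed
qed

end

section \<open>Preparation\<close>

definition num_arcs :: "kind \<Rightarrow> nat \<Rightarrow> nat" where
  "num_arcs k m = (case k of Directed \<Rightarrow> m | Undirected \<Rightarrow> m + m)"

lemma num_arcs_le: "num_arcs k m \<le> m + m" and num_arcs_ge: "m \<le> num_arcs k m"
  by (cases k; simp add: num_arcs_def)+

text \<open>Reverse arcs are stored behind the given ones for both kinds of graph; in a directed
  graph the value of \<open>N\<close> cuts them off.\<close>

definition arc_arrays :: "nat \<Rightarrow> (nat \<times> nat) list \<Rightarrow> state \<Rightarrow> bool" where
  "arc_arrays i es s \<longleftrightarrow> (\<forall>b < i. s ''U'' b = fst (es ! b) \<and> s ''V'' b = snd (es ! b) \<and> s ''I'' b = b \<and>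
     s ''U'' (length es + b) = snd (es ! b) \<and> s ''V'' (length es + b) = fst (es ! b) \<and>
     s ''I'' (length es + b) = b)"

lemma arcs_loop_correct:
  assumes "s ''tail'' = array (map fst es)" "s ''head'' = array (map snd es)"
    "s ''m'' 0 = length es" "s ''i'' 0 = 0"
    and W: "\<And>p. p \<in> set es \<Longrightarrow> fst p \<le> W \<and> snd p \<le> W" "2 * length es \<le> W"
  shows "halts W (While (Less (var ''i'') (var ''m'')) arcs_step) s
     (Suc (cost arcs_step) * length es + 1) (arc_arrays (length es) es)"
proof -
  let ?I = "\<lambda>s'. s' ''i'' 0 \<le> length es \<and> arc_arrays (s' ''i'' 0) es s'"
  have "halts W (While (Less (var ''i'') (var ''m'')) arcs_step) s
     (Suc (cost arcs_step) * length es + 1)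
     (\<lambda>s'. ?I s' \<and> unchanged arcs_step s s' \<and> \<not> bval (Less (var ''i'') (var ''m'')) s')"
  proof (rule halts_While_unchanged[where \<mu> = "\<lambda>s'. length es - s' ''i'' 0"])
    fix s' assume s': "?I s'" "unchanged arcs_step s s'" "bval (Less (var ''i'') (var ''m'')) s'"
    have regs: "s' ''tail'' = array (map fst es)" "s' ''head'' = array (map snd es)"
      "s' ''m'' 0 = length es"
      using s'(2) assms by (auto simp: unchanged_def arcs_step_def)
    define i where "i = s' ''i'' 0"
    have i: "i < length es" using s'(3) regs by (simp add: i_def)
    then have "fst (es ! i) \<le> W" "snd (es ! i) \<le> W" using W(1) by auto
    then have "wp W arcs_step (\<lambda>s''. ?I s'' \<and> length es - s'' ''i'' 0 < length es - s' ''i'' 0) s'"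
      using i W(2) s'(1)
      by (auto simp: arcs_step_def regs i_def[symmetric] array_def arc_arrays_def less_Suc_eq)
    then show "halts W arcs_step s' (cost arcs_step)
       (\<lambda>s''. ?I s'' \<and> length es - s'' ''i'' 0 < length es - s' ''i'' 0)"
      by (rule wp_halts)
  qed (use assms in \<open>auto simp: arc_arrays_def\<close>)
  then show ?thesis
  proof (rule halts_mono[OF _ order_refl])
    fix s' assume s': "?I s' \<and> unchanged arcs_step s s' \<and> \<not> bval (Less (var ''i'') (var ''m'')) s'"
    then have "s' ''m'' 0 = length es" using assms(3) by (auto simp: unchanged_def arcs_step_def)
    then have "s' ''i'' 0 = length es" using s' by auto
    then show "arc_arrays (length es) es s'" using s' by auto
  qed
qed

lemma sources_loop_correct:
  assumes "s ''source'' = array ss" "s ''k'' 0 = length ss" "s ''i'' 0 = 0" "s ''B'' = (\<lambda>_. 0)"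
    and W: "\<And>x. x \<in> set ss \<Longrightarrow> x \<le> W" "length ss \<le> W" "1 \<le> W"
  shows "halts W (While (Less (var ''i'') (var ''k'')) sources_step) s
     (Suc (cost sources_step) * length ss + 1)
     (\<lambda>s'. s' ''B'' = (\<lambda>x. if x \<in> set ss then 1 else 0))"
proof -
  let ?I = "\<lambda>s'. s' ''i'' 0 \<le> length ss \<and>
     s' ''B'' = (\<lambda>x. if x \<in> set (take (s' ''i'' 0) ss) then 1 else 0)"
  have "halts W (While (Less (var ''i'') (var ''k'')) sources_step) s
     (Suc (cost sources_step) * length ss + 1)
     (\<lambda>s'. ?I s' \<and> unchanged sources_step s s' \<and> \<not> bval (Less (var ''i'') (var ''k'')) s')"
  proof (rule halts_While_unchanged[where \<mu> = "\<lambda>s'. length ss - s' ''i'' 0"])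
    fix s' assume s': "?I s'" "unchanged sources_step s s'" "bval (Less (var ''i'') (var ''k'')) s'"
    have regs: "s' ''source'' = array ss" "s' ''k'' 0 = length ss"
      using s'(2) assms by (auto simp: unchanged_def sources_step_def)
    define i where "i = s' ''i'' 0"
    have i: "i < length ss" using s'(3) regs by (simp add: i_def)
    then have "ss ! i \<le> W" using W(1) by auto
    then have "wp W sources_step (\<lambda>s''. ?I s'' \<and> length ss - s'' ''i'' 0 < length ss - s' ''i'' 0) s'"
      using i W(2,3) s'(1)
      by (auto simp: sources_step_def regs i_def[symmetric] array_def take_Suc_conv_app_nth fun_eq_iff)
    then show "halts W sources_step s' (cost sources_step)
       (\<lambda>s''. ?I s'' \<and> length ss - s'' ''i'' 0 < length ss - s' ''i'' 0)"
      by (rule wp_halts)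
  qed (use assms in auto)
  then show ?thesis
  proof (rule halts_mono[OF _ order_refl])
    fix s' assume s': "?I s' \<and> unchanged sources_step s s' \<and> \<not> bval (Less (var ''i'') (var ''k'')) s'"
    then have "s' ''k'' 0 = length ss" using assms(2) by (auto simp: unchanged_def sources_step_def)
    then have "s' ''i'' 0 = length ss" using s' by auto
    then show "s' ''B'' = (\<lambda>x. if x \<in> set ss then 1 else 0)" using s' by auto
  qed
qed

text \<open>\<open>p\<close> is one more than the largest index below \<open>i\<close> of an arc
  with head \<open>v\<close>, or 0 if there is none. With \<open>i = b\<close> and
  \<open>v = V b\<close> it points to the successor of arc \<open>b\<close>.\<close>

definition list_pointer :: "(nat \<Rightarrow> nat) \<Rightarrow> nat \<Rightarrow> nat \<Rightarrow> nat \<Rightarrow> bool" where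
  "list_pointer V i v p \<longleftrightarrow> p \<le> i \<and> (0 < p \<longrightarrow> V (p - 1) = v) \<and> (\<forall>b < i. V b = v \<longrightarrow> b < p)"

definition linked :: "nat \<Rightarrow> (nat \<Rightarrow> nat) \<Rightarrow> (nat \<Rightarrow> nat) \<Rightarrow> (nat \<Rightarrow> nat) \<Rightarrow> state \<Rightarrow> bool" where
  "linked i U V Bs s \<longleftrightarrow> (\<forall>v. list_pointer V i v (s ''Z'' v)) \<and>
     (\<forall>b < i. list_pointer V b (V b) (s ''X'' b)) \<and> (\<forall>b < i. s ''L'' b = 1) \<and>
     (\<forall>x. s ''C'' x = (if x \<in> U ` {..<i} then Bs x else 0))"

lemma links_loop_correct:
  assumes arrays: "s ''U'' = U" "s ''V'' = V" "s ''B'' = Bs" "s ''N'' 0 = N" "s ''i'' 0 = 0"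
    and zero: "s ''Z'' = (\<lambda>_. 0)" "s ''C'' = (\<lambda>_. 0)"
    and W: "\<And>b. b < N \<Longrightarrow> U b \<le> W \<and> V b \<le> W" "N + 1 \<le> W" "\<And>x. Bs x \<le> 1"
  shows "halts W (While (Less (var ''i'') (var ''N'')) links_step) s
     (Suc (cost links_step) * N + 1) (linked N U V Bs)"
proof -
  let ?I = "\<lambda>s'. s' ''i'' 0 \<le> N \<and> linked (s' ''i'' 0) U V Bs s'"
  have "halts W (While (Less (var ''i'') (var ''N'')) links_step) s
     (Suc (cost links_step) * N + 1)
     (\<lambda>s'. ?I s' \<and> unchanged links_step s s' \<and> \<not> bval (Less (var ''i'') (var ''N'')) s')"
  proof (rule halts_While_unchanged[where \<mu> = "\<lambda>s'. N - s' ''i'' 0"])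
    fix s' assume s': "?I s'" "unchanged links_step s s'" "bval (Less (var ''i'') (var ''N'')) s'"
    have regs: "s' ''U'' = U" "s' ''V'' = V" "s' ''B'' = Bs" "s' ''N'' 0 = N"
      using s'(2) assms by (auto simp: unchanged_def links_step_def)
    define i where "i = s' ''i'' 0"
    have i: "i < N" using s'(3) regs by (simp add: i_def)
    have Z: "list_pointer V i v (s' ''Z'' v)" for v using s'(1) by (simp add: linked_def i_def)
    have "s' ''Z'' (V i) \<le> W" using Z[of "V i"] i W(2) by (simp add: list_pointer_def)
    moreover have "Bs (U i) \<le> W" using W(2) W(3)[of "U i"] by simp
    moreover have "list_pointer V (Suc i) v (if v = V i then Suc i else s' ''Z'' v)" for v
      using Z[of v] by (auto simp: list_pointer_def less_Suc_eq)
    ultimately have "wp W links_step (\<lambda>s''. ?I s'' \<and> N - s'' ''i'' 0 < N - s' ''i'' 0) s'"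
      using i W(1)[OF i] W(2) s'(1) Z
      by (auto simp: links_step_def regs i_def[symmetric] linked_def less_Suc_eq lessThan_Suc)
    then show "halts W links_step s' (cost links_step)
       (\<lambda>s''. ?I s'' \<and> N - s'' ''i'' 0 < N - s' ''i'' 0)"
      by (rule wp_halts)
  qed (use assms in \<open>auto simp: linked_def list_pointer_def\<close>)
  then show ?thesis
  proof (rule halts_mono[OF _ order_refl])
    fix s' assume s': "?I s' \<and> unchanged links_step s s' \<and> \<not> bval (Less (var ''i'') (var ''N'')) s'"
    then have "s' ''N'' 0 = N" using assms(4) by (auto simp: unchanged_def links_step_def)
    then have "s' ''i'' 0 = N" using s' by auto
    then show "linked N U V Bs s'" using s' by auto
  qed
qed

definition prepared :: "kind \<Rightarrow> nat \<Rightarrow> (nat \<times> nat) list \<Rightarrow> nat list \<Rightarrow> nat \<Rightarrow> state \<Rightarrow> bool" where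
  "prepared k n es ss f s \<longleftrightarrow>
     arc_arrays (length es) es s \<and> s ''B'' = (\<lambda>x. if x \<in> set ss then 1 else 0) \<and>
     linked (num_arcs k (length es)) (s ''U'') (s ''V'') (s ''B'') s \<and>
     s ''N'' 0 = num_arcs k (length es) \<and> unchanged (preparation k) (input n es ss f) s"

definition preparation_time :: "kind \<Rightarrow> nat \<Rightarrow> nat \<Rightarrow> nat" where
  "preparation_time k m l = 1 + ((Suc (cost arcs_step) * m + 1) + (1 +
     ((Suc (cost sources_step) * l + 1) + (1 + (Suc (cost links_step) * num_arcs k m + 1)))))"

lemma arc_arrays_less:
  assumes "arc_arrays (length es) es s" "b < num_arcs k (length es)"
  shows "\<exists>i < length es. s ''I'' b = i \<and>
    ((s ''U'' b, s ''V'' b) = es ! i \<or> (k = Undirected \<and> (s ''V'' b, s ''U'' b) = es ! i))"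
proof (cases "b < length es")
  case True
  then show ?thesis using assms(1) by (intro exI[of _ b]) (simp add: arc_arrays_def)
next
  case False
  then obtain i where "b = length es + i" by (metis le_Suc_ex not_less)
  moreover from this have "k = Undirected" "i < length es"
    using assms(2) by (cases k; auto simp: num_arcs_def)+
  ultimately show ?thesis
    using assms(1) by (intro exI[of _ i]) (simp add: arc_arrays_def)
qed

lemma preparation_correct:
  assumes es: "\<And>p. p \<in> set es \<Longrightarrow> fst p < n \<and> snd p < n" and ss: "set ss \<subseteq> {..<n}"
    and W: "n \<le> W" "2 * length es + 1 \<le> W" "length ss \<le> W"
  shows "halts W (preparation k) (input n es ss f) (preparation_time k (length es) (length ss))
     (prepared k n es ss f)"
proof -
  let ?s0 = "input n es ss f" and ?m = "length es" and ?N = "num_arcs k (length es)"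
  have N: "?N + 1 \<le> W" using W(2) num_arcs_le[of k ?m] by simp
  let ?c1 = "assign ''N'' (case k of Directed \<Rightarrow> var ''m'' | Undirected \<Rightarrow> Plus (var ''m'') (var ''m''))"
  let ?c2 = "While (Less (var ''i'') (var ''m'')) arcs_step"
  let ?c4 = "While (Less (var ''i'') (var ''k'')) sources_step"
  let ?c6 = "While (Less (var ''i'') (var ''N'')) links_step"
  have 1: "halts W ?c1 ?s0 1 (\<lambda>s. s ''N'' 0 = ?N \<and> unchanged ?c1 ?s0 s)"
    using wp_halts[of W ?c1 "\<lambda>s. s ''N'' 0 = ?N \<and> unchanged ?c1 ?s0 s" ?s0] N
    by (cases k) (simp_all add: input_def array_def num_arcs_def unchanged_def)
  have reset: "halts W (assign ''i'' (Const 0)) s 1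
      (\<lambda>s'. s' ''i'' 0 = 0 \<and> unchanged (assign ''i'' (Const 0)) s s')" for s
    using wp_halts[of W "assign ''i'' (Const 0)"
      "\<lambda>s'. s' ''i'' 0 = 0 \<and> unchanged (assign ''i'' (Const 0)) s s'" s]
    by (simp add: unchanged_def)
  have "halts W (preparation k) ?s0 (preparation_time k (length es) (length ss))
     (\<lambda>s. arc_arrays (length es) es s \<and> s ''B'' = (\<lambda>x. if x \<in> set ss then 1 else 0) \<and>
     linked ?N (s ''U'') (s ''V'') (s ''B'') s \<and> s ''N'' 0 = ?N)" (is "halts _ _ _ _ ?Q")
    unfolding preparation_def preparation_time_def
  proof (rule halts_Seq[OF 1])
    fix s1 assume "s1 ''N'' 0 = ?N \<and> unchanged ?c1 ?s0 s1"
    then have s1: "s1 ''N'' 0 = ?N" "\<And>x. x \<noteq> ''N'' \<Longrightarrow> s1 x = ?s0 x" by (auto simp: unchanged_def)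
    have "halts W ?c2 s1 (Suc (cost arcs_step) * ?m + 1) (arc_arrays ?m es)"
      using es W by (intro arcs_loop_correct) (fastforce simp: s1 input_def array_def)+
    then show "halts W (Seq ?c2 (Seq (assign ''i'' (Const 0)) (Seq ?c4 (Seq (assign ''i'' (Const 0)) ?c6)))) s1
       ((Suc (cost arcs_step) * ?m + 1) + (1 + ((Suc (cost sources_step) * length ss + 1) +
         (1 + (Suc (cost links_step) * ?N + 1))))) ?Q"
    proof (rule halts_Seq[OF halts_unchanged])
      fix s2 assume "arc_arrays ?m es s2 \<and> unchanged ?c2 s1 s2"
      then have s2: "arc_arrays ?m es s2" "\<And>x. x \<notin> {''i'', ''U'', ''V'', ''I''} \<Longrightarrow> s2 x = s1 x"
        by (auto simp: unchanged_def arcs_step_def)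
      show "halts W (Seq (assign ''i'' (Const 0)) (Seq ?c4 (Seq (assign ''i'' (Const 0)) ?c6))) s2
        (1 + ((Suc (cost sources_step) * length ss + 1) +
         (1 + (Suc (cost links_step) * ?N + 1)))) ?Q"
      proof (rule halts_Seq[OF reset])
        fix s3 assume "s3 ''i'' 0 = 0 \<and> unchanged (assign ''i'' (Const 0)) s2 s3"
        then have s3: "s3 ''i'' 0 = 0" "\<And>x. x \<noteq> ''i'' \<Longrightarrow> s3 x = s2 x" by (auto simp: unchanged_def)
        have "halts W ?c4 s3 (Suc (cost sources_step) * length ss + 1)
           (\<lambda>s'. s' ''B'' = (\<lambda>x. if x \<in> set ss then 1 else 0))"
        proof (rule sources_loop_correct)
          show "s3 ''source'' = array ss" "s3 ''k'' 0 = length ss" "s3 ''B'' = (\<lambda>_. 0)"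
            by (auto simp: s1 s2 s3 input_def array_def)
          show "x \<le> W" if "x \<in> set ss" for x using that ss W(1) by auto
        qed (use s3 W in auto)
        then show "halts W (Seq ?c4 (Seq (assign ''i'' (Const 0)) ?c6)) s3
          ((Suc (cost sources_step) * length ss + 1) + (1 + (Suc (cost links_step) * ?N + 1))) ?Q"
        proof (rule halts_Seq[OF halts_unchanged])
          fix s4 assume "s4 ''B'' = (\<lambda>x. if x \<in> set ss then 1 else 0) \<and> unchanged ?c4 s3 s4"
          then have s4: "s4 ''B'' = (\<lambda>x. if x \<in> set ss then 1 else 0)"
            "\<And>x. x \<notin> {''i'', ''B''} \<Longrightarrow> s4 x = s3 x"
            by (auto simp: unchanged_def sources_step_def)
          show "halts W (Seq (assign ''i'' (Const 0)) ?c6) s4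
            (1 + (Suc (cost links_step) * ?N + 1)) ?Q"
          proof (rule halts_Seq[OF reset])
            fix s5 assume "s5 ''i'' 0 = 0 \<and> unchanged (assign ''i'' (Const 0)) s4 s5"
            then have s5: "s5 ''i'' 0 = 0" "\<And>x. x \<noteq> ''i'' \<Longrightarrow> s5 x = s4 x" by (auto simp: unchanged_def)
            have arr: "arc_arrays ?m es s5" using s2(1) by (simp add: arc_arrays_def s3 s4 s5)
            have "halts W ?c6 s5 (Suc (cost links_step) * ?N + 1)
              (linked ?N (s5 ''U'') (s5 ''V'') (s5 ''B''))"
            proof (rule links_loop_correct[OF refl refl refl])
              show "s5 ''N'' 0 = ?N" "s5 ''Z'' = (\<lambda>_. 0)" "s5 ''C'' = (\<lambda>_. 0)"
                by (simp_all add: s1 s2 s3 s4 s5 input_def)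
              show "s5 ''U'' b \<le> W \<and> s5 ''V'' b \<le> W" if "b < ?N" for b
              proof -
                obtain i where "i < ?m" "(s5 ''U'' b, s5 ''V'' b) = es ! i \<or> (s5 ''V'' b, s5 ''U'' b) = es ! i"
                  using arc_arrays_less[OF arr \<open>b < ?N\<close>] by blast
                then show ?thesis using es[of "es ! i"] W(1) by (auto dest!: sym[of _ "es ! i"])
              qed
              show "s5 ''B'' x \<le> 1" for x by (simp add: s4 s5)
            qed (use s5 N in auto)
            then show "halts W ?c6 s5 (Suc (cost links_step) * ?N + 1) ?Q"
            proof (rule halts_mono[OF halts_unchanged order_refl])
              fix s6 assume s6: "linked ?N (s5 ''U'') (s5 ''V'') (s5 ''B'') s6 \<and> unchanged ?c6 s5 s6"
              then have same: "s6 x = s5 x" if "x \<notin> {''v'', ''u'', ''X'', ''Z'', ''L'', ''C'', ''i''}" for x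
                using that by (auto simp: unchanged_def links_step_def)
              show "?Q s6"
                using s6 arr by (simp add: same arc_arrays_def s1 s2 s3 s4 s5)
            qed
          qed
        qed
      qed
    qed
  qed
  then show ?thesis
    by (rule halts_mono[OF halts_unchanged]) (auto simp: prepared_def)
qed

lemma run_prepared:
  assumes G: "simple_graph k {..<n} E" and les: "lists_edges k es E"
    and W: "n * (f + 1) * (n + 2) + n + f + num_arcs k (length es) + length es + 3 \<le> W"
    and p: "prepared k n es ss f s"
  shows "run n (num_arcs k (length es)) (s ''U'') (s ''V'') (s ''X'') (s ''Z'') k es
    (s ''I'') (s ''B'') f W"
proof
  let ?N = "num_arcs k (length es)"
  have arr: "arc_arrays (length es) es s" and link: "linked ?N (s ''U'') (s ''V'') (s ''B'') s"
    using p by (auto simp: prepared_def)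
  have arc: "(s ''U'' b, s ''V'' b) \<in> \<Union>E \<and> s ''I'' b < length es \<and>
      edge_of k (es ! s ''I'' b) = edge_of k (s ''U'' b, s ''V'' b)" if "b < ?N" for b
  proof -
    obtain i where i: "i < length es" "s ''I'' b = i"
      "(s ''U'' b, s ''V'' b) = es ! i \<or> (k = Undirected \<and> (s ''V'' b, s ''U'' b) = es ! i)"
      using arc_arrays_less[OF arr \<open>b < ?N\<close>] by blast
    have "edge_of k (es ! i) = edge_of k (s ''U'' b, s ''V'' b)"
      using i(3) by (auto dest!: sym[of _ "es ! i"])
    moreover have "edge_of k (es ! i) \<in> E" using les i(1) by (auto simp: lists_edges_def)
    ultimately show ?thesis using i self_in_edge_of by (metis UnionI)
  qed
  have Z: "list_pointer (s ''V'') ?N v (s ''Z'' v)" for v using link by (simp add: linked_def)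
  have X: "list_pointer (s ''V'') b (s ''V'' b) (s ''X'' b)" if "b < ?N" for b
    using link that by (simp add: linked_def)
  show "s ''U'' b < n" "s ''V'' b < n" "s ''U'' b \<noteq> s ''V'' b" if "b < ?N" for b
    using simple_graph_arc[OF G conjunct1[OF arc[OF that]]] by auto
  show "s ''Z'' v \<le> ?N" "0 < s ''Z'' v \<Longrightarrow> s ''V'' (s ''Z'' v - 1) = v" for v
    using Z[of v] by (auto simp: list_pointer_def)
  show "b < s ''Z'' (s ''V'' b)" if "b < ?N" for b
    using Z[of "s ''V'' b"] that by (auto simp: list_pointer_def)
  show "s ''X'' b \<le> b" "0 < s ''X'' b \<Longrightarrow> s ''V'' (s ''X'' b - 1) = s ''V'' b" if "b < ?N" for b
    using X[OF that] by (auto simp: list_pointer_def)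
  show "b' < s ''X'' b" if "b < ?N" "b' < b" "s ''V'' b' = s ''V'' b" for b b'
    using X[OF that(1)] that(2,3) by (auto simp: list_pointer_def)
  show "s ''I'' b < length es" "edge_of k (es ! s ''I'' b) = edge_of k (s ''U'' b, s ''V'' b)" if "b < ?N" for b
    using arc[OF that] by auto
  show "s ''B'' x \<le> 1" for x using p by (simp add: prepared_def)
qed (fact W)

lemma all_arcs_prepared:
  assumes les: "lists_edges k es E" and p: "prepared k n es ss f s"
  shows "{(s ''U'' b, s ''V'' b) | b. b < num_arcs k (length es)} = \<Union>E"
proof (intro set_eqI iffI)
  have arr: "arc_arrays (length es) es s" using p by (auto simp: prepared_def)
  have E: "E = edge_of k ` set es" using les by (simp add: lists_edges_def)
  {
    fix q assume "q \<in> {(s ''U'' b, s ''V'' b) | b. b < num_arcs k (length es)}"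
    then obtain b where b: "b < num_arcs k (length es)" "q = (s ''U'' b, s ''V'' b)" by blast
    obtain i where i: "i < length es"
      "(s ''U'' b, s ''V'' b) = es ! i \<or> (k = Undirected \<and> (s ''V'' b, s ''U'' b) = es ! i)"
      using arc_arrays_less[OF arr b(1)] by blast
    then have "q \<in> edge_of k (es ! i)"
      using b(2) self_in_edge_of[of "es ! i" k] by (auto dest!: sym[of _ "es ! i"])
    then show "q \<in> \<Union>E" using i(1) unfolding E by auto
  next
    fix q assume "q \<in> \<Union>E"
    then obtain i where i: "i < length es" "q \<in> edge_of k (es ! i)"
      unfolding E by (auto simp: in_set_conv_nth)
    obtain x y where xy: "es ! i = (x, y)" by fastforce
    show "q \<in> {(s ''U'' b, s ''V'' b) | b. b < num_arcs k (length es)}"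
    proof (cases "q = (x, y)")
      case True
      then have "q = (s ''U'' i, s ''V'' i)" using arr i(1) xy by (simp add: arc_arrays_def)
      moreover have "i < num_arcs k (length es)" using i(1) num_arcs_ge[of "length es" k] by simp
      ultimately show ?thesis by blast
    next
      case False
      then have k: "k = Undirected" "q = (y, x)" using i(2) xy by (cases k; auto)+
      then have "q = (s ''U'' (length es + i), s ''V'' (length es + i))"
        using arr i(1) xy by (simp add: arc_arrays_def)
      moreover have "length es + i < num_arcs k (length es)" using i(1) k by (simp add: num_arcs_def)
      ultimately show ?thesis by blast
    qed
  }
qed

section \<open>Correctness and running time\<close>

text \<open>A source other than \<open>t\<close> with a walk to \<open>t\<close> has an outgoing
  arc. So it does no harm that the program, which fills \<open>C\<close> along the arcs, ignores
  sources that are not tails.\<close>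

lemma covers_mono:
  assumes "covers k t g R S X" "X \<subseteq> X'" "\<And>x y. x \<in> S' \<Longrightarrow> (x, y) \<in> R \<Longrightarrow> x \<in> S"
  shows "covers k t g R S' X'"
  unfolding covers_def
proof (intro allI impI ballI)
  fix F s l
  assume F: "card (F \<inter> edge_of k ` R) \<le> g" and s: "s \<in> S' - {t}"
    and w: "(s, t) \<in> avoiding k F R ^^ l"
  obtain l' where "l = Suc l'" using w s by (cases l) auto
  then obtain y where "(s, y) \<in> avoiding k F R" using w by (meson relpow_Suc_D2)
  then have "s \<in> S - {t}" using s assms(3) by (auto simp: avoiding_def)
  then show "\<exists>l' u. l' < l \<and> (s, u) \<in> avoiding k F R ^^ l' \<and> (u, t) \<in> avoiding k F R \<and>
             edge_of k (u, t) \<in> X'"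
    using assms(1,2) F w unfolding covers_def by blast
qed

text \<open>For \<open>x = n + f + 2\<close> the product, the terms in \<open>m\<close> and the
  remaining terms are at most \<open>x ^ 3\<close>, \<open>2 * x ^ 3\<close> and
  \<open>x ^ 3\<close>. The exponent 5 comes from \<open>4 \<le> x ^ 2\<close>.\<close>

lemma W_large:
  fixes n f m :: nat
  assumes "m \<le> n * n"
  shows "n * (f + 1) * (n + 2) + n + f + 2 * m + m + 3 \<le> (n + f + 2) ^ 5"
proof -
  define x where "x = n + f + 2"
  have x: "2 \<le> x" by (simp add: x_def)
  have "n * (f + 1) * (n + 2) \<le> x * x * x"
    by (intro mult_mono) (auto simp: x_def)
  moreover have "3 * m \<le> 3 * (x * x)"
    using assms mult_mono[of n x n x] by (simp add: x_def)
  moreover have "3 * (x * x) \<le> 2 * (x * x * x)" "x + 1 \<le> x * x * x" "4 * (x * x * x) \<le> x ^ 5"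
  proof -
    have "2 * (x * x) \<le> x * (x * x)" using x by (rule mult_le_mono1)
    then show "3 * (x * x) \<le> 2 * (x * x * x)" unfolding mult.assoc by linarith
    have "2 * x \<le> x * x" using x by (rule mult_le_mono1)
    moreover have "x * x \<le> x * (x * x)" using x mult_le_mono1[of 1 x "x * x"] by simp
    moreover have "x + 1 \<le> 2 * x" using x by simp
    ultimately show "x + 1 \<le> x * x * x" unfolding mult.assoc by linarith
    have "2 * 2 \<le> x * x" using x by (intro mult_mono) auto
    then have "4 * (x * x * x) \<le> (x * x) * (x * x * x)" by (intro mult_le_mono1) simp
    then show "4 * (x * x * x) \<le> x ^ 5" by (simp add: eval_nat_numeral mult.assoc)
  qed
  ultimately show ?thesis unfolding x_def[symmetric] using x_def by linarith
qed

section \<open>Constants of the running time\<close>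

definition stage_const :: nat where
  "stage_const = cost bfs_init + Suc (cost bfs_step) * 5 + Suc (cost mark_step) * 2 +
     Suc (cost update_step) * 2 + 14"

definition total_const :: nat where
  "total_const = Suc (cost arcs_step) + Suc (cost sources_step) + 2 * Suc (cost links_step) +
     2 * stage_const + 20"

context run
begin

lemma stage_time_le:
  assumes "1 \<le> m" "N \<le> 2 * m"
  shows "stage_time \<le> stage_const * m"
proof -
  define a b c d where abcd: "a = cost bfs_init" "b = Suc (cost bfs_step)"
    "c = Suc (cost mark_step)" "d = Suc (cost update_step)"
  have "b * (2 * N + 1) \<le> b * (5 * m)" "c * N \<le> c * (2 * m)" "d * N \<le> d * (2 * m)" "a * 1 \<le> a * m"
    using assms by (intro mult_le_mono2; simp)+
  moreover have "stage_time = a + b * (2 * N + 1) + c * N + 2 * N + d * N + 8"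
    by (simp add: stage_time_def abcd)
  moreover have "stage_const * m = a * m + b * (5 * m) + c * (2 * m) + d * (2 * m) + 14 * m"
    by (simp only: stage_const_def abcd[symmetric] add_mult_distrib mult.assoc)
  moreover have "2 * N + 8 \<le> 14 * m" using assms by simp
  ultimately show ?thesis by linarith
qed

text \<open>No factor of \<open>f * n * m\<close> is 0, so \<open>m\<close>, \<open>n\<close>,
  \<open>f * n\<close> and constants are all absorbed; doubling \<open>stage_const\<close> pays for
  \<open>f + 1 \<le> 2 * f\<close>.\<close>

lemma total_time_le:
  assumes "1 \<le> m" "1 \<le> f" "1 \<le> n" "l \<le> n" "N \<le> 2 * m" "N = num_arcs k m"
  shows "1 + (preparation_time k m l + (Suc target_time * n + 1)) \<le> total_const * (f * n * m)"
proof -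
  define M where "M = f * n * m"
  have fnm: "m \<le> M" "n \<le> M" "f * n \<le> M" "1 \<le> M"
  proof -
    have "1 * m \<le> (f * n) * m" "(f * n) * 1 \<le> (f * n) * m" "1 * n \<le> f * n"
      using assms by (auto intro!: mult_le_mono)
    then show "m \<le> M" "f * n \<le> M" "n \<le> M" "1 \<le> M" using assms by (auto simp: M_def)
  qed
  have "preparation_time k m l \<le> 6 + Suc (cost arcs_step) * M + Suc (cost sources_step) * M +
      2 * Suc (cost links_step) * M"
  proof -
    have "Suc (cost arcs_step) * m \<le> Suc (cost arcs_step) * M"
      "Suc (cost sources_step) * l \<le> Suc (cost sources_step) * M"
      "Suc (cost links_step) * N \<le> Suc (cost links_step) * (2 * M)"
      using fnm assms by (intro mult_le_mono2; simp)+
    then show ?thesis unfolding preparation_time_def assms(6)[symmetric] by (simp add: mult.left_commute)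
  qed
  moreover have "Suc target_time * n \<le> 2 * stage_const * M + 6 * M"
  proof -
    have "Suc target_time = (f + 1) * stage_time + f + 5" by (simp add: target_time_def)
    also have "\<dots> \<le> (f + 1) * (stage_const * m) + f + 5"
      using stage_time_le[OF assms(1,5)] by (intro add_right_mono mult_le_mono2)
    also have "\<dots> \<le> (2 * f) * (stage_const * m) + f + 5 * f"
      using assms(2) by (intro add_mono mult_le_mono1) auto
    finally have "Suc target_time * n \<le> ((2 * f) * (stage_const * m) + f + 5 * f) * n"
      by (rule mult_le_mono1)
    also have "\<dots> = 2 * stage_const * M + 6 * (f * n)" by (simp add: M_def algebra_simps)
    finally show ?thesis using fnm(3) by linarith
  qed
  ultimately have "1 + (preparation_time k m l + (Suc target_time * n + 1)) \<le>
      8 + Suc (cost arcs_step) * M + Suc (cost sources_step) * M + 2 * Suc (cost links_step) * M +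
      (2 * stage_const * M + 6 * M)"
    by linarith
  also have "\<dots> \<le> total_const * M"
    using fnm(4) by (simp add: total_const_def algebra_simps)
  finally show ?thesis unfolding M_def .
qed

end

lemma length_lists_edges:
  assumes "simple_graph k {..<n} E" "lists_edges k es E"
  shows "length es = card E" "length es \<le> n * n" "\<And>p. p \<in> set es \<Longrightarrow> fst p < n \<and> snd p < n"
proof -
  show "length es = card E"
    using assms(2) by (metis distinct_card length_map lists_edges_def)
  show less: "fst p < n \<and> snd p < n" if "p \<in> set es" for p
  proof -
    have "edge_of k p \<in> E" using assms(2) that by (auto simp: lists_edges_def)
    then have "(fst p, snd p) \<in> \<Union>E" using self_in_edge_of[of p k] by auto
    then show ?thesis using simple_graph_arc[OF assms(1)] by blast
  qed
  have "distinct es" using assms(2) by (auto simp: lists_edges_def distinct_map)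
  then have "length es = card (set es)" by (simp add: distinct_card)
  also have "\<dots> \<le> card ({..<n} \<times> {..<n})"
    using less by (intro card_mono) force+
  finally show "length es \<le> n * n" by (simp add: card_cartesian_product)
qed

lemma preserver_prog_correct:
  assumes G: "simple_graph k {..<n} E" and f: "f \<ge> 1" and S: "set ss \<subseteq> {..<n}" "distinct ss"
    and les: "lists_edges k es E" and m: "0 < length es"
  shows "halts ((n + f + 2) ^ 5) (preserver_prog k) (input n es ss f) (total_const * (f * n * card E))
    (\<lambda>s. ft_sourcewise_preserver f {..<n} E (set ss) (output_edges k es s) \<and>
       real (card (output_edges k es s)) \<le> real n * size_bound n f (card (set ss)))"
proof -
  define W where "W = (n + f + 2) ^ 5"
  let ?m = "length es" and ?N = "num_arcs k (length es)" and ?s0 = "input n es ss f"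
  note es = length_lists_edges[OF G les]
  have N: "?N \<le> 2 * ?m" using num_arcs_le[of k ?m] by simp
  have W: "n * (f + 1) * (n + 2) + n + f + 2 * ?m + ?m + 3 \<le> W"
    using W_large[OF es(2)] by (simp add: W_def)
  have ss: "length ss \<le> n"
    using S card_mono[of "{..<n}" "set ss"] by (simp add: distinct_card)
  have n: "1 \<le> n" using es(3)[of "es ! 0"] m by fastforce
  have prep: "halts W (preparation k) ?s0 (preparation_time k ?m (length ss)) (prepared k n es ss f)"
    using W ss by (intro preparation_correct es(3) S) auto
  have halt: "halts W (preserver_prog k) ?s0 (total_const * (f * n * ?m))
    (\<lambda>s. ft_sourcewise_preserver f {..<n} E (set ss) (output_edges k es s) \<and>
       real (card (output_edges k es s)) \<le> real n * size_bound n f (card (set ss)))"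
    (is "halts _ _ _ _ ?Q")
  proof -
    \<comment> \<open>The state after the preparation has to be fixed first, because its arrays are
      the parameters of the locale \<open>run\<close>.\<close>
    obtain T1 s1 where s1: "exec W (preparation k) ?s0 T1 s1" "T1 \<le> preparation_time k ?m (length ss)"
      "prepared k n es ss f s1"
      using prep unfolding halts_def by blast
    interpret run n ?N "s1 ''U''" "s1 ''V''" "s1 ''X''" "s1 ''Z''" k es "s1 ''I''" "s1 ''B''" f W
      using W N by (intro run_prepared[OF G les _ s1(3)]) simp
    have arcs: "all_arcs = \<Union>E"
      using all_arcs_prepared[OF les s1(3)] by (simp add: all_arcs_def)
    have B: "s1 ''B'' = (\<lambda>x. if x \<in> set ss then 1 else 0)"
      and link: "linked ?N (s1 ''U'') (s1 ''V'') (s1 ''B'') s1" and N1: "s1 ''N'' 0 = ?N"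
      and same: "unchanged (preparation k) ?s0 s1"
      using s1(3) by (auto simp: prepared_def)
    have same: "s1 x = ?s0 x" if "x \<notin> {''N'', ''i'', ''U'', ''V'', ''I'', ''B'', ''v'', ''u'', ''X'', ''Z'', ''L'', ''C''}" for x
      using same that
      by (auto simp: unchanged_def preparation_def arcs_step_def sources_step_def links_step_def)
    have "static s1" using N1 by (simp add: static_def same input_def array_def)
    moreover have "fresh s1" using link by (simp add: fresh_def linked_def)
    ultimately have "target_inv 0 s1"
      by (simp add: target_inv_def same input_def chosen_edges_def)
    then have "halts W main_loop s1 (Suc target_time * n + 1) (target_inv n)"
      by (rule main_loop_correct)
    then obtain T2 s2 where s2: "exec W main_loop s1 T2 s2" "T2 \<le> Suc target_time * n + 1" "target_inv n s2"
      unfolding halts_def by blast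
    have "bval (positive (var ''m'')) ?s0" using m by (simp add: input_def array_def)
    then have "exec W (preserver_prog k) ?s0 (1 + (T1 + T2)) s2"
      unfolding preserver_prog_def using s1(1) s2(1) by (intro exec.CondTrue exec.Seq)
    moreover have "1 + (T1 + T2) \<le> total_const * (f * n * ?m)"
      using total_time_le[of ?m "length ss"] s1(2) s2(2) m f n ss N by simp
    moreover have "?Q s2"
    proof -
      have out: "output_edges k es s2 = chosen_edges s2"
        by (simp add: output_edges_def chosen_edges_def)
      obtain X where X: "chosen_edges s2 = (\<Union>t < n. X t)"
        "\<forall>t < n. covers k t f all_arcs tail_sources (X t) \<and>
          real (card (X t)) \<le> size_bound n f (card tail_sources)"
        using s2(3) unfolding target_inv_def by blast
      have ts: "tail_sources \<subseteq> set ss" unfolding tail_sources_def by (auto simp: B split: if_splits)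
      have ts': "x \<in> tail_sources" if "x \<in> set ss" "(x, y) \<in> \<Union>E" for x y
      proof -
        have "(x, y) \<in> all_arcs" using that(2) arcs by simp
        then have "x \<in> s1 ''U'' ` {..<?N}" by (auto simp: all_arcs_def)
        then show ?thesis using that(1) unfolding tail_sources_def by (simp add: B)
      qed
      have "covers k t f (\<Union>E) (set ss) (chosen_edges s2)" if "t \<in> {..<n}" for t
      proof (rule covers_mono)
        show "covers k t f (\<Union>E) tail_sources (X t)" using X(2) that unfolding arcs by simp
        show "X t \<subseteq> chosen_edges s2" using that unfolding X(1) by blast
      qed (fact ts')
      moreover have "chosen_edges s2 \<subseteq> E"
        using les by (auto simp: chosen_edges_def lists_edges_def)
      ultimately have "ft_sourcewise_preserver f {..<n} E (set ss) (chosen_edges s2)"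
        using S(1) by (intro ft_sourcewise_preserver_if_covers[OF G]) auto
      moreover have "real (card (chosen_edges s2)) \<le> real n * size_bound n f (card (set ss))"
      proof -
        have "card (chosen_edges s2) \<le> (\<Sum>t < n. card (X t))"
          unfolding X(1) by (rule card_UN_le) simp
        then have "real (card (chosen_edges s2)) \<le> (\<Sum>t < n. real (card (X t)))"
          by (simp flip: of_nat_sum)
        also have "\<dots> \<le> (\<Sum>t < n. size_bound n f (card (set ss)))"
          using X(2) by (intro sum_mono order_trans[OF _ size_bound_mono[OF card_mono[OF _ ts]]]) auto
        finally show ?thesis by simp
      qed
      ultimately show ?thesis by (simp add: out)
    qed
    ultimately show ?thesis unfolding halts_def by blast
  qed
  then show ?thesis by (simp add: W_def es(1))
qed

theorem theorem1:
  fixes k :: kind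
  shows "\<exists>(prog :: com) (b :: nat) (c :: nat) (C :: real) (p :: nat).
    \<forall>(n :: nat) (E :: nat edge set) (f :: nat) (S :: nat set) (es :: (nat \<times> nat) list) (ss :: nat list).
      simple_graph k {..<n} E \<longrightarrow> f \<ge> 1 \<longrightarrow> S \<subseteq> {..<n} \<longrightarrow>
      lists_edges k es E \<longrightarrow> distinct ss \<longrightarrow> set ss = S \<longrightarrow>
      (\<exists>T s H. exec ((n + f + 2) ^ b) prog (input n es ss f) T s \<and>
         T \<le> c * (f * n * card E + 1) \<and>
         H = output_edges k es s \<and>
         ft_sourcewise_preserver f {..<n} E S H \<and>
         real (card H) \<le>
           C * (real f * real (card S) powr (1 / 2 ^ f) * real n powr (2 - 1 / 2 ^ f)) * ln (real n + 2) ^ p)"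
proof (rule exI[of _ "preserver_prog k"], rule exI[of _ 5], rule exI[of _ total_const],
    rule exI[of _ 48], rule exI[of _ 0], intro allI impI)
  fix n E f S es ss
  assume G: "simple_graph k {..<n} E" and f: "(f :: nat) \<ge> 1" and S: "S \<subseteq> {..<n}"
    and les: "lists_edges k es E" and ss: "distinct ss" "set ss = S"
  let ?bound = "48 * (real f * real (card S) powr (1 / 2 ^ f) * real n powr (2 - 1 / 2 ^ f)) * ln (real n + 2) ^ 0"
  show "\<exists>T s H. exec ((n + f + 2) ^ 5) (preserver_prog k) (input n es ss f) T s \<and>
         T \<le> total_const * (f * n * card E + 1) \<and> H = output_edges k es s \<and>
         ft_sourcewise_preserver f {..<n} E S H \<and> real (card H) \<le> ?bound"
  proof (cases "es = []")
    case True
    \<comment> \<open>For an edgeless graph the time bound is a constant, and the empty output is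
      the whole edge set.\<close>
    then have "E = {}" using les by (simp add: lists_edges_def)
    have "\<not> bval (positive (var ''m'')) (input n es ss f)"
      using True by (simp add: input_def array_def)
    then have "exec ((n + f + 2) ^ 5) (preserver_prog k) (input n es ss f) (1 + 1) (input n es ss f)"
      unfolding preserver_prog_def by (intro exec.CondFalse exec.Skip)
    moreover have "1 + 1 \<le> total_const * (f * n * card E + 1)"
      by (simp add: total_const_def \<open>E = {}\<close>)
    moreover have "output_edges k es (input n es ss f) = {}" using True by (simp add: output_edges_def)
    ultimately show ?thesis
      using \<open>E = {}\<close>
      by (intro exI[of _ "1 + 1"] exI[of _ "input n es ss f"] exI[of _ "{}"])
        (auto simp: ft_sourcewise_preserver_def ft_pairwise_preserver_def)
  next
    case False
    then obtain T s where Ts: "exec ((n + f + 2) ^ 5) (preserver_prog k) (input n es ss f) T s"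
      "T \<le> total_const * (f * n * card E)"
      "ft_sourcewise_preserver f {..<n} E S (output_edges k es s)"
      "real (card (output_edges k es s)) \<le> real n * size_bound n f (card S)"
      using preserver_prog_correct[OF G f _ ss(1) les] S ss(2) unfolding halts_def by auto
    have "real (card (output_edges k es s)) \<le> ?bound"
      using Ts(4) size_bound_le[OF f, of n "card S"] by simp
    moreover have "T \<le> total_const * (f * n * card E + 1)" using Ts(2) by simp
    ultimately show ?thesis using Ts by blast
  qed
qed

end
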